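(* Let $X^\bullet$ be an augmented cosimplicial space, equipped with a (continuous) map $$\langle f\rangle: X^{f^{-1}(1)}\times X^{f^{-1}(2)}\to X^T$$ for each finite totally ordered set $T$ and each function $f:T\to\{1,2\}$ (not necessarily order-preserving or surjective; $f^{-1}(i)$ has the order induced from $T$). Suppose the following conditions hold. (i) (Compatibility with cosimplicial operators.) For every order-preserving map $\phi:T\to T'$ of finite totally ordered sets and all functions $f:T\to\{1,2\}$, $g:T'\to\{1,2\}$ with $g\circ\phi=f$, writing $\phi_i:f^{-1}(i)\to g^{-1}(i)$ for the restriction of $\phi$, one has $\phi_*\circ\langle f\rangle=\langle g\rangle\circ\big((\phi_1)_*\times(\phi_2)_*\big)$. (ii) (Commutativity.) For every $f:T\to\{1,2\}$ one has $\langle f\rangle(x,y)=\langle t\circ f\rangle(y,x)$ for all $x\in X^{f^{-1}(1)}$, $y\in X^{f^{-1}(2)}$, where $t$ is the transposition of $\{1,2\}$. (iii) (Associativity.) Let $\alpha,\beta:\{1,2,3\}\to\{1,2\}$ be given by $\alpha(1)=\alpha(2)=1$, $\alpha(3)=2$ and $\beta(1)=1$, $\beta(2)=\beta(3)=2$. For every function $g:T\to\{1,2,3\}$, let $g_1$ be the restriction of $g$ to $g^{-1}\{1,2\}$ and $g_2$ the restriction of $g$ to $g^{-1}\{2,3\}$ (where the target $\{2,3\}$ is identified with $\{1,2\}$ in the order-preserving way). Then $$\langle\alpha\circ g\rangle\big(\langle g_1\rangle(x,y),z\big)=\langle\beta\circ g\rangle\big(x,\langle g_2\rangle(y,z)\big)$$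 for all $x\in X^{g^{-1}(1)}$, $y\in X^{g^{-1}(2)}$, $z\in X^{g^{-1}(3)}$. (iv) (Unit.) There is an element $\varepsilon\in X^\emptyset$ such that, for every $T$ and every $x\in X^T$: if $f:T\to\{1,2\}$ takes all of $T$ to $1$ then $\langle f\rangle(x,\varepsilon)=x$, and if $f$ takes all of $T$ to $2$ then $\langle f\rangle(\varepsilon,x)=x$. Then $\operatorname{Tot}(X^\bullet)$ is an $E_\infty$ space.
   Context: $\Delta_+$ is the category of finite totally ordered sets (including the empty set) and order-preserving maps. An augmented cosimplicial space is a functor $X^\bullet$ from $\Delta_+$ to spaces; its value at $T$ is written $X^T$, and the map induced by an order-preserving $\phi:T\to T'$ is written $\phi_*:X^T\to X^{T'}$. $\Delta^\bullet$ denotes the augmented cosimplicial space taking $T$ to $\Delta^T$, the simplex with vertex set $T$ (the convex hull of $T$), with $\Delta^\emptyset=\emptyset$. $\operatorname{Tot}(X^\bullet)$ is the space $\operatorname{Hom}_{\Delta_+}(\Delta^\bullet,X^\bullet)$ of maps of augmented cosimplicial spaces; equivalently it is the usual totalization of the restriction of $X^\bullet$ to nonempty finite totally ordered sets. An operad is a (symmetric) operad in topological spaces in the sense of May: spaces $\mathcal O(k)$, $k\ge 0$, with right $\Sigma_k$-actions, a unit $1\in\mathcal O(1)$ and composition maps $\gamma:\mathcal O(k)\times\mathcal O(j_1)\times\cdots\times\mathcal O(j_k)\to\mathcal O(j_1+\cdots+j_k)$ that are associative, unital and equivariant. ($\mathcal O(0)$ is not required to be a point.) An action of $\mathcal O$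 on a space $Y$ is a family of maps $\theta:\mathcal O(k)\times Y^k\to Y$, $k\ge 0$, compatible with the unit, with $\gamma$, and factoring through $\mathcal O(k)\times_{\Sigma_k}Y^k$. An $E_\infty$ operad is an operad $\mathcal O$ such that every $\mathcal O(k)$ is weakly equivalent to a point. An $E_\infty$ space is a space with an action of an $E_\infty$ operad. *)

theory Defs
  imports "HOL-Analysis.Analysis" "HOL-Combinatorics.Permutations"
begin

section \<open>Finite totally ordered sets\<close>

text \<open>
  A finite totally ordered set is given by its reflexive order relation \<open>r\<close>; the underlying set is
  \<open>Field r\<close>, and \<open>{}\<close> is the empty ordered set. Elements are drawn from \<open>nat\<close> (with an arbitrary
  order, not necessarily the standard one), which yields every finite totally ordered set up to
  isomorphism. Maps are extensional, so that a map is determined by its values on the domain.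
\<close>

definition fin_ord :: "nat rel set" where
  "fin_ord = {r. finite (Field r) \<and> Linear_order r}"

definition ord_hom :: "nat rel \<Rightarrow> nat rel \<Rightarrow> (nat \<Rightarrow> nat) set" where
  "ord_hom r r' = {\<phi> \<in> Field r \<rightarrow>\<^sub>E Field r'. \<forall>(x, y) \<in> r. (\<phi> x, \<phi> y) \<in> r'}"

definition preimage_ord :: "nat rel \<Rightarrow> (nat \<Rightarrow> nat) \<Rightarrow> nat set \<Rightarrow> nat rel" where
  "preimage_ord r f S = Restr r {x \<in> Field r. f x \<in> S}"

section \<open>Augmented cosimplicial spaces and totalization\<close>

locale augmented_cosimplicial_space =
  fixes X :: "nat rel \<Rightarrow> 'a topology"
    and push :: "nat rel \<Rightarrow> nat rel \<Rightarrow> (nat \<Rightarrow> nat) \<Rightarrow> 'a \<Rightarrow> 'a"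
  assumes push_continuous:
      "\<lbrakk>r \<in> fin_ord; r' \<in> fin_ord; \<phi> \<in> ord_hom r r'\<rbrakk>
        \<Longrightarrow> continuous_map (X r) (X r') (push r r' \<phi>)"
    and push_id:
      "\<lbrakk>r \<in> fin_ord; x \<in> topspace (X r)\<rbrakk> \<Longrightarrow> push r r (\<lambda>i\<in>Field r. i) x = x"
    and push_compose:
      "\<lbrakk>r \<in> fin_ord; r' \<in> fin_ord; r'' \<in> fin_ord; \<phi> \<in> ord_hom r r'; \<psi> \<in> ord_hom r' r'';
        x \<in> topspace (X r)\<rbrakk>
        \<Longrightarrow> push r r'' (compose (Field r) \<psi> \<phi>) x = push r' r'' \<psi> (push r r' \<phi> x)"

text \<open>The simplex with vertex set \<open>Field r\<close>, in barycentric coordinates extended by zero.\<close>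

definition simplex_space :: "nat rel \<Rightarrow> (nat \<Rightarrow> real) topology" where
  "simplex_space r = subtopology (product_topology (\<lambda>_. euclideanreal) UNIV)
     {p. (\<forall>i. 0 \<le> p i) \<and> (\<forall>i. i \<notin> Field r \<longrightarrow> p i = 0) \<and> (\<Sum>i\<in>Field r. p i) = 1}"

definition simplex_push :: "nat rel \<Rightarrow> nat rel \<Rightarrow> (nat \<Rightarrow> nat) \<Rightarrow> (nat \<Rightarrow> real) \<Rightarrow> nat \<Rightarrow> real" where
  "simplex_push r r' \<phi> p = (\<lambda>j. \<Sum>i\<in>{i \<in> Field r. \<phi> i = j}. p i)"

definition compact_open_topology :: "'a topology \<Rightarrow> 'b topology \<Rightarrow> ('a \<Rightarrow> 'b) topology" where
  "compact_open_topology A B = topology_generated_by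
     {{f \<in> extensional (topspace A). continuous_map A B f \<and> f ` K \<subseteq> U} | K U.
        compactin A K \<and> openin B U}"

text \<open>Natural transformations from \<open>simplex_space\<close> to \<open>X\<close>, as a subspace of the product of the
  mapping spaces.\<close>

definition Tot ::
    "(nat rel \<Rightarrow> 'a topology) \<Rightarrow> (nat rel \<Rightarrow> nat rel \<Rightarrow> (nat \<Rightarrow> nat) \<Rightarrow> 'a \<Rightarrow> 'a)
      \<Rightarrow> (nat rel \<Rightarrow> (nat \<Rightarrow> real) \<Rightarrow> 'a) topology" where
  "Tot X push = subtopology
     (product_topology (\<lambda>r. compact_open_topology (simplex_space r) (X r)) fin_ord)
     {h. \<forall>r \<in> fin_ord. \<forall>r' \<in> fin_ord. \<forall>\<phi> \<in> ord_hom r r'. \<forall>p \<in> topspace (simplex_space r).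
           h r' (simplex_push r r' \<phi> p) = push r r' \<phi> (h r p)}"

section \<open>Weak equivalences\<close>

definition cube :: "nat \<Rightarrow> (nat \<Rightarrow> real) topology" where
  "cube n = product_topology (\<lambda>_. top_of_set {0..1}) {..<n}"

definition cube_boundary :: "nat \<Rightarrow> (nat \<Rightarrow> real) set" where
  "cube_boundary n = {p \<in> topspace (cube n). \<exists>i<n. p i = 0 \<or> p i = 1}"

text \<open>Elements of the \<open>n\<close>-th homotopy group at \<open>x\<close> are the classes of \<open>spheroids n X x\<close> under
  \<open>spheroid_homotopic n X x\<close>.\<close>

definition spheroids :: "nat \<Rightarrow> 'a topology \<Rightarrow> 'a \<Rightarrow> ((nat \<Rightarrow> real) \<Rightarrow> 'a) set" where
  "spheroids n X x = {g. continuous_map (cube n) X g \<and> (\<forall>p \<in> cube_boundary n. g p = x)}"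

definition spheroid_homotopic ::
    "nat \<Rightarrow> 'a topology \<Rightarrow> 'a \<Rightarrow> ((nat \<Rightarrow> real) \<Rightarrow> 'a) \<Rightarrow> ((nat \<Rightarrow> real) \<Rightarrow> 'a) \<Rightarrow> bool" where
  "spheroid_homotopic n X x =
     homotopic_with (\<lambda>g. \<forall>p \<in> cube_boundary n. g p = x) (cube n) X"

text \<open>The second and third conjuncts say that \<open>f\<close> is injective and surjective on path components,
  the last one that it is so on all homotopy groups.\<close>

definition weak_homotopy_equivalence :: "'a topology \<Rightarrow> 'b topology \<Rightarrow> ('a \<Rightarrow> 'b) \<Rightarrow> bool" where
  "weak_homotopy_equivalence X Y f \<longleftrightarrow>
     continuous_map X Y f \<and>
     (\<forall>x \<in> topspace X. \<forall>x' \<in> topspace X.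
        path_component_of Y (f x) (f x') \<longrightarrow> path_component_of X x x') \<and>
     (\<forall>y \<in> topspace Y. \<exists>x \<in> topspace X. path_component_of Y (f x) y) \<and>
     (\<forall>n \<ge> 1. \<forall>x \<in> topspace X.
        (\<forall>g \<in> spheroids n X x. \<forall>g' \<in> spheroids n X x.
           spheroid_homotopic n Y (f x) (f \<circ> g) (f \<circ> g') \<longrightarrow> spheroid_homotopic n X x g g') \<and>
        (\<forall>k \<in> spheroids n Y (f x). \<exists>g \<in> spheroids n X x.
           spheroid_homotopic n Y (f x) (f \<circ> g) k))"

definition weakly_equivalent_to_point :: "'a topology \<Rightarrow> bool" where
  "weakly_equivalent_to_point X \<longleftrightarrow>
     weak_homotopy_equivalence X (discrete_topology {()}) (\<lambda>_. ())"

section \<open>Operads\<close>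

text \<open>
  Indices are zero-based: a \<open>k\<close>-tuple is an extensional function on \<open>{..<k}\<close>, and \<open>\<Sigma>\<^sub>k\<close> consists of
  the \<open>\<sigma>\<close> with \<open>\<sigma> permutes {..<k}\<close>. A list \<open>js\<close> cuts \<open>{..<sum_list js}\<close> into consecutive blocks,
  block \<open>s\<close> having size \<open>js ! s\<close> and starting at \<open>offset js s\<close>.
\<close>

definition offset :: "nat list \<Rightarrow> nat \<Rightarrow> nat" where
  "offset js s = sum_list (take s js)"

definition block :: "nat list \<Rightarrow> (nat \<Rightarrow> 'a) \<Rightarrow> nat \<Rightarrow> nat \<Rightarrow> 'a" where
  "block js y s = (\<lambda>i\<in>{..<js ! s}. y (offset js s + i))"

definition permute_tuple :: "nat \<Rightarrow> (nat \<Rightarrow> nat) \<Rightarrow> (nat \<Rightarrow> 'a) \<Rightarrow> nat \<Rightarrow> 'a" where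
  "permute_tuple k \<sigma> y = (\<lambda>i\<in>{..<k}. y (inv \<sigma> i))"

definition permute_blocks :: "(nat \<Rightarrow> nat) \<Rightarrow> nat list \<Rightarrow> nat list" where
  "permute_blocks \<sigma> js = map (\<lambda>p. js ! inv \<sigma> p) [0..<length js]"

text \<open>\<open>block_perm \<sigma> js\<close> is May's \<open>\<sigma>(j\<^sub>1, \<dots>, j\<^sub>k)\<close>: it moves the \<open>i\<close>-th element of block \<open>s\<close> of \<open>js\<close>
  to the \<open>i\<close>-th element of block \<open>\<sigma> s\<close> of \<open>permute_blocks \<sigma> js\<close>.\<close>

definition block_perm :: "(nat \<Rightarrow> nat) \<Rightarrow> nat list \<Rightarrow> nat \<Rightarrow> nat" where
  "block_perm \<sigma> js n =
     (if n < sum_list js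
      then concat (map (\<lambda>s. map (\<lambda>i. offset (permute_blocks \<sigma> js) (\<sigma> s) + i) [0..<js ! s])
             [0..<length js]) ! n
      else n)"

text \<open>\<open>sum_perm \<tau> js\<close> is May's \<open>\<tau>\<^sub>1 \<oplus> \<dots> \<oplus> \<tau>\<^sub>k\<close>: it acts on block \<open>s\<close> by \<open>\<tau> s\<close>.\<close>

definition sum_perm :: "(nat \<Rightarrow> nat \<Rightarrow> nat) \<Rightarrow> nat list \<Rightarrow> nat \<Rightarrow> nat" where
  "sum_perm \<tau> js n =
     (if n < sum_list js
      then concat (map (\<lambda>s. map (\<lambda>i. offset js s + \<tau> s i) [0..<js ! s]) [0..<length js]) ! n
      else n)"

text \<open>
  \<open>act k c \<sigma>\<close> is the right action \<open>c\<sigma>\<close>, and \<open>\<gamma> js\<close> is the composition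
  \<open>\<O>(k) \<times> \<O>(j\<^sub>1) \<times> \<dots> \<times> \<O>(j\<^sub>k) \<rightarrow> \<O>(j\<^sub>1 + \<dots> + j\<^sub>k)\<close> with \<open>js = [j\<^sub>1, \<dots>, j\<^sub>k]\<close>. In
  \<open>comp_assoc\<close> the arities of the innermost operations are grouped as a list of lists \<open>mss\<close>.
\<close>

locale operad =
  fixes Op :: "nat \<Rightarrow> 'o topology"
    and act :: "nat \<Rightarrow> 'o \<Rightarrow> (nat \<Rightarrow> nat) \<Rightarrow> 'o"
    and one :: 'o
    and \<gamma> :: "nat list \<Rightarrow> 'o \<times> (nat \<Rightarrow> 'o) \<Rightarrow> 'o"
  assumes act_continuous:
      "\<sigma> permutes {..<k} \<Longrightarrow> continuous_map (Op k) (Op k) (\<lambda>c. act k c \<sigma>)"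
    and act_id: "c \<in> topspace (Op k) \<Longrightarrow> act k c id = c"
    and act_comp:
      "\<lbrakk>c \<in> topspace (Op k); \<sigma> permutes {..<k}; \<sigma>' permutes {..<k}\<rbrakk>
        \<Longrightarrow> act k (act k c \<sigma>) \<sigma>' = act k c (\<sigma> \<circ> \<sigma>')"
    and one_in: "one \<in> topspace (Op 1)"
    and comp_continuous:
      "continuous_map
         (prod_topology (Op (length js)) (product_topology (\<lambda>i. Op (js ! i)) {..<length js}))
         (Op (sum_list js)) (\<gamma> js)"
    and comp_one_left:
      "c \<in> topspace (Op k) \<Longrightarrow> \<gamma> [k] (one, \<lambda>i\<in>{..<1}. c) = c"
    and comp_one_right:
      "c \<in> topspace (Op k) \<Longrightarrow> \<gamma> (replicate k 1) (c, \<lambda>i\<in>{..<k}. one) = c"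
    and comp_assoc:
      "\<lbrakk>c \<in> topspace (Op (length mss));
        d \<in> (\<Pi>\<^sub>E s\<in>{..<length mss}. topspace (Op (length (mss ! s))));
        e \<in> (\<Pi>\<^sub>E i\<in>{..<length (concat mss)}. topspace (Op (concat mss ! i)))\<rbrakk>
        \<Longrightarrow> \<gamma> (concat mss) (\<gamma> (map length mss) (c, d), e) =
            \<gamma> (map sum_list mss)
              (c, \<lambda>s\<in>{..<length mss}. \<gamma> (mss ! s) (d s, block (map length mss) e s))"
    and comp_equivariant_outer:
      "\<lbrakk>c \<in> topspace (Op (length js));
        d \<in> (\<Pi>\<^sub>E s\<in>{..<length js}. topspace (Op (js ! s)));
        \<sigma> permutes {..<length js}\<rbrakk>
        \<Longrightarrow> \<gamma> js (act (length js) c \<sigma>, d) =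
            act (sum_list js)
              (\<gamma> (permute_blocks \<sigma> js) (c, permute_tuple (length js) \<sigma> d))
              (block_perm \<sigma> js)"
    and comp_equivariant_inner:
      "\<lbrakk>c \<in> topspace (Op (length js));
        d \<in> (\<Pi>\<^sub>E s\<in>{..<length js}. topspace (Op (js ! s)));
        \<And>s. s < length js \<Longrightarrow> \<tau> s permutes {..<js ! s}\<rbrakk>
        \<Longrightarrow> \<gamma> js (c, \<lambda>s\<in>{..<length js}. act (js ! s) (d s) (\<tau> s)) =
            act (sum_list js) (\<gamma> js (c, d)) (sum_perm \<tau> js)"

locale operad_action = operad Op act one \<gamma>
  for Op :: "nat \<Rightarrow> 'o topology"
    and act :: "nat \<Rightarrow> 'o \<Rightarrow> (nat \<Rightarrow> nat) \<Rightarrow> 'o"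
    and one :: 'o
    and \<gamma> :: "nat list \<Rightarrow> 'o \<times> (nat \<Rightarrow> 'o) \<Rightarrow> 'o" +
  fixes Y :: "'y topology"
    and \<theta> :: "nat \<Rightarrow> 'o \<times> (nat \<Rightarrow> 'y) \<Rightarrow> 'y"
  assumes action_continuous:
      "continuous_map (prod_topology (Op k) (product_topology (\<lambda>_. Y) {..<k})) Y (\<theta> k)"
    and action_one:
      "u \<in> topspace Y \<Longrightarrow> \<theta> 1 (one, \<lambda>i\<in>{..<1}. u) = u"
    and action_comp:
      "\<lbrakk>c \<in> topspace (Op (length js));
        d \<in> (\<Pi>\<^sub>E s\<in>{..<length js}. topspace (Op (js ! s)));
        y \<in> {..<sum_list js} \<rightarrow>\<^sub>E topspace Y\<rbrakk>
        \<Longrightarrow> \<theta> (sum_list js) (\<gamma> js (c, d), y) =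
            \<theta> (length js) (c, \<lambda>s\<in>{..<length js}. \<theta> (js ! s) (d s, block js y s))"
    and action_equivariant:
      "\<lbrakk>c \<in> topspace (Op k); y \<in> {..<k} \<rightarrow>\<^sub>E topspace Y; \<sigma> permutes {..<k}\<rbrakk>
        \<Longrightarrow> \<theta> k (act k c \<sigma>, y) = \<theta> k (c, permute_tuple k \<sigma> y)"

locale E_infinity_operad = operad +
  assumes weakly_equivalent_to_point: "weakly_equivalent_to_point (Op k)"

text \<open>
  The existential quantifier needs a fixed carrier type for the operad. The type
  \<open>nat \<Rightarrow> real \<Rightarrow> real\<close> has cardinality \<open>2\<^sup>\<cc>\<close>, \<open>\<cc>\<close> being that of the continuum, and this loses no
  generality: as \<open>(2\<^sup>\<cc>)\<^sup>\<cc> = 2\<^sup>\<cc>\<close>, closing up under the operad structure and under chosen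
  null-homotopies of maps from spheres (\<open>\<cc>\<^sup>+\<close> times) shows that every E-infinity operad, of whatever
  size, has an E-infinity suboperad whose spaces have cardinality at most \<open>2\<^sup>\<cc>\<close>.
\<close>

definition E_infinity_space :: "'y topology \<Rightarrow> bool" where
  "E_infinity_space Y \<longleftrightarrow>
     (\<exists>(Op :: nat \<Rightarrow> (nat \<Rightarrow> real \<Rightarrow> real) topology) act one \<gamma> \<theta>.
        E_infinity_operad Op act one \<gamma> \<and> operad_action Op act one \<gamma> Y \<theta>)"

end

theory Submission
  imports Defs "HOL-Algebra.FiniteProduct"
begin

text \<open>The operad consists of monotone lattice paths: an operation of arity \<open>k\<close> is a path in
  \<open>[0, 1]\<^sup>k\<close> from \<open>(0, \<dots>, 0)\<close> to \<open>(1, \<dots>, 1)\<close> that moves in one coordinate at a time and has finitely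
  many corners, and composition substitutes paths coordinatewise, as in the coendomorphism operad of
  the interval. Such a path can be contracted by following it up to time \<open>u\<close> and then completing it
  by a standard path.

  A point of \<open>\<Delta>\<^sup>T\<close> is a partition of \<open>[0, 1]\<close> into intervals indexed by \<open>T\<close>. Refining it by the corners of
  a path \<open>c\<close> gives a finite ordered set \<open>S\<close> with an order-preserving map \<open>\<phi> : S \<rightarrow> T\<close> and a function
  \<open>f : S \<rightarrow> {1, \<dots>, k}\<close> recording which coordinate moves; the increments of the \<open>i\<close>-th coordinate are a point
  \<open>q\<^sub>i\<close> of the simplex on \<open>f\<^sup>-\<^sup>1(i)\<close>. Then \<open>c\<close> sends \<open>(h\<^sub>1, \<dots>, h\<^sub>k)\<close> to the map whose value at the given point is
  \<open>\<phi>\<^sub>* \<langle>f\<rangle>(h\<^sub>1(q\<^sub>1), \<dots>, h\<^sub>k(q\<^sub>k))\<close>, with the iterated bracket. Any two choices of \<open>S\<close> have a common refinement, so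
  compatibility with the cosimplicial operators makes this independent of \<open>S\<close>.\<close>

section \<open>Contractible spaces\<close>

text \<open>The main obstacle is continuity of the action: there is no evident continuous choice of
  a subdivision, since intervals shrink to points and the combinatorial type
  \<open>(S, f, \<phi>)\<close> jumps. Independence of the choice gets around this. For a closed set
  \<open>C\<close> of values, the parameters with value in \<open>C\<close> are obtained from the
  pairs (parameter, interval endpoints) of a fixed type with value in \<open>C\<close>, which form a
  closed set, by forgetting the endpoints. These range over a compact cube, so the projection is
  closed, and a finite union over types remains. Two features of the definitions come from this
  argument. Subdivisions may contain degenerate intervals, so that being one is a closed condition.
  An operation carries a bound on its number of corners, because operations are topologized
  pointwise and a path with few corners can be a limit of paths with more and more corners; the
  bound leaves finitely many types locally. It is a real number and not an integer, since it adds
  under composition and has to move continuously to a single value when the spaces are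
  contracted.\<close>

lemma continuous_map_real_prod [continuous_intros]:
  fixes f :: "'b \<Rightarrow> 'a \<Rightarrow> real"
  assumes "\<And>i. i \<in> I \<Longrightarrow> continuous_map X euclideanreal (f i)"
  shows "continuous_map X euclideanreal (\<lambda>x. \<Prod>i\<in>I. f i x)"
  using assms
  by (induction I rule: infinite_finite_induct) (auto intro!: continuous_intros)

definition clip :: "real \<Rightarrow> real" where
  "clip x = max 0 (min 1 x)"

lemma clip_simps [simp]: "0 \<le> clip x" "clip x \<le> 1" "x \<le> 0 \<Longrightarrow> clip x = 0"
  "1 \<le> x \<Longrightarrow> clip x = 1" "0 \<le> x \<Longrightarrow> x \<le> 1 \<Longrightarrow> clip x = x" "clip (clip x) = clip x"
  by (auto simp: clip_def)

lemma continuous_map_clip [continuous_intros]: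
  "continuous_map Z euclideanreal f \<Longrightarrow> continuous_map Z euclideanreal (\<lambda>z. clip (f z))"
  unfolding clip_def by (intro continuous_intros)

text \<open>A null homotopy \<open>H\<close> moves the base point, so it is applied to a spheroid made constant on a
  collar of the boundary and slowed down there by the factor \<open>\<delta>\<close>. The end map
  \<open>\<lambda>p. H (x, \<delta> p)\<close> does not depend on the spheroid.\<close>

definition collar :: "nat \<Rightarrow> (nat \<Rightarrow> real) \<Rightarrow> real" where
  "collar n p = (\<Prod>i<n. clip (4 * p i) * clip (4 * (1 - p i)))"

text \<open>Before clipping this interpolates linearly in \<open>t\<close> between the identity of
  the cube and the map at \<open>t = 1\<close> that stretches the middle cube with sides [1/4, 3/4]
  onto the whole cube; clipping sends the rest to the boundary. The factor 4 in
  \<open>collar\<close> fits this: \<open>collar n\<close> is 1 exactly on the middle cube.\<close>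

definition expand :: "nat \<Rightarrow> real \<Rightarrow> (nat \<Rightarrow> real) \<Rightarrow> nat \<Rightarrow> real" where
  "expand n t p = (\<lambda>i\<in>{..<n}. clip ((1 + t) * p i - t / 2))"

lemma continuous_map_cube_coord:
  "i < n \<Longrightarrow> continuous_map (cube n) euclideanreal (\<lambda>p. p i)"
  unfolding cube_def
  using continuous_map_product_projection[of i "{..<n}" "\<lambda>_. top_of_set {0..1::real}"]
  by (simp add: continuous_map_in_subtopology)

lemma continuous_map_into_cube:
  assumes "\<And>i. i < n \<Longrightarrow> continuous_map Z euclideanreal (\<lambda>z. f z i)"
    and "\<And>z i. z \<in> topspace Z \<Longrightarrow> i < n \<Longrightarrow> f z i \<in> {0..1}"
    and "\<And>z. z \<in> topspace Z \<Longrightarrow> f z \<in> extensional {..<n}"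
  shows "continuous_map Z (cube n) f"
  unfolding cube_def continuous_map_componentwise
  using assms by (auto simp: continuous_map_in_subtopology)

lemma collar_range: "0 \<le> collar n p" "collar n p \<le> 1"
  unfolding collar_def by (auto intro!: prod_nonneg prod_le_1 mult_le_one)

lemma collar_boundary: "p \<in> cube_boundary n \<Longrightarrow> collar n p = 0"
proof -
  assume "p \<in> cube_boundary n"
  then obtain i where "i < n" "p i = 0 \<or> p i = 1"
    by (auto simp: cube_boundary_def)
  then show ?thesis
    unfolding collar_def by (intro prod_zero) (auto intro!: bexI[of _ i])
qed

lemma expand_boundary:
  assumes "p \<in> cube_boundary n" "0 \<le> t"
  shows "expand n t p \<in> cube_boundary n"
  using assms unfolding expand_def cube_boundary_def cube_def
  by (fastforce simp: PiE_iff field_simps)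

text \<open>Wherever the null homotopy is slowed down, the stretched spheroid already sits at the
  base point. This makes the end map independent of the spheroid: elsewhere the factor is 1 and
  everything has been collapsed to one point.\<close>

lemma collar_less_one:
  assumes "p \<in> topspace (cube n)" "collar n p \<noteq> 1"
  shows "expand n 1 p \<in> cube_boundary n"
proof -
  obtain i where i: "i < n" "clip (4 * p i) * clip (4 * (1 - p i)) \<noteq> 1"
    using assms(2) unfolding collar_def by (metis (mono_tags, lifting) lessThan_iff prod.neutral)
  then have "4 * p i < 1 \<or> 4 * (1 - p i) < 1"
    by (metis clip_simps(4) linorder_not_le mult_1)
  then have "2 * p i - 1 / 2 \<le> 0 \<or> 2 * p i - 1 / 2 \<ge> 1"
    by auto
  with i(1) show ?thesis
    unfolding cube_boundary_def expand_def cube_def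
    by (auto simp: PiE_iff intro!: exI[of _ i])
qed

lemma contractible_imp_weakly_equivalent_to_point:
  assumes "contractible_space X" "topspace X \<noteq> {}"
  shows "weakly_equivalent_to_point X"
proof -
  obtain x0 :: 'a where "homotopic_with (\<lambda>_. True) X X id (\<lambda>_. x0)"
    using assms(1) by (auto simp: contractible_space_def)
  then obtain H :: "real \<times> 'a \<Rightarrow> 'a" where H: "continuous_map (prod_topology (top_of_set {0..1}) X) X H"
    and H0: "\<And>x. H (0, x) = x" and H1: "\<And>x. H (1, x) = x0"
    unfolding homotopic_with_def by (auto; metis)
  have pc: "path_component_of X x x'" if "x \<in> topspace X" "x' \<in> topspace X" for x x'
    using contractible_imp_path_connected_space[OF assms(1)] that
    by (simp add: path_connected_space_iff_path_component)
  have null: "spheroid_homotopic n X x g (\<lambda>p. H (collar n p, g (expand n 1 p)))"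
    if g: "g \<in> spheroids n X x" for n x g
  proof -
    have gc: "continuous_map (cube n) X g" and gb: "\<And>p. p \<in> cube_boundary n \<Longrightarrow> g p = x"
      using g by (auto simp: spheroids_def)
    let ?I = "top_of_set {0..1::real}"
    let ?Z = "prod_topology ?I (cube n)"
    have fstc: "continuous_map ?Z euclideanreal fst"
      using continuous_map_fst[of ?I "cube n"] by (simp add: continuous_map_in_subtopology)
    have co: "continuous_map ?Z euclideanreal (\<lambda>z. snd z i)" if "i < n" for i
      using continuous_map_compose[OF continuous_map_snd continuous_map_cube_coord[OF that]]
      by (simp add: comp_def)
    have ex: "continuous_map ?Z (cube n) (\<lambda>z. expand n (fst z) (snd z))"
      by (rule continuous_map_into_cube)
         (auto simp: expand_def intro!: continuous_intros fstc co)
    have ex1: "continuous_map ?Z (cube n) (\<lambda>z. expand n 1 (snd z))"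
      by (rule continuous_map_into_cube)
         (auto simp: expand_def intro!: continuous_intros fstc co)
    have cl: "continuous_map ?Z ?I (\<lambda>z. fst z * collar n (snd z))"
      unfolding continuous_map_in_subtopology
    proof
      show "continuous_map ?Z euclideanreal (\<lambda>z. fst z * collar n (snd z))"
        unfolding collar_def by (auto intro!: continuous_intros fstc co)
    qed (auto simp: collar_range intro!: mult_le_one)
    have "spheroid_homotopic n X x g (\<lambda>p. g (expand n 1 p))"
      unfolding spheroid_homotopic_def
    proof (subst homotopic_with, goal_cases)
      case (1 h k) then show ?case by (auto simp: cube_boundary_def)
    next
      case 2
      have "expand n 0 p = p" if "p \<in> topspace (cube n)" for p
        using that unfolding expand_def cube_def by (fastforce simp: PiE_iff extensional_def)
      then show ?case
        by (intro exI[of _ "\<lambda>z. g (expand n (fst z) (snd z))"])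
           (auto intro!: continuous_map_compose[OF ex gc, unfolded comp_def] gb expand_boundary)
    qed
    \<comment> \<open>Running \<open>H\<close> only up to time \<open>collar n p\<close>, which
      vanishes on the boundary, keeps the boundary at the base point although \<open>H\<close> moves
      it.\<close>
    moreover have "spheroid_homotopic n X x
        (\<lambda>p. g (expand n 1 p)) (\<lambda>p. H (collar n p, g (expand n 1 p)))"
      unfolding spheroid_homotopic_def
    proof (subst homotopic_with, goal_cases)
      case (1 h k) then show ?case by (auto simp: cube_boundary_def)
    next
      case 2
      have "continuous_map ?Z X (\<lambda>z. H (fst z * collar n (snd z), g (expand n 1 (snd z))))"
        using continuous_map_compose[OF _ H, of ?Z
            "\<lambda>z. (fst z * collar n (snd z), g (expand n 1 (snd z)))"]
          cl continuous_map_compose[OF ex1 gc]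
        by (simp add: continuous_map_pairwise comp_def)
      then show ?case
        by (intro exI[of _ "\<lambda>z. H (fst z * collar n (snd z), g (expand n 1 (snd z)))"])
           (auto simp: H0 collar_boundary intro!: gb expand_boundary)
    qed
    ultimately show ?thesis
      unfolding spheroid_homotopic_def by (rule homotopic_with_trans)
  qed
  have any: "spheroid_homotopic n X x g g'"
    if g: "g \<in> spheroids n X x" and g': "g' \<in> spheroids n X x" for n x g g'
  proof -
    have eq: "H (collar n p, k (expand n 1 p)) = H (collar n p, x)"
      if "p \<in> topspace (cube n)" "k \<in> spheroids n X x" for p k
      using that collar_less_one[of p n] H1 by (cases "collar n p = 1") (auto simp: spheroids_def)
    have h: "spheroid_homotopic n X x g (\<lambda>p. H (collar n p, x))" if "g \<in> spheroids n X x" for g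
      unfolding spheroid_homotopic_def
      by (rule homotopic_with_eq[OF null[OF that, unfolded spheroid_homotopic_def]])
         (auto simp: eq that cube_boundary_def)
    show ?thesis
      using h[OF g] h[OF g'] unfolding spheroid_homotopic_def
      by (meson homotopic_with_symD homotopic_with_trans)
  qed
  have const: "(\<lambda>_. x) \<in> spheroids n X x" if "x \<in> topspace X" for x n
    using that by (simp add: spheroids_def)
  have pt: "continuous_map Z (discrete_topology {()}) k" for Z :: "'b topology" and k
  proof -
    have "k = (\<lambda>_. ())" by auto
    then show ?thesis by simp
  qed
  show ?thesis
    unfolding weakly_equivalent_to_point_def weak_homotopy_equivalence_def
  proof (intro conjI ballI allI impI)
    fix y :: unit
    show "\<exists>x\<in>topspace X. path_component_of (discrete_topology {()}) () y"
      using assms(2) unfolding ex_in_conv[symmetric] by (auto simp: path_component_of_refl)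
  next
    fix n x k assume "x \<in> topspace X"
    then show "\<exists>g\<in>spheroids n X x.
        spheroid_homotopic n (discrete_topology {()}) () ((\<lambda>_. ()) \<circ> g) k"
      by (intro bexI[OF _ const]) (auto simp: spheroid_homotopic_def intro!: homotopic_with_equal pt)
  qed (simp_all add: any pc)
qed

section \<open>The compact-open topology\<close>

text \<open>Taking \<open>K\<close> empty makes the set of all extensional continuous maps
  subbasic.\<close>

lemma topspace_compact_open [simp]:
  "topspace (compact_open_topology A B) =
     {f \<in> extensional (topspace A). continuous_map A B f}"
  unfolding compact_open_topology_def topology_generated_by_topspace
  by (auto intro!: exI[of _ "{}"])

text \<open>One half of the exponential law, for arbitrary \<open>A\<close>. The parameters for
  which some point of \<open>K\<close> is sent outside \<open>U\<close> form the projection of a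
  closed set along the compact \<open>K\<close>, hence a closed set.\<close>

lemma continuous_map_into_compact_open:
  assumes F: "continuous_map (prod_topology Z A) B (\<lambda>(z, a). F z a)"
  shows "continuous_map Z (compact_open_topology A B) (\<lambda>z. restrict (F z) (topspace A))"
  unfolding compact_open_topology_def
proof (rule continuous_on_generated_topo)
  have fz: "continuous_map A B (restrict (F z) (topspace A))" if "z \<in> topspace Z" for z
  proof -
    have "continuous_map A (prod_topology Z A) (\<lambda>a. (z, a))"
      using that by (simp add: continuous_map_pairwise comp_def)
    from continuous_map_compose[OF this F] show ?thesis
      by (rule continuous_map_eq) (simp add: comp_def)
  qed
  then show "(\<lambda>z. restrict (F z) (topspace A)) ` topspace Z
      \<subseteq> \<Union> {{f \<in> extensional (topspace A). continuous_map A B f \<and> f ` K \<subseteq> U} | K U.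
        compactin A K \<and> openin B U}"
    by (auto intro!: exI[of _ "{}"])
  fix W
  assume "W \<in> {{f \<in> extensional (topspace A). continuous_map A B f \<and> f ` K \<subseteq> U} | K U.
        compactin A K \<and> openin B U}"
  then obtain K U where W: "W = {f \<in> extensional (topspace A). continuous_map A B f \<and> f ` K \<subseteq> U}"
    and K: "compactin A K" and U: "openin B U"
    by blast
  have KA: "K \<subseteq> topspace A"
    using K compactin_subset_topspace by blast
  let ?P = "prod_topology Z (subtopology A K)"
  have "continuous_map ?P B (\<lambda>(z, a). F z a)"
    using continuous_map_from_subtopology[OF F, of "UNIV \<times> K"]
    unfolding subtopology_Times subtopology_UNIV .
  then have "closedin ?P {w \<in> topspace ?P. (\<lambda>(z, a). F z a) w \<in> topspace B - U}"
    using U by (intro closedin_continuous_map_preimage) auto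
  then have "closedin Z (fst ` {w \<in> topspace ?P. (\<lambda>(z, a). F z a) w \<in> topspace B - U})"
    using closed_map_fst[of "subtopology A K" Z] K
    by (auto simp: closed_map_def compact_space_subtopology)
  then have "openin Z (topspace Z - fst ` {w \<in> topspace ?P. (\<lambda>(z, a). F z a) w \<in> topspace B - U})"
    by blast
  also have "topspace Z - fst ` {w \<in> topspace ?P. (\<lambda>(z, a). F z a) w \<in> topspace B - U}
      = (\<lambda>z. restrict (F z) (topspace A)) -` W \<inter> topspace Z"
  proof (intro equalityI subsetI)
    fix z
    assume z: "z \<in> topspace Z - fst ` {w \<in> topspace ?P. (\<lambda>(z, a). F z a) w \<in> topspace B - U}"
    have "F z a \<in> U" if "a \<in> K" for a
    proof -
      have "F z a \<in> topspace B"
        using continuous_map_funspace[OF F] z that KA by (fastforce simp: Pi_iff)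
      moreover have "F z a \<notin> topspace B - U"
      proof
        assume "F z a \<in> topspace B - U"
        then have "(z, a) \<in> {w \<in> topspace ?P. (\<lambda>(z, a). F z a) w \<in> topspace B - U}"
          using z that KA by auto
        then show False
          using z by (metis (no_types, lifting) DiffD2 fst_conv image_eqI)
      qed
      ultimately show ?thesis by blast
    qed
    then show "z \<in> (\<lambda>z. restrict (F z) (topspace A)) -` W \<inter> topspace Z"
      using z fz KA by (auto simp: W)
  next
    fix z
    assume "z \<in> (\<lambda>z. restrict (F z) (topspace A)) -` W \<inter> topspace Z"
    then show "z \<in> topspace Z - fst ` {w \<in> topspace ?P. (\<lambda>(z, a). F z a) w \<in> topspace B - U}"
      using KA by (auto simp: W)
  qed
  finally show "openin Z ((\<lambda>z. restrict (F z) (topspace A)) -` W \<inter> topspace Z)" .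
qed

text \<open>The other half of the exponential law. A compact Hausdorff space is regular, so a point
  of the preimage of \<open>U\<close> has a closed, hence compact, neighbourhood \<open>K\<close>
  inside that preimage, and \<open>K\<close> defines a subbasic set.\<close>

lemma continuous_map_compact_open_eval:
  assumes A: "compact_space A" "Hausdorff_space A"
  shows "continuous_map (prod_topology (compact_open_topology A B) A) B (\<lambda>(f, a). f a)"
  unfolding continuous_map_def
proof (intro conjI allI impI)
  show "(\<lambda>(f, a). f a) \<in> topspace (prod_topology (compact_open_topology A B) A) \<rightarrow> topspace B"
    by (auto simp: continuous_map_def)
  fix U assume U: "openin B U"
  show "openin (prod_topology (compact_open_topology A B) A)
     {w \<in> topspace (prod_topology (compact_open_topology A B) A). (\<lambda>(f, a). f a) w \<in> U}"
  proof (subst openin_subopen, safe, goal_cases)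
    case (1 f a)
    then have f: "f \<in> extensional (topspace A)" "continuous_map A B f" and a: "a \<in> topspace A" "f a \<in> U"
      by auto
    have "openin A {x \<in> topspace A. f x \<in> U}"
      using f U by (simp add: openin_continuous_map_preimage)
    moreover have "neighbourhood_base_of (closedin A) A"
      using A compact_Hausdorff_imp_regular_space neighbourhood_base_of_closedin by blast
    ultimately obtain V K where V: "openin A V" "closedin A K" "a \<in> V" "V \<subseteq> K"
      "K \<subseteq> {x \<in> topspace A. f x \<in> U}"
      using a unfolding neighbourhood_base_of by (metis (no_types, lifting) mem_Collect_eq)
    let ?N = "{g \<in> extensional (topspace A). continuous_map A B g \<and> g ` K \<subseteq> U}"
    have "openin (compact_open_topology A B) ?N"
      unfolding compact_open_topology_def
      using V(2) A(1) U closedin_compact_space by (intro topology_generated_by_Basis) blast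
    then have "openin (prod_topology (compact_open_topology A B) A) (?N \<times> V)"
      using V(1) by (simp add: openin_prod_Times_iff)
    moreover have "(f, a) \<in> ?N \<times> V"
      using f V by auto
    moreover have "?N \<times> V \<subseteq> {w \<in> topspace (prod_topology (compact_open_topology A B) A).
        (\<lambda>(f, a). f a) w \<in> U}"
      using V openin_subset[OF V(1)] by (auto simp: image_subset_iff subset_iff)
    ultimately show ?case
      by (intro exI[of _ "?N \<times> V"]) auto
  qed
qed

section \<open>Simplices as compact Hausdorff spaces\<close>

lemma simplex_space_topspace:
  "topspace (simplex_space r) =
     {p. (\<forall>i. 0 \<le> p i) \<and> (\<forall>i. i \<notin> Field r \<longrightarrow> p i = 0) \<and> (\<Sum>i\<in>Field r. p i) = 1}"
  by (simp add: simplex_space_def)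

lemma continuous_map_simplex_coord:
  "continuous_map (simplex_space r) euclideanreal (\<lambda>p. p i)"
  unfolding simplex_space_def
  by (intro continuous_map_from_subtopology continuous_map_product_projection) simp

lemma continuous_map_into_simplex:
  assumes "\<And>i. continuous_map Z euclideanreal (\<lambda>z. q z i)"
    and "\<And>z. z \<in> topspace Z \<Longrightarrow> q z \<in> topspace (simplex_space r)"
  shows "continuous_map Z (simplex_space r) q"
  using assms unfolding simplex_space_def
  by (auto simp: continuous_map_in_subtopology continuous_map_componentwise_UNIV)

lemma Hausdorff_simplex_space: "Hausdorff_space (simplex_space r)"
  unfolding simplex_space_def
  by (intro Hausdorff_space_subtopology) (simp add: Hausdorff_space_product_topology)

lemma closedin_Ball:
  assumes "\<And>i. i \<in> I \<Longrightarrow> closedin Z {z \<in> topspace Z. P i z}"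
  shows "closedin Z {z \<in> topspace Z. \<forall>i\<in>I. P i z}"
proof (cases "I = {}")
  case False
  have "{z \<in> topspace Z. \<forall>i\<in>I. P i z} = (\<Inter>i\<in>I. {z \<in> topspace Z. P i z})"
    using False by auto
  with False assms show ?thesis by (auto intro!: closedin_Inter)
qed simp

lemma closedin_conj:
  assumes "closedin Z {z \<in> topspace Z. P z}" "closedin Z {z \<in> topspace Z. Q z}"
  shows "closedin Z {z \<in> topspace Z. P z \<and> Q z}"
proof -
  have "{z \<in> topspace Z. P z \<and> Q z} = {z \<in> topspace Z. P z} \<inter> {z \<in> topspace Z. Q z}" by auto
  with assms show ?thesis by auto
qed

lemma closedin_le:
  fixes f g :: "'a \<Rightarrow> real"
  assumes "continuous_map Z euclideanreal f" "continuous_map Z euclideanreal g"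
  shows "closedin Z {z \<in> topspace Z. f z \<le> g z}"
proof -
  have "continuous_map Z euclideanreal (\<lambda>z. g z - f z)"
    using assms by (intro continuous_intros)
  from closedin_continuous_map_preimage[OF this, of "{0..}"] show ?thesis
    by simp
qed

lemma closedin_eq:
  fixes f :: "'a \<Rightarrow> real"
  assumes "continuous_map Z euclideanreal f"
  shows "closedin Z {z \<in> topspace Z. f z = c}"
  using closedin_continuous_map_preimage[OF assms, of "{c}"] by simp

text \<open>Barycentric coordinates are indexed by all of \<open>nat\<close>, so compactness comes
  from Tychonoff's theorem for the infinite cube, in which the simplex is closed.\<close>

lemma compact_simplex_space:
  assumes "finite (Field r)"
  shows "compact_space (simplex_space r)"
proof -
  let ?P = "product_topology (\<lambda>_::nat. euclideanreal) UNIV"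
  have coord: "continuous_map ?P euclideanreal (\<lambda>p. p i)" for i
    by (rule continuous_map_product_projection) simp
  have box: "compactin ?P (UNIV \<rightarrow>\<^sub>E {0..1})"
    by (simp add: compactin_PiE)
  have cl: "closedin ?P {p \<in> topspace ?P. (\<forall>i\<in>UNIV. 0 \<le> p i) \<and> (\<forall>i\<in>- Field r. p i = 0)
      \<and> (\<Sum>i\<in>Field r. p i) = 1}"
    by (intro closedin_conj closedin_Ball closedin_le closedin_eq continuous_map_sum coord assms
        continuous_map_const[THEN iffD2] disjI2) auto
  have le: "p i \<le> 1" if "\<forall>i. 0 \<le> p i" "\<forall>i. i \<notin> Field r \<longrightarrow> p i = 0" "(\<Sum>i\<in>Field r. p i) = 1"
    for p :: "nat \<Rightarrow> real" and i
    using that member_le_sum[of i "Field r" p] assms by (cases "i \<in> Field r") auto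
  show ?thesis
    unfolding simplex_space_def
    by (rule compact_space_subtopology, rule closed_compactin[OF box])
       (use cl le in \<open>auto simp: PiE_iff Ball_def\<close>)
qed

section \<open>Finite total orders\<close>

lemma fin_ordD:
  assumes "T \<in> fin_ord"
  shows "finite (Field T)" "Linear_order T" "\<And>x. x \<in> Field T \<Longrightarrow> (x, x) \<in> T"
    "\<And>x y. (x, y) \<in> T \<Longrightarrow> (y, x) \<in> T \<Longrightarrow> x = y"
    "\<And>x y z. (x, y) \<in> T \<Longrightarrow> (y, z) \<in> T \<Longrightarrow> (x, z) \<in> T"
    "\<And>x y. x \<in> Field T \<Longrightarrow> y \<in> Field T \<Longrightarrow> (x, y) \<in> T \<or> (y, x) \<in> T"
proof -
  have "finite (Field T)" and lin: "Linear_order T"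
    using assms by (auto simp: fin_ord_def)
  then show "finite (Field T)" "Linear_order T" by auto
  have "refl_on (Field T) T" "antisym T" "trans T" "total_on (Field T) T"
    using lin by (auto simp: linear_order_on_def partial_order_on_def preorder_on_def)
  then show "x \<in> Field T \<Longrightarrow> (x, x) \<in> T" "(x, y) \<in> T \<Longrightarrow> (y, x) \<in> T \<Longrightarrow> x = y"
    "(x, y) \<in> T \<Longrightarrow> (y, z) \<in> T \<Longrightarrow> (x, z) \<in> T"
    "x \<in> Field T \<Longrightarrow> y \<in> Field T \<Longrightarrow> (x, y) \<in> T \<or> (y, x) \<in> T" for x y z
    by (metis refl_onD antisymD transD total_on_def)+
qed

lemma Field_Restr: "T \<in> fin_ord \<Longrightarrow> A \<subseteq> Field T \<Longrightarrow> Field (Restr T A) = A"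
  using fin_ordD(3) by (fastforce simp: Field_def)

lemma Restr_fin_ord: "T \<in> fin_ord \<Longrightarrow> Restr T A \<in> fin_ord"
  using Linear_order_Restr finite_subset[of "Field (Restr T A)" "Field T"]
  by (auto simp: fin_ord_def Field_def)

lemma Restr_Field [simp]: "Restr T (Field T) = T"
  by (auto simp: Field_def)

lemma Field_preimage_ord [simp]:
  "T \<in> fin_ord \<Longrightarrow> Field (preimage_ord T f S) = {x \<in> Field T. f x \<in> S}"
  unfolding preimage_ord_def by (rule Field_Restr) auto

lemma preimage_ord_fin_ord [simp, intro]: "T \<in> fin_ord \<Longrightarrow> preimage_ord T f S \<in> fin_ord"
  unfolding preimage_ord_def by (rule Restr_fin_ord)

lemma preimage_ord_all: "f \<in> Field T \<rightarrow> S \<Longrightarrow> preimage_ord T f S = T"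
proof -
  assume "f \<in> Field T \<rightarrow> S"
  then have "{x \<in> Field T. f x \<in> S} = Field T" by auto
  then show ?thesis unfolding preimage_ord_def by simp
qed

lemma preimage_ord_Restr:
  assumes "T \<in> fin_ord" "A \<subseteq> Field T" "{x \<in> A. f x \<in> S} = B"
  shows "preimage_ord (Restr T A) f S = Restr T B"
  using assms by (auto simp: preimage_ord_def Field_Restr)

lemma empty_fin_ord [simp]: "{} \<in> fin_ord"
  by (simp add: fin_ord_def Field_def linear_order_on_def partial_order_on_def preorder_on_def
      refl_on_def antisym_def trans_def total_on_def)

lemma ord_homI:
  assumes "\<phi> \<in> extensional (Field r)" "\<And>x y. (x, y) \<in> r \<Longrightarrow> (\<phi> x, \<phi> y) \<in> r'"
    "r \<in> fin_ord"
  shows "\<phi> \<in> ord_hom r r'"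
proof -
  have "\<phi> x \<in> Field r'" if "x \<in> Field r" for x
    using assms(2)[OF fin_ordD(3)[OF assms(3) that]] by (rule FieldI1)
  then show ?thesis
    using assms by (auto simp: ord_hom_def PiE_iff)
qed

lemma ord_homD:
  assumes "\<phi> \<in> ord_hom r r'"
  shows "\<phi> \<in> extensional (Field r)" "\<And>x. x \<in> Field r \<Longrightarrow> \<phi> x \<in> Field r'"
    "\<And>x y. (x, y) \<in> r \<Longrightarrow> (\<phi> x, \<phi> y) \<in> r'"
  using assms by (auto simp: ord_hom_def PiE_iff)

lemma ord_hom_id: "r \<in> fin_ord \<Longrightarrow> (\<lambda>i\<in>Field r. i) \<in> ord_hom r r"
  by (rule ord_homI) (auto simp: FieldI1 FieldI2)

lemma ord_hom_compose:
  assumes "r \<in> fin_ord" "\<phi> \<in> ord_hom r r'" "\<psi> \<in> ord_hom r' r''"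
  shows "compose (Field r) \<psi> \<phi> \<in> ord_hom r r''"
  using assms by (intro ord_homI) (auto simp: compose_def FieldI1 FieldI2 dest: ord_homD)

lemma ord_hom_restrict:
  assumes "T \<in> fin_ord" "T' \<in> fin_ord" "\<phi> \<in> ord_hom T T'"
    and "\<And>x. x \<in> Field T \<Longrightarrow> f x \<in> S \<Longrightarrow> g (\<phi> x) \<in> S"
  shows "restrict \<phi> (Field (preimage_ord T f S)) \<in> ord_hom (preimage_ord T f S) (preimage_ord T' g S)"
proof (rule ord_homI)
  fix x y assume "(x, y) \<in> preimage_ord T f S"
  then show "(restrict \<phi> (Field (preimage_ord T f S)) x, restrict \<phi> (Field (preimage_ord T f S)) y)
      \<in> preimage_ord T' g S"
    using assms by (auto simp: preimage_ord_def[of T' g] preimage_ord_def[of T f] Field_Restr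
        dest: ord_homD)
qed (use assms in auto)

section \<open>Iterated brackets\<close>

text \<open>The pairs \<open>(A, x)\<close> with \<open>A \<subseteq> T\<close> and \<open>x \<in> X\<^sup>A\<close> form a commutative monoid under the binary
  bracket once a zero \<open>None\<close> is adjoined as the product of pairs with intersecting supports. Finite
  products in this monoid are the \<open>k\<close>-ary brackets, and their coherence is that of \<open>finprod\<close>.\<close>

locale cosimplicial_brackets = augmented_cosimplicial_space X push
  for X :: "nat rel \<Rightarrow> 'a topology"
    and push :: "nat rel \<Rightarrow> nat rel \<Rightarrow> (nat \<Rightarrow> nat) \<Rightarrow> 'a \<Rightarrow> 'a" +
  fixes br :: "nat rel \<Rightarrow> (nat \<Rightarrow> nat) \<Rightarrow> 'a \<times> 'a \<Rightarrow> 'a"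
    and \<epsilon> :: 'a
  assumes continuous:
      "\<And>T f. \<lbrakk>T \<in> fin_ord; f \<in> Field T \<rightarrow>\<^sub>E {1, 2}\<rbrakk> \<Longrightarrow>
         continuous_map
           (prod_topology (X (preimage_ord T f {1})) (X (preimage_ord T f {2}))) (X T) (br T f)"
    and compatible:
      "\<And>T T' \<phi> f g x y.
         \<lbrakk>T \<in> fin_ord; T' \<in> fin_ord; \<phi> \<in> ord_hom T T';
          f \<in> Field T \<rightarrow>\<^sub>E {1, 2}; g \<in> Field T' \<rightarrow>\<^sub>E {1, 2}; compose (Field T) g \<phi> = f;
          x \<in> topspace (X (preimage_ord T f {1})); y \<in> topspace (X (preimage_ord T f {2}))\<rbrakk> \<Longrightarrow>
         push T T' \<phi> (br T f (x, y)) =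
         br T' g
           (push (preimage_ord T f {1}) (preimage_ord T' g {1})
              (restrict \<phi> (Field (preimage_ord T f {1}))) x,
            push (preimage_ord T f {2}) (preimage_ord T' g {2})
              (restrict \<phi> (Field (preimage_ord T f {2}))) y)"
    and commutative:
      "\<And>T f x y.
         \<lbrakk>T \<in> fin_ord; f \<in> Field T \<rightarrow>\<^sub>E {1, 2};
          x \<in> topspace (X (preimage_ord T f {1})); y \<in> topspace (X (preimage_ord T f {2}))\<rbrakk> \<Longrightarrow>
         br T f (x, y) = br T (\<lambda>i\<in>Field T. if f i = 1 then 2 else 1) (y, x)"
    and associative:
      "\<And>T g x y z.
         \<lbrakk>T \<in> fin_ord; g \<in> Field T \<rightarrow>\<^sub>E {1, 2, 3};
          x \<in> topspace (X (preimage_ord T g {1})); y \<in> topspace (X (preimage_ord T g {2}));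
          z \<in> topspace (X (preimage_ord T g {3}))\<rbrakk> \<Longrightarrow>
         br T (\<lambda>i\<in>Field T. if g i = 3 then 2 else 1)
           (br (preimage_ord T g {1, 2}) (\<lambda>i\<in>Field (preimage_ord T g {1, 2}). g i) (x, y), z) =
         br T (\<lambda>i\<in>Field T. if g i = 1 then 1 else 2)
           (x, br (preimage_ord T g {2, 3}) (\<lambda>i\<in>Field (preimage_ord T g {2, 3}). g i - 1) (y, z))"
    and unit_in: "\<epsilon> \<in> topspace (X {})"
    and unit_right: "\<And>T x. T \<in> fin_ord \<Longrightarrow> x \<in> topspace (X T) \<Longrightarrow> br T (\<lambda>i\<in>Field T. 1) (x, \<epsilon>) = x"
begin

definition label :: "nat set \<Rightarrow> nat set \<Rightarrow> nat \<Rightarrow> nat" where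
  "label A B = (\<lambda>i\<in>A \<union> B. if i \<in> A then 1 else 2)"

definition supported :: "nat rel \<Rightarrow> (nat set \<times> 'a) option monoid" where
  "supported T =
    \<lparr>carrier = insert None {Some (A, x) | A x. A \<subseteq> Field T \<and> x \<in> topspace (X (Restr T A))},
     mult = (\<lambda>u v. case u of None \<Rightarrow> None | Some (A, x) \<Rightarrow>
       (case v of None \<Rightarrow> None | Some (B, y) \<Rightarrow>
         if A \<inter> B = {} then Some (A \<union> B, br (Restr T (A \<union> B)) (label A B) (x, y)) else None)),
     one = Some ({}, \<epsilon>)\<rparr>"

context
  fixes T A B
  assumes T: "T \<in> fin_ord" and AB: "A \<subseteq> Field T" "B \<subseteq> Field T" "A \<inter> B = {}"
begin

lemma label_in: "label A B \<in> Field (Restr T (A \<union> B)) \<rightarrow>\<^sub>E {1, 2}"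
  using T AB by (subst Field_Restr) (auto simp: label_def)

lemma preimage_label:
  "preimage_ord (Restr T (A \<union> B)) (label A B) {1} = Restr T A"
  "preimage_ord (Restr T (A \<union> B)) (label A B) {2} = Restr T B"
  using T AB by (intro preimage_ord_Restr; auto simp: label_def)+

lemma br_continuous:
  "continuous_map (prod_topology (X (Restr T A)) (X (Restr T B))) (X (Restr T (A \<union> B)))
     (br (Restr T (A \<union> B)) (label A B))"
  using continuous[OF Restr_fin_ord[OF T] label_in] unfolding preimage_label .

lemma br_in:
  assumes "x \<in> topspace (X (Restr T A))" "y \<in> topspace (X (Restr T B))"
  shows "br (Restr T (A \<union> B)) (label A B) (x, y) \<in> topspace (X (Restr T (A \<union> B)))"
  using continuous_map_funspace[OF br_continuous] assms by auto

lemma br_commute: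
  assumes "x \<in> topspace (X (Restr T A))" "y \<in> topspace (X (Restr T B))"
  shows "br (Restr T (A \<union> B)) (label A B) (x, y) = br (Restr T (B \<union> A)) (label B A) (y, x)"
proof -
  have "(\<lambda>i\<in>Field (Restr T (A \<union> B)). if label A B i = 1 then 2 else 1) = label B A"
    using T AB by (subst Field_Restr) (auto simp: label_def fun_eq_iff)
  then show ?thesis
    using commutative[OF Restr_fin_ord[OF T] label_in, unfolded preimage_label, OF assms]
    by (simp add: Un_commute)
qed

end

lemma br_assoc:
  assumes T: "T \<in> fin_ord" and AB: "A \<subseteq> Field T" "B \<subseteq> Field T" "C \<subseteq> Field T"
    and d: "A \<inter> B = {}" "A \<inter> C = {}" "B \<inter> C = {}"
    and x: "x \<in> topspace (X (Restr T A))" "y \<in> topspace (X (Restr T B))" "z \<in> topspace (X (Restr T C))"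
  shows "br (Restr T (A \<union> B \<union> C)) (label (A \<union> B) C) (br (Restr T (A \<union> B)) (label A B) (x, y), z)
    = br (Restr T (A \<union> (B \<union> C))) (label A (B \<union> C)) (x, br (Restr T (B \<union> C)) (label B C) (y, z))"
proof -
  let ?U = "A \<union> (B \<union> C)"
  \<comment> \<open>The colouring with fibres \<open>A\<close>, \<open>B\<close>, \<open>C\<close>
    over 1, 2, 3; merging two colours or restricting to two of them gives the four labels that occur
    on the two sides.\<close>
  let ?g = "\<lambda>i\<in>?U. if i \<in> A then 1 else if i \<in> B then 2 else (3::nat)"
  have F: "Field (Restr T ?U) = ?U"
    using T AB by (intro Field_Restr) auto
  have g: "?g \<in> Field (Restr T ?U) \<rightarrow>\<^sub>E {1, 2, 3}"
    unfolding F by auto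
  have p: "preimage_ord (Restr T ?U) ?g S = Restr T {i \<in> ?U. ?g i \<in> S}" for S
    using T AB by (intro preimage_ord_Restr) auto
  have s: "{i \<in> ?U. ?g i \<in> {1}} = A" "{i \<in> ?U. ?g i \<in> {2}} = B" "{i \<in> ?U. ?g i \<in> {3}} = C"
    "{i \<in> ?U. ?g i \<in> {1, 2}} = A \<union> B" "{i \<in> ?U. ?g i \<in> {2, 3}} = B \<union> C"
    using d by auto
  have F2: "Field (Restr T (A \<union> B)) = A \<union> B" "Field (Restr T (B \<union> C)) = B \<union> C"
    using T AB by (auto intro!: Field_Restr)
  have l: "(\<lambda>i\<in>?U. if ?g i = 3 then 2 else 1) = label (A \<union> B) C"
    "(\<lambda>i\<in>A \<union> B. ?g i) = label A B" "(\<lambda>i\<in>?U. if ?g i = 1 then 1 else 2) = label A (B \<union> C)"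
    "(\<lambda>i\<in>B \<union> C. ?g i - 1) = label B C"
    using d by (auto simp: label_def fun_eq_iff restrict_def)
  show ?thesis
    using associative[OF Restr_fin_ord[OF T] g, unfolded p s F F2 l, OF x]
    by (simp add: Un_assoc)
qed

lemma supported_simps:
  "carrier (supported T) = insert None {Some (A, x) | A x. A \<subseteq> Field T \<and> x \<in> topspace (X (Restr T A))}"
  "\<one>\<^bsub>supported T\<^esub> = Some ({}, \<epsilon>)"
  "Some (A, x) \<otimes>\<^bsub>supported T\<^esub> Some (B, y) =
     (if A \<inter> B = {} then Some (A \<union> B, br (Restr T (A \<union> B)) (label A B) (x, y)) else None)"
  "u \<otimes>\<^bsub>supported T\<^esub> None = None" "None \<otimes>\<^bsub>supported T\<^esub> u = None"
  by (auto simp: supported_def split: option.splits)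

lemma comm_monoid_supported:
  assumes T: "T \<in> fin_ord"
  shows "comm_monoid (supported T)"
proof (rule comm_monoidI)
  fix u v assume "u \<in> carrier (supported T)" "v \<in> carrier (supported T)"
  then show "u \<otimes>\<^bsub>supported T\<^esub> v \<in> carrier (supported T)"
    "u \<otimes>\<^bsub>supported T\<^esub> v = v \<otimes>\<^bsub>supported T\<^esub> u"
    using br_in[OF T] br_commute[OF T]
    by (auto simp: supported_simps(1); auto simp: supported_simps)+
next
  show "\<one>\<^bsub>supported T\<^esub> \<in> carrier (supported T)"
    using unit_in by (simp add: supported_simps)
next
  fix u v w assume uvw: "u \<in> carrier (supported T)" "v \<in> carrier (supported T)" "w \<in> carrier (supported T)"
  show "u \<otimes>\<^bsub>supported T\<^esub> v \<otimes>\<^bsub>supported T\<^esub> w = u \<otimes>\<^bsub>supported T\<^esub> (v \<otimes>\<^bsub>supported T\<^esub> w)"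
  proof (cases "u = None \<or> v = None \<or> w = None")
    case False
    then obtain A x B y C z where s: "u = Some (A, x)" "v = Some (B, y)" "w = Some (C, z)"
      by auto
    with uvw have "A \<subseteq> Field T" "B \<subseteq> Field T" "C \<subseteq> Field T" "x \<in> topspace (X (Restr T A))"
      "y \<in> topspace (X (Restr T B))" "z \<in> topspace (X (Restr T C))"
      by (auto simp: supported_simps)
    with br_assoc[OF T this(1-3) _ _ _ this(4-6)] show ?thesis
      by (simp add: s supported_simps Un_assoc Int_Un_distrib Int_Un_distrib2)
  qed (auto simp: supported_simps)
next
  fix u assume u: "u \<in> carrier (supported T)"
  show "\<one>\<^bsub>supported T\<^esub> \<otimes>\<^bsub>supported T\<^esub> u = u"
  proof (cases u)
    case (Some v)
    then obtain A x where v: "v = (A, x)" "A \<subseteq> Field T" "x \<in> topspace (X (Restr T A))"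
      using u by (auto simp: supported_simps)
    \<comment> \<open>Commutativity moves \<open>\<epsilon>\<close> to the right, where
      \<open>unit_right\<close> applies.\<close>
    have "br (Restr T ({} \<union> A)) (label {} A) (\<epsilon>, x) = br (Restr T (A \<union> {})) (label A {}) (x, \<epsilon>)"
      using br_commute[OF T, of "{}" A \<epsilon> x] v unit_in by auto
    also have "label A {} = (\<lambda>i\<in>Field (Restr T A). 1)"
      unfolding Field_Restr[OF T v(2)] by (auto simp: label_def fun_eq_iff)
    also have "br (Restr T (A \<union> {})) (\<lambda>i\<in>Field (Restr T A). 1) (x, \<epsilon>) = x"
      unfolding Un_empty_right by (rule unit_right[OF Restr_fin_ord[OF T] v(3)])
    finally show ?thesis
      using v Some by (simp add: supported_simps)
  qed (simp add: supported_simps)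
qed

text \<open>The iterated bracket. Fibres of \<open>f\<close> over distinct indices are disjoint, so
  for finite \<open>I\<close> and arguments in the right spaces the product never meets the zero
  \<open>None\<close>, and \<open>the\<close> is applied to a genuine pair; see
  \<open>finprod_supported\<close>.\<close>

definition brs :: "nat rel \<Rightarrow> nat set \<Rightarrow> (nat \<Rightarrow> nat) \<Rightarrow> (nat \<Rightarrow> 'a) \<Rightarrow> 'a" where
  "brs T I f x = snd (the (finprod (supported T) (\<lambda>i. Some ({s \<in> Field T. f s = i}, x i)) I))"

lemma Restr_preimage: "Restr T {s \<in> Field T. f s \<in> I} = preimage_ord T f I"
  "Restr T {s \<in> Field T. f s = i} = preimage_ord T f {i}"
  by (auto simp: preimage_ord_def)

context
  fixes T
  assumes T: "T \<in> fin_ord"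
begin

interpretation comm_monoid "supported T"
  by (rule comm_monoid_supported[OF T])

lemma fibre_in_carrier:
  "x i \<in> topspace (X (preimage_ord T f {i})) \<Longrightarrow>
    Some ({s \<in> Field T. f s = i}, x i) \<in> carrier (supported T)"
  by (auto simp: supported_simps Restr_preimage)

lemma finprod_supported:
  assumes "finite I" "\<And>i. i \<in> I \<Longrightarrow> x i \<in> topspace (X (preimage_ord T f {i}))"
  shows "finprod (supported T) (\<lambda>i. Some ({s \<in> Field T. f s = i}, x i)) I
      = Some ({s \<in> Field T. f s \<in> I}, brs T I f x)" (is ?A)
    and "brs T I f x \<in> topspace (X (preimage_ord T f I))" (is ?B)
proof -
  have "\<exists>w. finprod (supported T) (\<lambda>i. Some ({s \<in> Field T. f s = i}, x i)) I
      = Some ({s \<in> Field T. f s \<in> I}, w)"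
    using assms
  proof (induction I rule: finite_induct)
    case empty
    then show ?case by (simp add: supported_simps)
  next
    case (insert i I)
    then obtain w where w: "finprod (supported T) (\<lambda>i. Some ({s \<in> Field T. f s = i}, x i)) I
      = Some ({s \<in> Field T. f s \<in> I}, w)"
      by auto
    have "{s \<in> Field T. f s = i} \<inter> {s \<in> Field T. f s \<in> I} = {}"
      using insert by auto
    moreover have "{s \<in> Field T. f s = i} \<union> {s \<in> Field T. f s \<in> I} = {s \<in> Field T. f s \<in> insert i I}"
      by auto
    ultimately show ?case
      using insert w by (subst finprod_insert) (auto simp: supported_simps Restr_preimage)
  qed
  then show ?A
    by (auto simp: brs_def)
  moreover have "finprod (supported T) (\<lambda>i. Some ({s \<in> Field T. f s = i}, x i)) I \<in> carrier (supported T)"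
    using assms by (intro finprod_closed) (auto intro!: fibre_in_carrier)
  ultimately show ?B
    by (auto simp: supported_simps Restr_preimage)
qed

lemma brs_empty: "brs T {} f x = \<epsilon>"
  by (simp add: brs_def supported_simps)

text \<open>The recursion by which continuity, restriction and naturality of iterated brackets
  reduce to the binary axioms. Reindexing and grouping are instead read off from
  \<open>finprod\<close>.\<close>

lemma brs_insert:
  assumes "finite I" "i \<notin> I" "\<And>j. j \<in> insert i I \<Longrightarrow> x j \<in> topspace (X (preimage_ord T f {j}))"
  shows "brs T (insert i I) f x = br (preimage_ord T f (insert i I))
      (label {s \<in> Field T. f s = i} {s \<in> Field T. f s \<in> I}) (x i, brs T I f x)"
proof -
  have 1: "{s \<in> Field T. f s = i} \<union> {s \<in> Field T. f s \<in> I} = {s \<in> Field T. f s \<in> insert i I}"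
    by auto
  have "Some ({s \<in> Field T. f s \<in> insert i I}, brs T (insert i I) f x)
      = finprod (supported T) (\<lambda>i. Some ({s \<in> Field T. f s = i}, x i)) (insert i I)"
    using assms by (subst finprod_supported(1)) auto
  also have "\<dots> = Some ({s \<in> Field T. f s = i}, x i) \<otimes>\<^bsub>supported T\<^esub>
      Some ({s \<in> Field T. f s \<in> I}, brs T I f x)"
    using assms by (subst finprod_insert) (auto intro!: fibre_in_carrier simp: finprod_supported)
  also have "\<dots> = Some ({s \<in> Field T. f s \<in> insert i I}, br (preimage_ord T f (insert i I))
      (label {s \<in> Field T. f s = i} {s \<in> Field T. f s \<in> I}) (x i, brs T I f x))"
    using assms unfolding supported_simps 1 Restr_preimage by auto
  finally show ?thesis by simp
qed

lemma brs_singleton: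
  assumes "x i \<in> topspace (X (preimage_ord T f {i}))"
  shows "brs T {i} f x = x i"
  using assms fibre_in_carrier[of x i f] by (simp add: brs_def)

lemma brs_cong:
  assumes "finite I" "\<And>i. i \<in> I \<Longrightarrow> x i \<in> topspace (X (preimage_ord T f {i}))"
    and "\<And>i. i \<in> I \<Longrightarrow> x i = x' i"
    and "\<And>s i. s \<in> Field T \<Longrightarrow> i \<in> I \<Longrightarrow> f s = i \<longleftrightarrow> f' s = i"
  shows "brs T I f x = brs T I f' x'"
proof -
  have "Some ({s \<in> Field T. f s = i}, x i) = Some ({s \<in> Field T. f' s = i}, x' i)" if "i \<in> I" for i
    using assms that by auto
  then have "finprod (supported T) (\<lambda>i. Some ({s \<in> Field T. f s = i}, x i)) I
      = finprod (supported T) (\<lambda>i. Some ({s \<in> Field T. f' s = i}, x' i)) I"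
    using assms(2) fibre_in_carrier by (intro finprod_cong') (auto, metis)
  then show ?thesis by (simp add: brs_def)
qed

text \<open>Symmetry of the iterated bracket, in the form needed for equivariance of the action and
  for renumbering the labels of a block.\<close>

lemma brs_reindex:
  assumes "finite I" "inj_on \<sigma> I" "\<And>i. i \<in> I \<Longrightarrow> x (\<sigma> i) \<in> topspace (X (preimage_ord T f {\<sigma> i}))"
    and "\<And>s i. s \<in> Field T \<Longrightarrow> i \<in> I \<Longrightarrow> f s = \<sigma> i \<longleftrightarrow> f' s = i"
  shows "brs T (\<sigma> ` I) f x = brs T I f' (\<lambda>i. x (\<sigma> i))"
proof -
  have eq: "{s \<in> Field T. f s = \<sigma> i} = {s \<in> Field T. f' s = i}" if "i \<in> I" for i
    using assms that by auto
  have "finprod (supported T) (\<lambda>i. Some ({s \<in> Field T. f s = i}, x i)) (\<sigma> ` I)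
      = finprod (supported T) (\<lambda>i. Some ({s \<in> Field T. f s = \<sigma> i}, x (\<sigma> i))) I"
    using assms by (intro finprod_reindex) (auto intro!: fibre_in_carrier)
  also have "\<dots> = finprod (supported T) (\<lambda>i. Some ({s \<in> Field T. f' s = i}, x (\<sigma> i))) I"
  proof (rule finprod_cong')
    show "(\<lambda>i. Some ({s \<in> Field T. f' s = i}, x (\<sigma> i))) \<in> I \<rightarrow> carrier (supported T)"
      using fibre_in_carrier[of x "\<sigma> _" f, OF assms(3)] by (simp add: eq)
  qed (simp_all add: eq)
  finally show ?thesis by (simp add: brs_def)
qed

text \<open>General associativity: the labels are grouped into blocks \<open>J i\<close>, and
  \<open>e\<close> records the block. This is what operadic composition uses.\<close>

lemma brs_UN:
  assumes I: "finite I" "\<And>i. i \<in> I \<Longrightarrow> finite (J i)" "disjoint_family_on J I"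
    and x: "\<And>i j. i \<in> I \<Longrightarrow> j \<in> J i \<Longrightarrow> x j \<in> topspace (X (preimage_ord T f {j}))"
    and e: "\<And>s i. s \<in> Field T \<Longrightarrow> i \<in> I \<Longrightarrow> e s = i \<longleftrightarrow> f s \<in> J i"
  shows "brs T (\<Union>i\<in>I. J i) f x = brs T I e (\<lambda>i. brs T (J i) f x)"
proof -
  have eq: "{s \<in> Field T. f s \<in> J i} = {s \<in> Field T. e s = i}" if "i \<in> I" for i
    using e that by auto
  have "finprod (supported T) (\<lambda>i. Some ({s \<in> Field T. f s = i}, x i)) (\<Union>i\<in>I. J i)
      = finprod (supported T) (\<lambda>i. finprod (supported T) (\<lambda>i. Some ({s \<in> Field T. f s = i}, x i)) (J i)) I"
    using I x by (intro finprod_UN_disjoint)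
      (auto intro!: fibre_in_carrier simp: pairwise_def disjnt_def disjoint_family_on_def)
  also have "\<dots> = finprod (supported T) (\<lambda>i. Some ({s \<in> Field T. e s = i}, brs T (J i) f x)) I"
  proof (rule finprod_cong')
    show "(\<lambda>i. Some ({s \<in> Field T. e s = i}, brs T (J i) f x)) \<in> I \<rightarrow> carrier (supported T)"
    proof
      fix i assume i: "i \<in> I"
      have "brs T (J i) f x \<in> topspace (X (preimage_ord T f (J i)))"
        using I(2) x i by (intro finprod_supported) auto
      also have "preimage_ord T f (J i) = preimage_ord T e {i}"
        using eq[OF i] by (simp add: Restr_preimage[symmetric])
      finally show "Some ({s \<in> Field T. e s = i}, brs T (J i) f x) \<in> carrier (supported T)"
        by (rule fibre_in_carrier)
    qed
  qed (use I x finprod_supported(1) eq in auto)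
  finally show ?thesis by (simp add: brs_def)
qed

lemma brs_continuous:
  assumes "finite I" "\<And>i. i \<in> I \<Longrightarrow> continuous_map Z (X (preimage_ord T f {i})) (\<lambda>z. x z i)"
  shows "continuous_map Z (X (preimage_ord T f I)) (\<lambda>z. brs T I f (x z))"
  using assms
proof (induction I rule: finite_induct)
  case empty
  then show ?case
    using unit_in by (simp add: brs_empty preimage_ord_def)
next
  case (insert i I)
  let ?A = "{s \<in> Field T. f s = i}" and ?B = "{s \<in> Field T. f s \<in> I}"
  have AB: "?A \<union> ?B = {s \<in> Field T. f s \<in> insert i I}" by auto
  have b: "continuous_map (prod_topology (X (preimage_ord T f {i})) (X (preimage_ord T f I)))
      (X (preimage_ord T f (insert i I))) (br (preimage_ord T f (insert i I)) (label ?A ?B))"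
    using br_continuous[OF T, of ?A ?B] insert.hyps unfolding AB Restr_preimage by auto
  have x: "continuous_map Z (prod_topology (X (preimage_ord T f {i})) (X (preimage_ord T f I)))
      (\<lambda>z. (x z i, brs T I f (x z)))"
    using insert by (auto simp: continuous_map_pairwise comp_def)
  have "continuous_map Z (X (preimage_ord T f (insert i I)))
      (\<lambda>z. br (preimage_ord T f (insert i I)) (label ?A ?B) (x z i, brs T I f (x z)))"
    using continuous_map_compose[OF x b] by (simp only: comp_def)
  then show ?case
  proof (rule continuous_map_eq)
    fix z assume "z \<in> topspace Z"
    then have "x z j \<in> topspace (X (preimage_ord T f {j}))" if "j \<in> insert i I" for j
      using continuous_map_funspace[OF insert.prems[OF that]] by auto
    then show "br (preimage_ord T f (insert i I)) (label ?A ?B) (x z i, brs T I f (x z))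
        = brs T (insert i I) f (x z)"
      using insert.hyps by (subst brs_insert) auto
  qed
qed

end

lemma brs_in:
  assumes "T \<in> fin_ord" "f \<in> Field T \<rightarrow> I" "finite I"
    "\<And>i. i \<in> I \<Longrightarrow> x i \<in> topspace (X (preimage_ord T f {i}))"
  shows "brs T I f x \<in> topspace (X T)"
  using finprod_supported(2)[OF assms(1,3,4)] preimage_ord_all[OF assms(2)] by simp

text \<open>The two sides are products in different monoids, \<open>supported (Restr T A)\<close>
  and \<open>supported T\<close>, so they are compared by induction through
  \<open>brs_insert\<close>.\<close>

lemma brs_Restr:
  assumes T: "T \<in> fin_ord" and A: "A \<subseteq> Field T" and "finite I"
    and "\<And>s. s \<in> Field T \<Longrightarrow> f s \<in> I \<Longrightarrow> s \<in> A"
    and "\<And>i. i \<in> I \<Longrightarrow> x i \<in> topspace (X (preimage_ord T f {i}))"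
  shows "brs (Restr T A) I f x = brs T I f x"
  using assms(3-)
proof (induction I rule: finite_induct)
  case empty
  then show ?case using T by (simp add: brs_empty Restr_fin_ord)
next
  case (insert i I)
  have F: "Field (Restr T A) = A"
    using T A by (rule Field_Restr)
  have eq: "{s \<in> A. f s = i} = {s \<in> Field T. f s = i}" "{s \<in> A. f s \<in> I} = {s \<in> Field T. f s \<in> I}"
    using A insert.prems(1) by auto
  have pre: "preimage_ord (Restr T A) f S = preimage_ord T f S" if "S \<subseteq> insert i I" for S
  proof -
    have "{x \<in> A. f x \<in> S} = {x \<in> Field T. f x \<in> S}"
      using A insert.prems(1) that by auto
    from preimage_ord_Restr[OF T A this] show ?thesis
      by (simp only: Restr_preimage)
  qed
  have "brs (Restr T A) (insert i I) f x = br (preimage_ord T f (insert i I))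
      (label {s \<in> Field T. f s = i} {s \<in> Field T. f s \<in> I}) (x i, brs (Restr T A) I f x)"
    using insert T by (subst brs_insert) (auto simp: Restr_fin_ord pre F eq)
  also have "\<dots> = brs T (insert i I) f x"
    using insert by (simp only: brs_insert[OF T insert.hyps insert.prems(2)]) auto
  finally show ?case .
qed

text \<open>Iterates compatibility with cosimplicial operators. Since \<open>g\<close> composed with
  \<open>\<phi>\<close> is \<open>f\<close>, the map \<open>\<phi>\<close> restricts to every union
  of fibres, which keeps the induction inside the hypothesis.\<close>

lemma brs_push:
  assumes T: "T \<in> fin_ord" "T' \<in> fin_ord" and \<phi>: "\<phi> \<in> ord_hom T T'"
    and g: "\<And>s. s \<in> Field T \<Longrightarrow> g (\<phi> s) = f s"
    and "finite I" "\<And>i. i \<in> I \<Longrightarrow> x i \<in> topspace (X (preimage_ord T f {i}))"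
  shows "push (preimage_ord T f I) (preimage_ord T' g I)
      (restrict \<phi> (Field (preimage_ord T f I))) (brs T I f x)
    = brs T' I g (\<lambda>i. push (preimage_ord T f {i}) (preimage_ord T' g {i})
        (restrict \<phi> (Field (preimage_ord T f {i}))) (x i))"
  using assms(5-)
proof (induction I rule: finite_induct)
  case empty
  have p: "preimage_ord T f {} = {}" "preimage_ord T' g {} = {}"
    by (auto simp: preimage_ord_def)
  \<comment> \<open>The empty bracket is \<open>\<epsilon>\<close>, and the restriction of
    \<open>\<phi>\<close> to the empty order is an identity, so \<open>\<epsilon>\<close> is
    fixed.\<close>
  have "(\<lambda>i\<in>Field {}. i) = restrict \<phi> (Field {})"
    by (simp add: fun_eq_iff)
  then show ?case
    using push_id[OF empty_fin_ord unit_in] unfolding p brs_empty[OF T(1)] brs_empty[OF T(2)] by metis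
next
  case (insert i I)
  let ?r = "\<lambda>S. restrict \<phi> (Field (preimage_ord T f S))"
  have hom: "?r S \<in> ord_hom (preimage_ord T f S) (preimage_ord T' g S)" for S
    using T \<phi> g by (intro ord_hom_restrict) auto
  have xi: "x j \<in> topspace (X (preimage_ord T f {j}))" if "j \<in> insert i I" for j
    using insert that by auto
  have px: "push (preimage_ord T f {j}) (preimage_ord T' g {j}) (?r {j}) (x j)
      \<in> topspace (X (preimage_ord T' g {j}))" if "j \<in> insert i I" for j
    using continuous_map_funspace[OF push_continuous[OF _ _ hom[of "{j}"]]] xi[OF that] T by auto
  let ?A = "{s \<in> Field T. f s = i}" and ?B = "{s \<in> Field T. f s \<in> I}"
  let ?A' = "{s \<in> Field T'. g s = i}" and ?B' = "{s \<in> Field T'. g s \<in> I}"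
  let ?U = "preimage_ord T f (insert i I)" and ?U' = "preimage_ord T' g (insert i I)"
  have AB: "?A \<union> ?B = {s \<in> Field T. f s \<in> insert i I}" "?A' \<union> ?B' = {s \<in> Field T'. g s \<in> insert i I}"
    by auto
  have dis: "?A \<inter> ?B = {}" "?A' \<inter> ?B' = {}"
    using insert.hyps by auto
  have l: "label ?A ?B \<in> Field ?U \<rightarrow>\<^sub>E {1, 2}" "label ?A' ?B' \<in> Field ?U' \<rightarrow>\<^sub>E {1, 2}"
    using label_in[OF T(1) _ _ dis(1)] label_in[OF T(2) _ _ dis(2)] unfolding AB Restr_preimage by auto
  have p: "preimage_ord ?U (label ?A ?B) {1} = preimage_ord T f {i}"
    "preimage_ord ?U (label ?A ?B) {2} = preimage_ord T f I"
    "preimage_ord ?U' (label ?A' ?B') {1} = preimage_ord T' g {i}"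
    "preimage_ord ?U' (label ?A' ?B') {2} = preimage_ord T' g I"
    using preimage_label[OF T(1) _ _ dis(1)] preimage_label[OF T(2) _ _ dis(2)]
    unfolding AB Restr_preimage by auto
  have c: "compose (Field ?U) (label ?A' ?B') (?r (insert i I)) = label ?A ?B"
    using T g ord_homD(2)[OF \<phi>] by (auto simp: compose_def label_def fun_eq_iff restrict_def)
  have r: "restrict (?r (insert i I)) (Field (preimage_ord T f {i})) = ?r {i}"
    "restrict (?r (insert i I)) (Field (preimage_ord T f I)) = ?r I"
    using T by (auto simp: fun_eq_iff restrict_def)
  have bi: "brs T I f x \<in> topspace (X (preimage_ord T f I))"
    using finprod_supported(2)[OF T(1) insert.hyps(1)] xi by blast
  have IH: "push (preimage_ord T f I) (preimage_ord T' g I) (?r I) (brs T I f x)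
      = brs T' I g (\<lambda>i. push (preimage_ord T f {i}) (preimage_ord T' g {i}) (?r {i}) (x i))"
    by (rule insert.IH) (use insert.prems in auto)
  have "push ?U ?U' (?r (insert i I)) (brs T (insert i I) f x)
    = push ?U ?U' (?r (insert i I)) (br ?U (label ?A ?B) (x i, brs T I f x))"
    using insert T by (subst brs_insert) auto
  also have "\<dots> = br ?U' (label ?A' ?B') (push (preimage_ord T f {i}) (preimage_ord T' g {i}) (?r {i}) (x i),
      push (preimage_ord T f I) (preimage_ord T' g I) (?r I) (brs T I f x))"
    using compatible[OF _ _ hom l c, of "x i" "brs T I f x", unfolded p r] T xi bi by auto
  also have "\<dots> = brs T' (insert i I) g (\<lambda>i. push (preimage_ord T f {i}) (preimage_ord T' g {i}) (?r {i}) (x i))"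
    unfolding IH
    by (rule brs_insert[OF T(2) insert.hyps px, symmetric])
  finally show ?case .
qed

end

section \<open>Unit paths and subdivisions\<close>

text \<open>Extended constantly beyond [0, 1], so that rescaled paths and composites need no care
  with domains and the path defines a Stieltjes measure on the line.\<close>

definition unit_path :: "(real \<Rightarrow> real) \<Rightarrow> bool" where
  "unit_path g \<longleftrightarrow> mono g \<and> continuous_on UNIV g \<and> (\<forall>x\<le>0. g x = 0) \<and> (\<forall>x\<ge>1. g x = 1)"

lemma unit_pathD:
  assumes "unit_path g"
  shows "x \<le> y \<Longrightarrow> g x \<le> g y" "isCont g x" "x \<le> 0 \<Longrightarrow> g x = 0" "1 \<le> x \<Longrightarrow> g x = 1"
    "0 \<le> g x" "g x \<le> 1"
proof -
  show 1: "x \<le> y \<Longrightarrow> g x \<le> g y" for x y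
    using assms by (auto simp: unit_path_def mono_def)
  show "isCont g x" "x \<le> 0 \<Longrightarrow> g x = 0" "1 \<le> x \<Longrightarrow> g x = 1"
    using assms by (auto simp: unit_path_def continuous_on_eq_continuous_at)
  show "0 \<le> g x" "g x \<le> 1"
    using 1[of "min x 0" x] 1[of x "max x 1"] assms by (auto simp: unit_path_def)
qed

lemma unit_path_clip: "unit_path clip"
  unfolding unit_path_def clip_def by (auto simp: mono_def intro!: continuous_intros)

lemma unit_path_compose: "unit_path g \<Longrightarrow> unit_path h \<Longrightarrow> unit_path (\<lambda>x. g (h x))"
  unfolding unit_path_def
  by (auto simp: mono_def intro: continuous_on_compose2)

text \<open>The Stieltjes measure of \<open>g\<close>. It gives the increase of \<open>g\<close> on
  the overlap of two intervals without case distinctions on the order of their endpoints.\<close>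

definition mass :: "(real \<Rightarrow> real) \<Rightarrow> real set \<Rightarrow> real" where
  "mass g A = measure (interval_measure g) A"

lemma mass_Ioc: "unit_path g \<Longrightarrow> x \<le> y \<Longrightarrow> mass g {x<..y} = g y - g x"
  unfolding mass_def
  by (rule measure_interval_measure_Ioc)
     (simp_all add: unit_pathD(1) continuous_at_imp_continuous_at_within[OF unit_pathD(2)])

lemma mass_nonneg: "0 \<le> mass g A" and mass_empty: "mass g {} = 0"
  by (auto simp: mass_def)

text \<open>The intervals together carry the full mass 1, so the rest of the unit interval is a null
  set and may be ignored when the mass of a smaller interval is computed.\<close>

lemma mass_split:
  assumes g: "unit_path g" and K: "finite K"
    and ab: "\<And>k. k \<in> K \<Longrightarrow> 0 \<le> a k \<and> a k \<le> b k \<and> b k \<le> 1"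
    and dis: "disjoint_family_on (\<lambda>k. {a k<..b k}) K"
    and total: "(\<Sum>k\<in>K. g (b k) - g (a k)) = 1"
    and xy: "0 \<le> x" "x \<le> y" "y \<le> 1"
  shows "(\<Sum>k\<in>K. mass g ({x<..y} \<inter> {a k<..b k})) = g y - g x"
proof -
  let ?M = "interval_measure g"
  let ?U = "\<Union>k\<in>K. {a k<..b k}"
  have em: "emeasure ?M {u<..v} = ennreal (g v - g u)" if "u \<le> v" for u v
    by (rule emeasure_interval_measure_Ioc[OF that unit_pathD(1)[OF g]])
      (simp_all add: continuous_at_imp_continuous_at_within[OF unit_pathD(2)[OF g]])
  have fin: "A \<in> fmeasurable ?M" if "A \<subseteq> {0<..1}" "A \<in> sets borel" for A
  proof (rule fmeasurableI2[OF _ that(1)])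
    show "{0<..1} \<in> fmeasurable ?M"
      by (rule fmeasurableI) (simp_all add: em)
  qed (simp add: that(2))
  have U: "?U \<subseteq> {0<..1}"
    using ab by fastforce
  have Ub: "?U \<in> sets borel"
    using K by (intro sets.finite_UN) auto
  have meas: "measure ?M ?U = (\<Sum>k\<in>K. measure ?M {a k<..b k})"
    using ab U dis K by (intro measure_finite_Union) (auto simp: fin em)
  also have "\<dots> = 1"
    unfolding total[symmetric] using ab mass_Ioc[OF g] by (intro sum.cong) (auto simp: mass_def)
  finally have U1: "measure ?M ?U = 1" .
  have "measure ?M {0<..1} = 1"
    using mass_Ioc[OF g, of 0 1] unit_pathD(3,4)[OF g] by (simp add: mass_def)
  then have null: "measure ?M ({0<..1} - ?U) = 0"
    using U U1 fin Ub by (subst measurable_measure_Diff) auto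
  have "measure ?M ({x<..y} - ?U) \<le> measure ?M ({0<..1} - ?U)"
    using xy U Ub by (intro measure_mono_fmeasurable fin) auto
  then have d: "measure ?M ({x<..y} - ?U) = 0"
    using null by (simp add: measure_le_0_iff)
  have "g y - g x = measure ?M {x<..y}"
    using mass_Ioc[OF g xy(2)] by (simp add: mass_def)
  also have "{x<..y} = ({x<..y} - ?U) \<union> ({x<..y} \<inter> ?U)"
    by auto
  also have "measure ?M \<dots> = measure ?M ({x<..y} - ?U) + measure ?M ({x<..y} \<inter> ?U)"
  proof -
    have "{x<..y} - ?U \<in> fmeasurable ?M" "{x<..y} \<inter> ?U \<in> fmeasurable ?M"
      using xy Ub by (auto intro!: fin)
    then show ?thesis
      by (intro measure_Union) (auto simp: fmeasurable_def)
  qed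
  also have "\<dots> = measure ?M (\<Union>k\<in>K. {x<..y} \<inter> {a k<..b k})"
    using d by (simp add: Int_UN_distrib)
  also have "\<dots> = (\<Sum>k\<in>K. measure ?M ({x<..y} \<inter> {a k<..b k}))"
  proof (rule measure_finite_Union)
    show "disjoint_family_on (\<lambda>k. {x<..y} \<inter> {a k<..b k}) K"
      using dis by (force simp: disjoint_family_on_def)
    show "emeasure ?M ({x<..y} \<inter> {a k<..b k}) \<noteq> \<infinity>" if "k \<in> K" for k
    proof -
      have "{x<..y} \<inter> {a k<..b k} \<in> fmeasurable ?M"
        using xy by (intro fin) auto
      then show ?thesis by (simp add: fmeasurable_def del: Int_greaterThanAtMost)
    qed
  qed (use K in auto)
  finally show ?thesis by (simp add: mass_def)
qed

text \<open>\<open>lower\<close> and \<open>upper\<close> give the left and right end of the cell of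
  \<open>i\<close> when [0, 1] is cut into consecutive intervals of lengths
  \<open>p\<close>.\<close>

definition lower :: "nat rel \<Rightarrow> (nat \<Rightarrow> real) \<Rightarrow> nat \<Rightarrow> real" where
  "lower r p i = (\<Sum>j\<in>{j \<in> Field r. (j, i) \<in> r \<and> j \<noteq> i}. p j)"

definition upper :: "nat rel \<Rightarrow> (nat \<Rightarrow> real) \<Rightarrow> nat \<Rightarrow> real" where
  "upper r p i = (\<Sum>j\<in>{j \<in> Field r. (j, i) \<in> r}. p j)"

lemma simplexD:
  assumes "p \<in> topspace (simplex_space r)"
  shows "\<And>i. 0 \<le> p i" "\<And>i. i \<notin> Field r \<Longrightarrow> p i = 0" "(\<Sum>i\<in>Field r. p i) = 1"
  using assms by (auto simp: simplex_space_topspace)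

context
  fixes r p
  assumes r: "r \<in> fin_ord" and p: "p \<in> topspace (simplex_space r)"
begin

lemma upper_eq: "i \<in> Field r \<Longrightarrow> upper r p i = lower r p i + p i"
proof -
  assume i: "i \<in> Field r"
  have "{j \<in> Field r. (j, i) \<in> r} = insert i {j \<in> Field r. (j, i) \<in> r \<and> j \<noteq> i}"
    using i fin_ordD(3)[OF r] by auto
  then show ?thesis
    unfolding upper_def lower_def using fin_ordD(1)[OF r] by simp
qed

lemma lower_nonneg: "0 \<le> lower r p i"
  unfolding lower_def using simplexD(1)[OF p] by (simp add: sum_nonneg)

lemma upper_le_one: "upper r p i \<le> 1"
  unfolding upper_def simplexD(3)[OF p, symmetric]
  using fin_ordD(1)[OF r] simplexD(1)[OF p] by (intro sum_mono2) auto

lemma upper_le_lower: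
  assumes "(i, j) \<in> r" "i \<noteq> j"
  shows "upper r p i \<le> lower r p j"
  unfolding upper_def lower_def
proof (rule sum_mono2)
  show "{j \<in> Field r. (j, i) \<in> r} \<subseteq> {i \<in> Field r. (i, j) \<in> r \<and> i \<noteq> j}"
    using assms fin_ordD(4,5)[OF r] by blast
qed (use fin_ordD(1)[OF r] simplexD(1)[OF p] in auto)

lemma cell_unique:
  assumes "x \<in> {lower r p i<..upper r p i}" "x \<in> {lower r p j<..upper r p j}"
    "i \<in> Field r" "j \<in> Field r"
  shows "i = j"
proof (rule ccontr)
  assume "i \<noteq> j"
  then show False
    using fin_ordD(6)[OF r assms(3,4)] upper_le_lower[of i j] upper_le_lower[of j i] assms by auto
qed

end

text \<open>A subdivision cuts out of \<open>[0, 1]\<close> finitely many intervals, ordered by \<open>S\<close>, such that the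
  interval \<open>s\<close> lies in the cell \<open>\<phi> s\<close> of the partition of \<open>[0, 1]\<close> with lengths \<open>p\<close>, and such that
  the path \<open>c i\<close> only increases on the intervals labelled \<open>i\<close>.\<close>

definition subdivision ::
  "nat \<Rightarrow> (nat \<Rightarrow> real \<Rightarrow> real) \<Rightarrow> nat rel \<Rightarrow> (nat \<Rightarrow> real) \<Rightarrow> nat rel \<Rightarrow> (nat \<Rightarrow> nat) \<Rightarrow> (nat \<Rightarrow> nat)
    \<Rightarrow> (nat \<Rightarrow> real) \<Rightarrow> (nat \<Rightarrow> real) \<Rightarrow> bool" where
  "subdivision k c r p S f \<phi> a b \<longleftrightarrow>
     S \<in> fin_ord \<and> f \<in> Field S \<rightarrow>\<^sub>E {..<k} \<and> \<phi> \<in> ord_hom S r \<and>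
     (\<forall>s\<in>Field S. 0 \<le> a s \<and> a s \<le> b s \<and> b s \<le> 1) \<and>
     (\<forall>(s, s')\<in>S. s \<noteq> s' \<longrightarrow> b s \<le> a s') \<and>
     (\<forall>s\<in>Field S. lower r p (\<phi> s) \<le> a s \<and> b s \<le> upper r p (\<phi> s)) \<and>
     (\<forall>i<k. (\<Sum>s\<in>{s \<in> Field S. f s = i}. c i (b s) - c i (a s)) = 1)"

text \<open>Extended by zero outside the fibre over \<open>i\<close>, so as to be a point of
  \<open>simplex_space\<close>.\<close>

definition weight :: "(nat \<Rightarrow> real \<Rightarrow> real) \<Rightarrow> nat rel \<Rightarrow> (nat \<Rightarrow> nat) \<Rightarrow> (nat \<Rightarrow> real) \<Rightarrow> (nat \<Rightarrow> real)
    \<Rightarrow> nat \<Rightarrow> nat \<Rightarrow> real" where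
  "weight c S f a b i s = (if s \<in> Field S \<and> f s = i then c i (b s) - c i (a s) else 0)"

lemma subdivisionD:
  assumes "subdivision k c r p S f \<phi> a b"
  shows "S \<in> fin_ord" "f \<in> Field S \<rightarrow>\<^sub>E {..<k}" "\<phi> \<in> ord_hom S r"
    "\<And>s. s \<in> Field S \<Longrightarrow> 0 \<le> a s \<and> a s \<le> b s \<and> b s \<le> 1"
    "\<And>s s'. (s, s') \<in> S \<Longrightarrow> s \<noteq> s' \<Longrightarrow> b s \<le> a s'"
    "\<And>s. s \<in> Field S \<Longrightarrow> lower r p (\<phi> s) \<le> a s \<and> b s \<le> upper r p (\<phi> s)"
    "\<And>i. i < k \<Longrightarrow> (\<Sum>s\<in>{s \<in> Field S. f s = i}. c i (b s) - c i (a s)) = 1"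
  using assms unfolding subdivision_def by auto

lemma weight_in_simplex:
  assumes "subdivision k c r p S f \<phi> a b" "i < k" "unit_path (c i)"
  shows "weight c S f a b i \<in> topspace (simplex_space (preimage_ord S f {i}))"
proof -
  note D = subdivisionD[OF assms(1)]
  have "(\<Sum>s\<in>{s \<in> Field S. f s = i}. weight c S f a b i s) = 1"
    unfolding D(7)[OF assms(2), symmetric] by (intro sum.cong) (auto simp: weight_def)
  then show ?thesis
    using D(1) D(4) unit_pathD(1)[OF assms(3)] by (auto simp: simplex_space_topspace weight_def)
qed

lemma subdivision_disjoint:
  assumes "subdivision k c r p S f \<phi> a b"
  shows "disjoint_family_on (\<lambda>s. {a s<..b s}) (Field S)"
  unfolding disjoint_family_on_def
proof (intro ballI impI)
  note D = subdivisionD[OF assms]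
  fix s t assume st: "s \<in> Field S" "t \<in> Field S" "s \<noteq> t"
  then have "b s \<le> a t \<or> b t \<le> a s"
    using fin_ordD(6)[OF D(1) st(1,2)] D(5) by metis
  then show "{a s<..b s} \<inter> {a t<..b t} = {}" by auto
qed

lemma subdivision_mass_split:
  assumes "subdivision k c r p S f \<phi> a b" "i < k" "unit_path (c i)" "0 \<le> x" "x \<le> y" "y \<le> 1"
  shows "(\<Sum>s\<in>{s \<in> Field S. f s = i}. mass (c i) ({x<..y} \<inter> {a s<..b s})) = c i y - c i x"
proof -
  note D = subdivisionD[OF assms(1)]
  have "disjoint_family_on (\<lambda>s. {a s<..b s}) {s \<in> Field S. f s = i}"
    using subdivision_disjoint[OF assms(1)] by (rule disjoint_family_on_mono[rotated]) auto
  then show ?thesis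
    using mass_split[OF assms(3) _ _ _ D(7)[OF assms(2)] assms(4-6)] D(4) fin_ordD(1)[OF D(1)]
    by auto
qed

section \<open>Values on subdivisions and independence of the choice\<close>

context cosimplicial_brackets
begin

lemma TotD:
  assumes "h \<in> topspace (Tot X push)"
  shows "h \<in> extensional fin_ord"
    "r \<in> fin_ord \<Longrightarrow> h r \<in> extensional (topspace (simplex_space r))"
    "r \<in> fin_ord \<Longrightarrow> continuous_map (simplex_space r) (X r) (h r)"
    "r \<in> fin_ord \<Longrightarrow> p \<in> topspace (simplex_space r) \<Longrightarrow> h r p \<in> topspace (X r)"
    "\<lbrakk>r \<in> fin_ord; r' \<in> fin_ord; \<phi> \<in> ord_hom r r'; p \<in> topspace (simplex_space r)\<rbrakk> \<Longrightarrow>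
       h r' (simplex_push r r' \<phi> p) = push r r' \<phi> (h r p)"
  using assms unfolding Tot_def by (auto simp: PiE_iff continuous_map_def)

text \<open>The formula of the overview with the points \<open>q i\<close> left free: besides the
  weights of a subdivision, \<open>val_unique\<close> inserts masses of overlaps.\<close>

definition val :: "nat \<Rightarrow> (nat \<Rightarrow> nat rel \<Rightarrow> (nat \<Rightarrow> real) \<Rightarrow> 'a) \<Rightarrow> nat rel \<Rightarrow> nat rel
    \<Rightarrow> (nat \<Rightarrow> nat) \<Rightarrow> (nat \<Rightarrow> nat) \<Rightarrow> (nat \<Rightarrow> nat \<Rightarrow> real) \<Rightarrow> 'a" where
  "val k y S r f \<phi> q = push S r \<phi> (brs S {..<k} f (\<lambda>i. y i (preimage_ord S f {i}) (q i)))"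

lemma push_in:
  assumes "r \<in> fin_ord" "r' \<in> fin_ord" "\<phi> \<in> ord_hom r r'" "x \<in> topspace (X r)"
  shows "push r r' \<phi> x \<in> topspace (X r')"
  using continuous_map_funspace[OF push_continuous[OF assms(1-3)]] assms(4) by auto

text \<open>Naturality of the \<open>y i\<close> turns the pushforward of the points
  \<open>q i\<close> to \<open>q' i\<close> into a pushforward of values, which
  \<open>brs_push\<close> exchanges with the bracket; functoriality of \<open>push\<close> then
  absorbs \<open>\<pi>\<close> into \<open>\<phi>\<close>.\<close>

lemma val_refine:
  assumes S: "S \<in> fin_ord" "S' \<in> fin_ord" "r \<in> fin_ord"
    and \<pi>: "\<pi> \<in> ord_hom S S'" and \<phi>': "\<phi>' \<in> ord_hom S' r" and \<phi>: "\<phi> = compose (Field S) \<phi>' \<pi>"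
    and f': "f' \<in> Field S' \<rightarrow> {..<k}" and f: "\<And>s. s \<in> Field S \<Longrightarrow> f s = f' (\<pi> s)"
    and y: "\<And>i. i < k \<Longrightarrow> y i \<in> topspace (Tot X push)"
    and q': "\<And>i. i < k \<Longrightarrow> q' i \<in> topspace (simplex_space (preimage_ord S' f' {i}))"
    and q0: "\<And>i s. i < k \<Longrightarrow> 0 \<le> q i s" "\<And>i s. i < k \<Longrightarrow> s \<notin> Field S \<or> f s \<noteq> i \<Longrightarrow> q i s = 0"
    and sum: "\<And>i s. i < k \<Longrightarrow> s \<in> Field S' \<Longrightarrow> f' s = i \<Longrightarrow>
      (\<Sum>u\<in>{u \<in> Field S. f u = i \<and> \<pi> u = s}. q i u) = q' i s"
  shows "val k y S r f \<phi> q = val k y S' r f' \<phi>' q'"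
proof -
  note fin = fin_ordD(1)[OF S(1)] fin_ordD(1)[OF S(2)]
  note \<pi>D = ord_homD[OF \<pi>]
  let ?P = "\<lambda>i. preimage_ord S f {i}" and ?P' = "\<lambda>i. preimage_ord S' f' {i}"
  let ?\<pi> = "\<lambda>i. restrict \<pi> (Field (?P i))"
  have hom: "?\<pi> i \<in> ord_hom (?P i) (?P' i)" for i
    using S \<pi> f by (intro ord_hom_restrict) auto
  have q: "q i \<in> topspace (simplex_space (?P i))" if i: "i < k" for i
  proof -
    have "(\<Sum>u\<in>{u \<in> Field S. f u = i}. q i u)
        = (\<Sum>s\<in>{s \<in> Field S'. f' s = i}. \<Sum>u\<in>{u \<in> {u \<in> Field S. f u = i}. \<pi> u = s}. q i u)"
      using fin f \<pi>D(2) by (intro sum.group[symmetric]) auto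
    also have "\<dots> = (\<Sum>s\<in>{s \<in> Field S'. f' s = i}. q' i s)"
      using sum[OF i] by (intro sum.cong) (auto simp: conj_ac)
    also have "\<dots> = 1"
      using simplexD(3)[OF q'[OF i]] S by simp
    finally show ?thesis
      using S q0[OF i] by (auto simp: simplex_space_topspace)
  qed
  have sp: "simplex_push (?P i) (?P' i) (?\<pi> i) (q i) = q' i" if i: "i < k" for i
  proof
    fix s
    have eq: "{u \<in> Field (?P i). ?\<pi> i u = s} = {u \<in> Field S. f u = i \<and> \<pi> u = s}"
      using S by auto
    show "simplex_push (?P i) (?P' i) (?\<pi> i) (q i) s = q' i s"
    proof (cases "s \<in> Field S' \<and> f' s = i")
      case True
      then show ?thesis unfolding simplex_push_def eq using sum[OF i] by auto
    next
      case False
      then have "{u \<in> Field S. f u = i \<and> \<pi> u = s} = {}"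
        using \<pi>D(2) f by auto
      then show ?thesis
        unfolding simplex_push_def eq using simplexD(2)[OF q'[OF i], of s] False S
        by (simp only: sum.empty) auto
    qed
  qed
  have fk: "f \<in> Field S \<rightarrow> {..<k}"
    using f f' \<pi>D(2) by auto
  have xi: "y i (?P i) (q i) \<in> topspace (X (?P i))" if "i \<in> {..<k}" for i
    using TotD(4)[OF y _ q] that S by auto
  have bin: "brs S {..<k} f (\<lambda>i. y i (?P i) (q i)) \<in> topspace (X S)"
    using S fk xi by (intro brs_in) auto
  have "restrict \<pi> (Field S) = \<pi>"
    using \<pi>D(1) by (rule extensional_restrict)
  then have "push S S' \<pi> (brs S {..<k} f (\<lambda>i. y i (?P i) (q i)))
      = brs S' {..<k} f' (\<lambda>i. push (?P i) (?P' i) (?\<pi> i) (y i (?P i) (q i)))"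
    using brs_push[OF S(1,2) \<pi>, of f' f "{..<k}" "\<lambda>i. y i (?P i) (q i)"] f xi
    by (simp add: preimage_ord_all[OF fk] preimage_ord_all[OF f'])
  also have "\<dots> = brs S' {..<k} f' (\<lambda>i. y i (?P' i) (q' i))"
  proof (rule brs_cong)
    fix i assume i: "i \<in> {..<k}"
    show "push (?P i) (?P' i) (?\<pi> i) (y i (?P i) (q i)) \<in> topspace (X (?P' i))"
      using S xi[OF i] hom by (intro push_in) auto
    show "push (?P i) (?P' i) (?\<pi> i) (y i (?P i) (q i)) = y i (?P' i) (q' i)"
      using TotD(5)[OF y _ _ hom q, of i i] i S sp[of i] by auto
  qed (use S in auto)
  finally show ?thesis
    unfolding val_def \<phi> using push_compose[OF S \<pi> \<phi>' bin] by simp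
qed

text \<open>Both subdivisions are coarsenings of the set of overlapping pairs of intervals, weighted
  by the masses of the overlaps, so \<open>val_refine\<close> applies twice.\<close>

lemma val_unique:
  assumes r: "r \<in> fin_ord" and p: "p \<in> topspace (simplex_space r)"
    and c: "\<And>i. i < k \<Longrightarrow> unit_path (c i)"
    and y: "\<And>i. i < k \<Longrightarrow> y i \<in> topspace (Tot X push)"
    and sub: "subdivision k c r p S f \<phi> a b" "subdivision k c r p S' f' \<phi>' a' b'"
  shows "val k y S r f \<phi> (weight c S f a b) = val k y S' r f' \<phi>' (weight c S' f' a' b')"
proof -
  note D = subdivisionD[OF sub(1)] and D' = subdivisionD[OF sub(2)]
  let ?I = "\<lambda>s. {a s<..b s}" and ?I' = "\<lambda>s. {a' s<..b' s}"
  \<comment> \<open>Overlaps with different labels are dropped. The intervals labelled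
    \<open>i\<close> in either subdivision carry the whole mass of \<open>c i\<close>, so pairs with
    equal labels already account for every weight.\<close>
  define E where "E = {(s, s'). s \<in> Field S \<and> s' \<in> Field S' \<and> f s = f' s' \<and> ?I s \<inter> ?I' s' \<noteq> {}}"
  define S2 where "S2 = {(prod_encode u, prod_encode v) | u v.
    u \<in> E \<and> v \<in> E \<and> (fst u, fst v) \<in> S \<and> (snd u, snd v) \<in> S'}"
  have finE: "finite E"
    using fin_ordD(1)[OF D(1)] fin_ordD(1)[OF D'(1)]
    by (intro finite_subset[of E "Field S \<times> Field S'"]) (auto simp: E_def)
  have reflS2: "(prod_encode u, prod_encode u) \<in> S2" if "u \<in> E" for u
    using that fin_ordD(3)[OF D(1)] fin_ordD(3)[OF D'(1)] unfolding S2_def E_def by auto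
  have F2: "Field S2 = prod_encode ` E"
  proof
    show "Field S2 \<subseteq> prod_encode ` E"
      by (auto simp: S2_def Field_def)
    show "prod_encode ` E \<subseteq> Field S2"
      using reflS2 by (auto intro: FieldI1)
  qed
  have less: "(s, t) \<in> S" if "s \<in> Field S" "t \<in> Field S" "x \<in> ?I s" "z \<in> ?I t" "x \<le> z" for s t x z
    using fin_ordD(6)[OF D(1) that(1,2)] D(5)[of t s] fin_ordD(3)[OF D(1) that(1)] that
    by (cases "s = t") auto
  have less': "(s, t) \<in> S'" if "s \<in> Field S'" "t \<in> Field S'" "x \<in> ?I' s" "z \<in> ?I' t" "x \<le> z" for s t x z
    using fin_ordD(6)[OF D'(1) that(1,2)] D'(5)[of t s] fin_ordD(3)[OF D'(1) that(1)] that
    by (cases "s = t") auto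
  have S2: "S2 \<in> fin_ord"
    unfolding fin_ord_def linear_order_on_def partial_order_on_def preorder_on_def
  proof (intro CollectI conjI)
    show "finite (Field S2)" using finE by (simp add: F2)
    show "S2 \<subseteq> Field S2 \<times> Field S2" by (auto simp: Field_def)
    show "refl_on (Field S2) S2" using reflS2 by (auto simp: F2 refl_on_def)
    show "trans S2"
      unfolding S2_def trans_def using fin_ordD(5)[OF D(1)] fin_ordD(5)[OF D'(1)] by (auto; metis)
    show "antisym S2"
      unfolding S2_def antisym_def using fin_ordD(4)[OF D(1)] fin_ordD(4)[OF D'(1)]
      by (auto simp: prod_eq_iff)
    show "total_on (Field S2) S2"
      unfolding total_on_def F2
    proof (intro ballI impI)
      fix m n assume "m \<in> prod_encode ` E" "n \<in> prod_encode ` E"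
      then obtain u v where uv: "u \<in> E" "v \<in> E" "m = prod_encode u" "n = prod_encode v" by auto
      \<comment> \<open>Comparing one point of each overlap decides the order in both components at
        once; hence the componentwise order is total.\<close>
      obtain x z where "x \<in> ?I (fst u) \<inter> ?I' (snd u)" "z \<in> ?I (fst v) \<inter> ?I' (snd v)"
        using uv unfolding E_def by fastforce
      then show "(m, n) \<in> S2 \<or> (n, m) \<in> S2"
        using uv less[of "fst u" "fst v" x z] less[of "fst v" "fst u" z x]
          less'[of "snd u" "snd v" x z] less'[of "snd v" "snd u" z x]
        unfolding S2_def E_def by (cases "x \<le> z") auto
    qed
  qed
  define \<pi> where "\<pi> = (\<lambda>n\<in>Field S2. fst (prod_decode n))"
  define \<pi>' where "\<pi>' = (\<lambda>n\<in>Field S2. snd (prod_decode n))"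
  have \<pi>: "\<pi> \<in> ord_hom S2 S" and \<pi>': "\<pi>' \<in> ord_hom S2 S'"
    using S2 by (auto intro!: ord_homI simp: \<pi>_def \<pi>'_def F2) (auto simp: S2_def)
  define q where "q i n = (if n \<in> Field S2 \<and> f (\<pi> n) = i then mass (c i) (?I (\<pi> n) \<inter> ?I' (\<pi>' n)) else 0)"
    for i n
  have EF: "\<pi> n \<in> Field S" "\<pi>' n \<in> Field S'" "f (\<pi> n) = f' (\<pi>' n)" "\<phi> (\<pi> n) = \<phi>' (\<pi>' n)"
    if nF: "n \<in> Field S2" for n
  proof -
    obtain u where u: "u \<in> E" "n = prod_encode u"
      using nF unfolding F2 by blast
    obtain s s' where "u = (s, s')" by (cases u)
    with u have n: "n = prod_encode (s, s')" "(s, s') \<in> E" by auto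
    have \<pi>n: "\<pi> n = s" "\<pi>' n = s'"
      using nF n(1) by (auto simp: \<pi>_def \<pi>'_def)
    then show EF1: "\<pi> n \<in> Field S" "\<pi>' n \<in> Field S'" "f (\<pi> n) = f' (\<pi>' n)"
      using n(2) by (auto simp: E_def)
    \<comment> \<open>A common point of the two intervals lies in the cells of both images, so the
      maps to \<open>r\<close> agree on the refinement.\<close>
    obtain x where x: "x \<in> ?I s" "x \<in> ?I' s'"
      using n(2) unfolding E_def by blast
    show "\<phi> (\<pi> n) = \<phi>' (\<pi>' n)"
    proof (rule cell_unique[OF r p])
      show "x \<in> {lower r p (\<phi> (\<pi> n))<..upper r p (\<phi> (\<pi> n))}"
        using D(6)[OF EF1(1)] x \<pi>n by auto
      show "x \<in> {lower r p (\<phi>' (\<pi>' n))<..upper r p (\<phi>' (\<pi>' n))}"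
        using D'(6)[OF EF1(2)] x \<pi>n by auto
    qed (use EF1 ord_homD(2)[OF D(3)] ord_homD(2)[OF D'(3)] in auto)
  qed
  have enc: "prod_encode (s, s') \<in> Field S2" "\<pi> (prod_encode (s, s')) = s" "\<pi>' (prod_encode (s, s')) = s'"
    if "(s, s') \<in> E" for s s'
    using that by (auto simp: F2 \<pi>_def \<pi>'_def)
  have dec: "(\<pi> n, \<pi>' n) \<in> E" "prod_encode (\<pi> n, \<pi>' n) = n" if "n \<in> Field S2" for n
    using that by (auto simp: F2 \<pi>_def \<pi>'_def)
  have zero: "mass g (?I s \<inter> ?I' s') = 0" "mass g (?I' s' \<inter> ?I s) = 0"
    if "(s, s') \<notin> E" "s \<in> Field S" "s' \<in> Field S'" "f s = f' s'" for s s' g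
  proof -
    have "?I s \<inter> ?I' s' = {}"
      using that unfolding E_def by blast
    then show "mass g (?I s \<inter> ?I' s') = 0" "mass g (?I' s' \<inter> ?I s) = 0"
      by (simp_all only: Int_commute[of "?I' s'"] mass_empty)
  qed
  have sum1: "(\<Sum>u\<in>{u \<in> Field S2. f (\<pi> u) = i \<and> \<pi> u = s}. q i u) = weight c S f a b i s"
    if i: "i < k" and s: "s \<in> Field S" "f s = i" for i s
  proof -
    have "(\<Sum>u\<in>{u \<in> Field S2. f (\<pi> u) = i \<and> \<pi> u = s}. q i u)
      = (\<Sum>s'\<in>{s' \<in> Field S'. f' s' = i \<and> (s, s') \<in> E}. mass (c i) (?I s \<inter> ?I' s'))"
    proof (rule sum.reindex_bij_witness[of _ "\<lambda>s'. prod_encode (s, s')" \<pi>'])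
      fix u assume u: "u \<in> {u \<in> Field S2. f (\<pi> u) = i \<and> \<pi> u = s}"
      then show "prod_encode (s, \<pi>' u) = u" "mass (c i) (?I s \<inter> ?I' (\<pi>' u)) = q i u"
        "\<pi>' u \<in> {s' \<in> Field S'. f' s' = i \<and> (s, s') \<in> E}"
        using dec[of u] EF[of u] unfolding q_def by force+
    next
      fix s' assume "s' \<in> {s' \<in> Field S'. f' s' = i \<and> (s, s') \<in> E}"
      then show "\<pi>' (prod_encode (s, s')) = s'" "prod_encode (s, s') \<in> {u \<in> Field S2. f (\<pi> u) = i \<and> \<pi> u = s}"
        using enc[of s s'] s by auto
    qed
    also have "\<dots> = (\<Sum>s'\<in>{s' \<in> Field S'. f' s' = i}. mass (c i) (?I s \<inter> ?I' s'))"
      using fin_ordD(1)[OF D'(1)] zero(1)[of s] s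
      by (intro sum.mono_neutral_left) (auto simp del: Int_greaterThanAtMost)
    also have "\<dots> = c i (b s) - c i (a s)"
      using D(4)[OF s(1)] by (intro subdivision_mass_split[OF sub(2) i c[OF i]]) auto
    finally show ?thesis using s by (simp add: weight_def)
  qed
  have sum2: "(\<Sum>u\<in>{u \<in> Field S2. f (\<pi> u) = i \<and> \<pi>' u = s'}. q i u) = weight c S' f' a' b' i s'"
    if i: "i < k" and s': "s' \<in> Field S'" "f' s' = i" for i s'
  proof -
    have "(\<Sum>u\<in>{u \<in> Field S2. f (\<pi> u) = i \<and> \<pi>' u = s'}. q i u)
      = (\<Sum>s\<in>{s \<in> Field S. f s = i \<and> (s, s') \<in> E}. mass (c i) (?I' s' \<inter> ?I s))"
    proof (rule sum.reindex_bij_witness[of _ "\<lambda>s. prod_encode (s, s')" \<pi>])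
      fix u assume u: "u \<in> {u \<in> Field S2. f (\<pi> u) = i \<and> \<pi>' u = s'}"
      then show "prod_encode (\<pi> u, s') = u" "mass (c i) (?I' s' \<inter> ?I (\<pi> u)) = q i u"
        "\<pi> u \<in> {s \<in> Field S. f s = i \<and> (s, s') \<in> E}"
        using dec[of u] EF[of u] unfolding q_def by (force simp: Int_commute)+
    next
      fix s assume "s \<in> {s \<in> Field S. f s = i \<and> (s, s') \<in> E}"
      then show "\<pi> (prod_encode (s, s')) = s" "prod_encode (s, s') \<in> {u \<in> Field S2. f (\<pi> u) = i \<and> \<pi>' u = s'}"
        using enc[of s s'] by auto
    qed
    also have "\<dots> = (\<Sum>s\<in>{s \<in> Field S. f s = i}. mass (c i) (?I' s' \<inter> ?I s))"
      using fin_ordD(1)[OF D(1)] zero(2)[of _ s'] s'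
      by (intro sum.mono_neutral_left) (auto simp del: Int_greaterThanAtMost)
    also have "\<dots> = c i (b' s') - c i (a' s')"
      using D'(4)[OF s'(1)] by (intro subdivision_mass_split[OF sub(1) i c[OF i]]) auto
    finally show ?thesis using s' by (simp add: weight_def)
  qed
  have "val k y S2 r (\<lambda>n. f (\<pi> n)) (compose (Field S2) \<phi> \<pi>) q = val k y S r f \<phi> (weight c S f a b)"
    using D(2) by (intro val_refine[OF S2 D(1) r \<pi> D(3) refl] y sum1 weight_in_simplex[OF sub(1)] c)
      (auto simp: q_def mass_nonneg)
  moreover have "val k y S2 r (\<lambda>n. f (\<pi> n)) (compose (Field S2) \<phi> \<pi>) q
      = val k y S' r f' \<phi>' (weight c S' f' a' b')"
    using D'(2) EF
    by (intro val_refine[OF S2 D'(1) r \<pi>' D'(3)] y sum2 weight_in_simplex[OF sub(2)] c)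
      (auto simp: q_def mass_nonneg compose_def fun_eq_iff)
  ultimately show ?thesis by simp
qed

end

section \<open>Existence of subdivisions\<close>

lemma fin_ord_greatest:
  assumes r: "r \<in> fin_ord" and "finite A" "A \<noteq> {}" "A \<subseteq> Field r"
  shows "\<exists>m\<in>A. \<forall>x\<in>A. (x, m) \<in> r"
  using assms(2-)
proof (induction A rule: finite_ne_induct)
  case (singleton x)
  then show ?case using fin_ordD(3)[OF r] by auto
next
  case (insert x A)
  then obtain m where m: "m \<in> A" "\<And>x. x \<in> A \<Longrightarrow> (x, m) \<in> r"
    by auto
  then have "(x, m) \<in> r \<or> (m, x) \<in> r"
    using insert.prems fin_ordD(6)[OF r] by auto
  then show ?case
  proof
    assume "(x, m) \<in> r"
    then show ?thesis using m by auto
  next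
    assume "(m, x) \<in> r"
    then show ?thesis
      using m insert.prems fin_ordD(3)[OF r] by (intro bexI[of _ x]) (auto intro: fin_ordD(5)[OF r])
  qed
qed

lemma fin_ord_least:
  assumes r: "r \<in> fin_ord" and "finite A" "A \<noteq> {}" "A \<subseteq> Field r"
  shows "\<exists>m\<in>A. \<forall>x\<in>A. (m, x) \<in> r"
proof -
  have "converse r \<in> fin_ord"
    using r by (auto simp: fin_ord_def)
  from fin_ord_greatest[OF this assms(2,3)] assms(4) show ?thesis by auto
qed

text \<open>The least \<open>j\<close> whose cell ends at or after \<open>z\<close> works: its lower
  end is 0 or the upper end of its predecessor, which falls short of \<open>z\<close>. Minimality is
  kept in the conclusion because it makes the map from a subdivision to \<open>r\<close>
  order-preserving.\<close>

lemma cell_exists: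
  assumes r: "r \<in> fin_ord" and p: "p \<in> topspace (simplex_space r)" and z: "0 < z" "z \<le> 1"
  shows "\<exists>j\<in>Field r. lower r p j < z \<and> z \<le> upper r p j \<and>
    (\<forall>j'\<in>Field r. z \<le> upper r p j' \<longrightarrow> (j, j') \<in> r)"
proof -
  note fin = fin_ordD(1)[OF r]
  have "Field r \<noteq> {}"
    using simplexD(3)[OF p] by auto
  from fin_ord_greatest[OF r fin this] obtain m where m: "m \<in> Field r" "\<forall>x\<in>Field r. (x, m) \<in> r"
    by auto
  then have "{j \<in> Field r. (j, m) \<in> r} = Field r"
    by auto
  then have "upper r p m = 1"
    using simplexD(3)[OF p] by (simp add: upper_def)
  then have "m \<in> {j \<in> Field r. z \<le> upper r p j}"
    using m z by auto
  then obtain j where j: "j \<in> Field r" "z \<le> upper r p j"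
    and least: "\<And>j'. j' \<in> Field r \<Longrightarrow> z \<le> upper r p j' \<Longrightarrow> (j, j') \<in> r"
    using fin_ord_least[OF r, of "{j \<in> Field r. z \<le> upper r p j}"] fin by auto
  have "lower r p j < z"
  proof (cases "{i \<in> Field r. (i, j) \<in> r \<and> i \<noteq> j} = {}")
    case True
    then have "lower r p j = 0" unfolding lower_def by (simp only: sum.empty)
    with z show ?thesis by simp
  next
    case False
    then obtain i where i: "i \<in> Field r" "(i, j) \<in> r" "i \<noteq> j"
      "\<And>i'. i' \<in> Field r \<Longrightarrow> (i', j) \<in> r \<Longrightarrow> i' \<noteq> j \<Longrightarrow> (i', i) \<in> r"
      using fin_ord_greatest[OF r _ False] fin by auto
    have "{i' \<in> Field r. (i', i) \<in> r} = {i \<in> Field r. (i, j) \<in> r \<and> i \<noteq> j}"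
      using i fin_ordD(4,5)[OF r] by blast
    then have "lower r p j = upper r p i"
      by (simp add: upper_def lower_def)
    moreover have "\<not> z \<le> upper r p i"
      using least[OF i(1)] i(2,3) fin_ordD(4)[OF r] by blast
    ultimately show ?thesis by simp
  qed
  with j least show ?thesis by blast
qed

text \<open>Any finite set containing the corners qualifies, so break sets can be enlarged freely
  and their cardinalities only need to be estimated from above.\<close>

definition breaks :: "nat \<Rightarrow> (nat \<Rightarrow> real \<Rightarrow> real) \<Rightarrow> real set \<Rightarrow> bool" where
  "breaks k c F \<longleftrightarrow> finite F \<and>
     (\<forall>x y. x < y \<longrightarrow> {x<..<y} \<inter> F = {} \<longrightarrow>
       (\<forall>i<k. \<forall>j<k. c i x \<noteq> c i y \<longrightarrow> c j x \<noteq> c j y \<longrightarrow> i = j))"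

lemma finite_real_enumeration:
  fixes A :: "real set"
  assumes A: "finite A" "A \<subseteq> {0..1}" "0 \<in> A" "1 \<in> A"
  shows "\<exists>(x :: nat \<Rightarrow> real) M. M < card A \<and> x 0 = 0 \<and> x M = 1 \<and>
    (\<forall>m m'. m < m' \<longrightarrow> m' \<le> M \<longrightarrow> x m < x m') \<and> (\<forall>m\<le>M. x m \<in> A) \<and>
    (\<forall>m<M. \<forall>z\<in>A. z \<le> x m \<or> x (Suc m) \<le> z)"
proof -
  define xs where "xs = sorted_list_of_set A"
  have set: "set xs = A" and len: "length xs = card A"
    using A by (auto simp: xs_def)
  have less: "xs ! m < xs ! m'" if "m < m'" "m' < length xs" for m m'
    using that sorted_wrt_nth_less[of "(<)" xs] by (simp add: xs_def)
  have le: "xs ! m \<le> xs ! m'" if "m \<le> m'" "m' < length xs" for m m'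
    using that less[of m m'] by (cases "m = m'") auto
  have pos: "0 < length xs"
    using set A by auto
  have in01: "xs ! m \<in> A" if "m < length xs" for m
    using that set by auto
  obtain i where i: "i < length xs" "xs ! i = 0"
    using A set by (metis in_set_conv_nth)
  obtain j where j: "j < length xs" "xs ! j = 1"
    using A set by (metis in_set_conv_nth)
  show ?thesis
  proof (rule exI[of _ "\<lambda>m. xs ! m"], rule exI[of _ "length xs - 1"], intro conjI allI impI ballI)
    show "xs ! 0 = 0"
      using le[of 0 i] i in01[of 0] A(2) pos by fastforce
    show "xs ! (length xs - 1) = 1"
      using le[of j "length xs - 1"] j in01[of "length xs - 1"] A(2) pos by fastforce
    fix m z assume m: "m < length xs - 1" "z \<in> A"
    then obtain l where l: "l < length xs" "z = xs ! l"
      using set by (metis in_set_conv_nth)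
    show "z \<le> xs ! m \<or> xs ! Suc m \<le> z"
      using le[of l m] le[of "Suc m" l] l m by (cases "l \<le> m") auto
  qed (use len less in01 pos in auto)
qed

text \<open>The injection \<open>e\<close> prescribes the names of the elements of \<open>S\<close>.
  Continuity of the action needs them in a fixed finite set, and composition needs disjoint sets of
  names for several subdivisions.\<close>

lemma subdivision_exists:
  assumes r: "r \<in> fin_ord" and p: "p \<in> topspace (simplex_space r)"
    and c: "\<And>i. i < k \<Longrightarrow> unit_path (c i)" and F: "breaks k c F" "card F \<le> n" and e: "inj e"
  shows "\<exists>S f \<phi> a b. subdivision k c r p S f \<phi> a b \<and> Field S \<subseteq> e ` {..<n + 2 * card (Field r) + 2}"
proof -
  note fin = fin_ordD(1)[OF r]
  \<comment> \<open>At most \<open>n\<close> breaks, two ends for each cell, and 0 and 1: this is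
    the bound \<open>n + 2 * card (Field r) + 2\<close>.\<close>
  define A where "A = F \<inter> {0..1} \<union> lower r p ` Field r \<union> upper r p ` Field r \<union> {0, 1}"
  have lu: "0 \<le> lower r p j" "lower r p j \<le> 1" "0 \<le> upper r p j" "upper r p j \<le> 1"
    if "j \<in> Field r" for j
    using lower_nonneg[OF r p, of j] upper_le_one[OF r p, of j] upper_eq[OF r p that]
      simplexD(1)[OF p, of j] by auto
  have finF: "finite F"
    using F by (simp add: breaks_def)
  have A: "finite A" "A \<subseteq> {0..1}" "0 \<in> A" "1 \<in> A"
    using finF fin lu by (auto simp: A_def)
  have "card A \<le> card (F \<inter> {0..1}) + card (lower r p ` Field r) + card (upper r p ` Field r) + card {0, 1::real}"
    unfolding A_def by (intro order.trans[OF card_Un_le] add_right_mono order.refl)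
  also have "\<dots> \<le> n + card (Field r) + card (Field r) + 2"
    using F(2) card_mono[of F "F \<inter> {0..1}"] finF fin
    by (intro add_mono card_image_le) auto
  finally have cardA: "card A \<le> n + 2 * card (Field r) + 2" by simp
  obtain x :: "nat \<Rightarrow> real" and M :: nat where x: "M < card A" "x 0 = 0" "x M = 1"
    "\<And>m m'. m < m' \<Longrightarrow> m' \<le> M \<Longrightarrow> x m < x m'" "\<And>m. m \<le> M \<Longrightarrow> x m \<in> A"
    "\<And>m z. m < M \<Longrightarrow> z \<in> A \<Longrightarrow> z \<le> x m \<or> x (Suc m) \<le> z"
  proof -
    obtain x M where "M < card A \<and> x 0 = 0 \<and> x M = 1 \<and>
      (\<forall>m m'. m < m' \<longrightarrow> m' \<le> M \<longrightarrow> x m < x m') \<and> (\<forall>m\<le>M. x m \<in> A) \<and>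
      (\<forall>m<M. \<forall>z\<in>A. z \<le> x m \<or> x (Suc m) \<le> z)"
      using finite_real_enumeration[OF A] by (elim exE)
    then show ?thesis by (intro that[of M x]) auto
  qed
  have xle: "x m \<le> x m'" if "m \<le> m'" "m' \<le> M" for m m'
    using that x(4)[of m m'] by (cases "m = m'") auto
  have x01: "0 \<le> x m" "x m \<le> 1" if "m \<le> M" for m
    using x(5)[OF that] A(2) by auto
  define \<phi>0 where "\<phi>0 m = (SOME j. j \<in> Field r \<and> lower r p j < x (Suc m) \<and> x (Suc m) \<le> upper r p j \<and>
    (\<forall>j'\<in>Field r. x (Suc m) \<le> upper r p j' \<longrightarrow> (j, j') \<in> r))" for m
  have \<phi>0: "\<phi>0 m \<in> Field r" "lower r p (\<phi>0 m) < x (Suc m)" "x (Suc m) \<le> upper r p (\<phi>0 m)"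
    "\<And>j'. j' \<in> Field r \<Longrightarrow> x (Suc m) \<le> upper r p j' \<Longrightarrow> (\<phi>0 m, j') \<in> r" if "m < M" for m
  proof -
    have "0 < x (Suc m)" "x (Suc m) \<le> 1"
      using x(4)[of 0 "Suc m"] x(2) x01[of "Suc m"] that by auto
    from cell_exists[OF r p this] have "\<exists>j. j \<in> Field r \<and> lower r p j < x (Suc m) \<and> x (Suc m) \<le> upper r p j \<and>
      (\<forall>j'\<in>Field r. x (Suc m) \<le> upper r p j' \<longrightarrow> (j, j') \<in> r)" by blast
    from someI_ex[OF this, folded \<phi>0_def]
    show "\<phi>0 m \<in> Field r" "lower r p (\<phi>0 m) < x (Suc m)" "x (Suc m) \<le> upper r p (\<phi>0 m)"
      "\<And>j'. j' \<in> Field r \<Longrightarrow> x (Suc m) \<le> upper r p j' \<Longrightarrow> (\<phi>0 m, j') \<in> r" by blast+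
  qed
  have low: "lower r p (\<phi>0 m) \<le> x m" if "m < M" for m
  proof -
    have "lower r p (\<phi>0 m) \<in> A"
      using \<phi>0(1)[OF that] by (auto simp: A_def)
    then show ?thesis using x(6)[OF that] \<phi>0(2)[OF that] by force
  qed
  \<comment> \<open>Pieces on which no coordinate moves have no label and are discarded; on each
    remaining piece exactly one coordinate moves. For \<open>k = 0\<close> nothing remains and
    \<open>S\<close> is empty.\<close>
  define D where "D = {m. m < M \<and> (\<exists>i<k. c i (x m) \<noteq> c i (x (Suc m)))}"
  define lab where "lab m = (SOME i. i < k \<and> c i (x m) \<noteq> c i (x (Suc m)))" for m
  have lab: "lab m < k" "c (lab m) (x m) \<noteq> c (lab m) (x (Suc m))" if "m \<in> D" for m
    using someI_ex[of "\<lambda>i. i < k \<and> c i (x m) \<noteq> c i (x (Suc m))"] that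
    unfolding D_def lab_def by auto
  have lab_unique: "lab m = i" "m \<in> D" if m: "m < M" and i: "i < k" "c i (x m) \<noteq> c i (x (Suc m))" for m i
  proof -
    show "m \<in> D" using that by (auto simp: D_def)
    have "{x m<..<x (Suc m)} \<inter> F = {}"
    proof (rule ccontr)
      assume "{x m<..<x (Suc m)} \<inter> F \<noteq> {}"
      then obtain z where z: "z \<in> F" "x m < z" "z < x (Suc m)" by auto
      then have "z \<in> A"
        using x01[of m] x01[of "Suc m"] m by (auto simp: A_def)
      with x(6)[OF m] z show False by force
    qed
    then show "lab m = i"
      using F(1) lab[OF \<open>m \<in> D\<close>] i x(4)[of m "Suc m"] m unfolding breaks_def by auto
  qed
  have DM: "m < M" if "m \<in> D" for m
    using that by (simp add: D_def)
  obtain d where d: "\<And>m. d (e m) = m"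
    using e inv_f_f by metis
  define S where "S = {(e m, e m') | m m'. m \<in> D \<and> m' \<in> D \<and> m \<le> m'}"
  have FS: "Field S = e ` D"
    by (auto simp: S_def Field_def)
  have S: "S \<in> fin_ord"
    unfolding fin_ord_def linear_order_on_def partial_order_on_def preorder_on_def
  proof (intro CollectI conjI)
    show "finite (Field S)" by (simp add: FS D_def)
    show "S \<subseteq> Field S \<times> Field S" by (auto simp: Field_def)
    show "refl_on (Field S) S" unfolding refl_on_def FS by (auto simp: S_def)
    show "trans S"
      unfolding S_def trans_def using injD[OF e] by (auto; metis order.trans)
    show "antisym S"
      unfolding S_def antisym_def using injD[OF e] by (auto; metis order.antisym)
    show "total_on (Field S) S"
      unfolding total_on_def FS
    proof (intro ballI impI)
      fix s s' assume "s \<in> e ` D" "s' \<in> e ` D"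
      then obtain m m' where "s = e m" "s' = e m'" "m \<in> D" "m' \<in> D" by auto
      then show "(s, s') \<in> S \<or> (s', s) \<in> S"
        using linear[of m m'] unfolding S_def by blast
    qed
  qed
  define f where "f = (\<lambda>s\<in>Field S. lab (d s))"
  define \<phi> where "\<phi> = (\<lambda>s\<in>Field S. \<phi>0 (d s))"
  have v: "f (e m) = lab m" "\<phi> (e m) = \<phi>0 m" if "m \<in> D" for m
    using that by (auto simp: f_def \<phi>_def FS d)
  have "subdivision k c r p S f \<phi> (\<lambda>s. x (d s)) (\<lambda>s. x (Suc (d s)))"
    unfolding subdivision_def
  proof (intro conjI S ballI allI impI)
    show "f \<in> Field S \<rightarrow>\<^sub>E {..<k}"
      using lab by (auto simp: f_def FS d)
    show "\<phi> \<in> ord_hom S r"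
    proof (rule ord_homI[OF _ _ S])
      fix s s' assume "(s, s') \<in> S"
      then obtain m m' where m: "s = e m" "s' = e m'" "m \<in> D" "m' \<in> D" "m \<le> m'"
        by (auto simp: S_def)
      have "x (Suc m) \<le> upper r p (\<phi>0 m')"
        using \<phi>0(3)[OF DM[OF m(4)]] xle[of "Suc m" "Suc m'"] DM[OF m(4)] m(5) by auto
      then show "(\<phi> s, \<phi> s') \<in> r"
        using \<phi>0(4)[OF DM[OF m(3)] \<phi>0(1)[OF DM[OF m(4)]]] m v by auto
    qed (simp add: \<phi>_def)
  next
    fix s assume "s \<in> Field S"
    then obtain m where m: "s = e m" "m \<in> D" by (auto simp: FS)
    show "0 \<le> x (d s)" "x (d s) \<le> x (Suc (d s))" "x (Suc (d s)) \<le> 1"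
      using DM[OF m(2)] x01[of m] x01[of "Suc m"] x(4)[of m "Suc m"] by (auto simp: m d)
    show "lower r p (\<phi> s) \<le> x (d s)" "x (Suc (d s)) \<le> upper r p (\<phi> s)"
      using low[OF DM[OF m(2)]] \<phi>0(3)[OF DM[OF m(2)]] by (auto simp: m d v)
  next
    fix u assume "u \<in> S"
    then obtain m m' where m: "u = (e m, e m')" "m \<in> D" "m' \<in> D" "m \<le> m'"
      by (auto simp: S_def)
    show "case u of (s, s') \<Rightarrow> s \<noteq> s' \<longrightarrow> x (Suc (d s)) \<le> x (d s')"
      using xle[of "Suc m" m'] DM[OF m(3)] m by (cases "m = m'") (auto simp: d)
  next
    fix i assume i: "i < k"
    have "(\<Sum>s\<in>{s \<in> Field S. f s = i}. c i (x (Suc (d s))) - c i (x (d s)))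
      = (\<Sum>m\<in>{m \<in> D. lab m = i}. c i (x (Suc m)) - c i (x m))"
      by (rule sum.reindex_bij_witness[of _ e d]) (auto simp: FS d v)
    also have "\<dots> = (\<Sum>m<M. c i (x (Suc m)) - c i (x m))"
    proof (rule sum.mono_neutral_left)
      show "\<forall>m\<in>{..<M} - {m \<in> D. lab m = i}. c i (x (Suc m)) - c i (x m) = 0"
        using lab_unique[OF _ i] by force
    qed (auto simp: D_def)
    also have "\<dots> = c i (x M) - c i (x 0)"
      by (rule sum_lessThan_telescope)
    also have "\<dots> = 1"
      using unit_pathD(3,4)[OF c[OF i]] x by simp
    finally show "(\<Sum>s\<in>{s \<in> Field S. f s = i}. c i (x (Suc (d s))) - c i (x (d s))) = 1" .
  qed
  moreover have "Field S \<subseteq> e ` {..<n + 2 * card (Field r) + 2}"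
    using DM x(1) cardA by (fastforce simp: FS)
  ultimately show ?thesis by blast
qed

section \<open>The operad of lattice paths\<close>

text \<open>Coordinate \<open>i\<close> of a path is stored as \<open>c (Suc i)\<close>, and \<open>c 0 = (\<lambda>_. t)\<close> carries a real bound \<open>t\<close> on the
  number of its breaks. The bound makes the number of breaks locally bounded, which the continuity of
  the action depends on.\<close>

definition op_set :: "nat \<Rightarrow> (nat \<Rightarrow> real \<Rightarrow> real) set" where
  "op_set k = {c. (\<forall>x. c 0 x = c 0 0) \<and> (\<forall>i<k. unit_path (c (Suc i))) \<and> (\<forall>i\<ge>k. c (Suc i) = (\<lambda>_. 0)) \<and>
     (\<exists>F. breaks k (\<lambda>i. c (Suc i)) F \<and> real (card F) \<le> c 0 0)}"

definition op_space :: "nat \<Rightarrow> (nat \<Rightarrow> real \<Rightarrow> real) topology" where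
  "op_space k = subtopology
     (product_topology (\<lambda>_. product_topology (\<lambda>_. euclideanreal) UNIV) UNIV) (op_set k)"

text \<open>Coordinates beyond the arity are zero, so an operation is determined by its bound and
  its first \<open>k\<close> coordinates; see \<open>op_ext\<close>.\<close>

definition mk_op :: "nat \<Rightarrow> real \<Rightarrow> (nat \<Rightarrow> real \<Rightarrow> real) \<Rightarrow> nat \<Rightarrow> real \<Rightarrow> real" where
  "mk_op k t g n = (case n of 0 \<Rightarrow> (\<lambda>_. t) | Suc i \<Rightarrow> if i < k then g i else (\<lambda>_. 0))"

lemma mk_op_simps [simp]: "mk_op k t g 0 = (\<lambda>_. t)" "i < k \<Longrightarrow> mk_op k t g (Suc i) = g i"
  "\<not> i < k \<Longrightarrow> mk_op k t g (Suc i) = (\<lambda>_. 0)"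
  by (auto simp: mk_op_def)

lemma topspace_op_space [simp]: "topspace (op_space k) = op_set k"
  by (simp add: op_space_def)

lemma op_setD:
  assumes "c \<in> op_set k"
  shows "c 0 x = c 0 0" "i < k \<Longrightarrow> unit_path (c (Suc i))" "\<not> i < k \<Longrightarrow> c (Suc i) = (\<lambda>_. 0)"
    "\<exists>F. breaks k (\<lambda>i. c (Suc i)) F \<and> real (card F) \<le> c 0 0" "0 \<le> c 0 0"
proof -
  show 4: "\<exists>F. breaks k (\<lambda>i. c (Suc i)) F \<and> real (card F) \<le> c 0 0"
    using assms unfolding op_set_def by blast
  then show "0 \<le> c 0 0" by (meson of_nat_0_le_iff order.trans)
qed (use assms in \<open>auto simp: op_set_def\<close>)

lemma op_eqI:
  assumes "c \<in> op_set k" "t = c 0 0" "\<And>i. i < k \<Longrightarrow> g i = c (Suc i)"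
  shows "mk_op k t g = c"
proof
  fix n show "mk_op k t g n = c n"
  proof (cases n)
    case 0
    have "c 0 = (\<lambda>_. c 0 0)" using op_setD(1)[OF assms(1)] by (rule ext)
    then show ?thesis unfolding 0 mk_op_simps assms(2) by (rule sym)
  next
    case (Suc i)
    then show ?thesis using assms(3)[of i] op_setD(3)[OF assms(1), of i] by (cases "i < k") auto
  qed
qed

lemma breaks_cong:
  assumes "\<And>i. i < k \<Longrightarrow> g i = g' i"
  shows "breaks k g F \<longleftrightarrow> breaks k g' F"
  using assms unfolding breaks_def by auto

lemma mk_op_in:
  assumes "\<And>i. i < k \<Longrightarrow> unit_path (g i)" "breaks k g F" "real (card F) \<le> t"
  shows "mk_op k t g \<in> op_set k"
proof -
  have "breaks k (\<lambda>i. mk_op k t g (Suc i)) F"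
    using assms(2) by (subst breaks_cong[of k _ g]) auto
  then show ?thesis using assms by (auto simp: op_set_def)
qed

lemma continuous_map_op_coord: "continuous_map (op_space k) euclideanreal (\<lambda>c. c n x)"
proof -
  have "continuous_map (product_topology (\<lambda>_. product_topology (\<lambda>_. euclideanreal) UNIV) UNIV)
      (product_topology (\<lambda>_. euclideanreal) UNIV) (\<lambda>c. c n)"
    by (rule continuous_map_product_projection) simp
  from continuous_map_compose[OF this continuous_map_product_projection[of x UNIV "\<lambda>_. euclideanreal"]]
  show ?thesis
    unfolding op_space_def by (intro continuous_map_from_subtopology) (simp add: comp_def)
qed

lemma continuous_map_mk_op:
  assumes "continuous_map Z euclideanreal t"
    and "\<And>i x. i < k \<Longrightarrow> continuous_map Z euclideanreal (\<lambda>z. g z i x)"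
    and "\<And>z. z \<in> topspace Z \<Longrightarrow> mk_op k (t z) (g z) \<in> op_set k"
  shows "continuous_map Z (op_space k) (\<lambda>z. mk_op k (t z) (g z))"
proof -
  have "continuous_map Z euclideanreal (\<lambda>z. mk_op k (t z) (g z) n x)" for n x
    using assms by (cases n; cases "n - 1 < k") auto
  then show ?thesis
    using assms(3) unfolding op_space_def
    by (auto simp: continuous_map_in_subtopology continuous_map_componentwise_UNIV)
qed

text \<open>Since the coordinates are monotone, pointwise convergence suffices for joint continuity of
  evaluation.\<close>

lemma continuous_map_op_eval:
  assumes c: "continuous_map Z (op_space k) c" and x: "continuous_map Z euclideanreal x" and i: "i < k"
  shows "continuous_map Z euclideanreal (\<lambda>z. c z (Suc i) (x z))"
  unfolding continuous_map_upper_lower_semicontinuous_lt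
proof (intro allI conjI)
  fix \<alpha> :: real
  have up: "unit_path (c z (Suc i))" if "z \<in> topspace Z" for z
    using continuous_map_funspace[OF c] that op_setD(2) i by fastforce
  have cc: "continuous_map Z euclideanreal (\<lambda>z. c z (Suc i) y)" for y
    using continuous_map_compose[OF c continuous_map_op_coord] by (simp add: comp_def)
  show "openin Z {z \<in> topspace Z. \<alpha> < c z (Suc i) (x z)}"
  proof (subst openin_subopen, intro ballI)
    fix z assume "z \<in> {z \<in> topspace Z. \<alpha> < c z (Suc i) (x z)}"
    then have z: "z \<in> topspace Z" "\<alpha> < c z (Suc i) (x z)" by auto
    have "((c z (Suc i)) \<longlongrightarrow> c z (Suc i) (x z)) (at_left (x z))"
      using unit_pathD(2)[OF up[OF z(1)]] by (simp add: isCont_def filterlim_at_split)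
    from order_tendstoD(1)[OF this z(2)] obtain y where y: "y < x z" "\<alpha> < c z (Suc i) y"
      unfolding eventually_at_left_field by (meson dense)
    \<comment> \<open>The first condition evaluates at the fixed point \<open>y\<close> only, hence
      is open by pointwise convergence; monotonicity carries it over to \<open>x w\<close>, which
      lies beyond \<open>y\<close>.\<close>
    let ?U = "{w \<in> topspace Z. \<alpha> < c w (Suc i) y} \<inter> {w \<in> topspace Z. y < x w}"
    have "openin Z ?U"
      using cc[of y] x unfolding continuous_map_upper_lower_semicontinuous_lt by auto
    moreover have "?U \<subseteq> {z \<in> topspace Z. \<alpha> < c z (Suc i) (x z)}"
    proof
      fix w assume w: "w \<in> ?U"
      then show "w \<in> {z \<in> topspace Z. \<alpha> < c z (Suc i) (x z)}"
        using unit_pathD(1)[OF up, of w y "x w"] by auto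
    qed
    ultimately show "\<exists>T. openin Z T \<and> z \<in> T \<and> T \<subseteq> {z \<in> topspace Z. \<alpha> < c z (Suc i) (x z)}"
      using z y by (intro exI[of _ ?U]) auto
  qed
  show "openin Z {z \<in> topspace Z. c z (Suc i) (x z) < \<alpha>}"
  proof (subst openin_subopen, intro ballI)
    fix z assume "z \<in> {z \<in> topspace Z. c z (Suc i) (x z) < \<alpha>}"
    then have z: "z \<in> topspace Z" "c z (Suc i) (x z) < \<alpha>" by auto
    have "((c z (Suc i)) \<longlongrightarrow> c z (Suc i) (x z)) (at_right (x z))"
      using unit_pathD(2)[OF up[OF z(1)]] by (simp add: isCont_def filterlim_at_split)
    from order_tendstoD(2)[OF this z(2)] obtain y where y: "x z < y" "c z (Suc i) y < \<alpha>"
      unfolding eventually_at_right_field by (meson dense)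
    let ?U = "{w \<in> topspace Z. c w (Suc i) y < \<alpha>} \<inter> {w \<in> topspace Z. x w < y}"
    have "openin Z ?U"
      using cc[of y] x unfolding continuous_map_upper_lower_semicontinuous_lt by auto
    moreover have "?U \<subseteq> {z \<in> topspace Z. c z (Suc i) (x z) < \<alpha>}"
    proof
      fix w assume w: "w \<in> ?U"
      then show "w \<in> {z \<in> topspace Z. c z (Suc i) (x z) < \<alpha>}"
        using unit_pathD(1)[OF up, of w "x w" y] by auto
    qed
    ultimately show "\<exists>T. openin Z T \<and> z \<in> T \<and> T \<subseteq> {z \<in> topspace Z. c z (Suc i) (x z) < \<alpha>}"
      using z y by (intro exI[of _ ?U]) auto
  qed
qed

text \<open>The null homotopy runs \<open>c\<close> at double speed up to time \<open>u\<close> and then moves the remaining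
  coordinates one after the other to \<open>1\<close>, with \<open>u\<close> going from \<open>1\<close> to \<open>0\<close>.\<close>

definition cut_path :: "nat \<Rightarrow> real \<Rightarrow> (nat \<Rightarrow> real \<Rightarrow> real) \<Rightarrow> nat \<Rightarrow> real \<Rightarrow> real" where
  "cut_path k u c i x =
     c (Suc i) (min (2 * x) u) + (1 - c (Suc i) u) * clip (real k * (2 * x - 1) - real i)"

lemma clip_mono: "x \<le> y \<Longrightarrow> clip x \<le> clip y"
  by (auto simp: clip_def)

lemma clip_moves: "x < y \<Longrightarrow> clip (x - l) \<noteq> clip (y - l) \<Longrightarrow> x < l + 1 \<and> l < y"
  by (auto simp: clip_def max_def min_def split: if_splits)

text \<open>The coordinates of \<open>c\<close> are not assumed to reach 1, so that the zero path
  with \<open>u = 0\<close> is covered; this yields the standard path in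
  \<open>standard_path_in\<close>.\<close>

lemma unit_path_cut_path:
  assumes c: "mono (c (Suc i))" "continuous_on UNIV (c (Suc i))" "\<And>x. x \<le> 0 \<Longrightarrow> c (Suc i) x = 0"
    "\<And>x. c (Suc i) x \<le> 1" and i: "i < k" and u: "0 \<le> u" "u \<le> 1"
  shows "unit_path (cut_path k u c i)"
proof -
  have "cut_path k u c i x \<le> cut_path k u c i y" if "x \<le> y" for x y
    unfolding cut_path_def using that i c(4)[of u]
    by (intro add_mono mult_left_mono clip_mono monoD[OF c(1)]) (auto intro!: mult_left_mono)
  moreover have "continuous_on UNIV (cut_path k u c i)"
  proof -
    have "continuous_on UNIV (\<lambda>x. c (Suc i) (min (2 * x) u))"
      by (rule continuous_on_compose2[OF c(2)]) (auto intro!: continuous_intros)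
    then show ?thesis
      unfolding cut_path_def[abs_def] clip_def by (intro continuous_intros)
  qed
  moreover have "cut_path k u c i x = 0" if "x \<le> 0" for x
  proof -
    have "real k * (2 * x - 1) \<le> 0"
      using that by (intro mult_nonneg_nonpos) auto
    then show ?thesis
      using that u c(3)[of "min (2 * x) u"] by (simp add: cut_path_def)
  qed
  moreover have "cut_path k u c i x = 1" if "1 \<le> x" for x
  proof -
    have "real k \<le> real k * (2 * x - 1)"
      using that mult_left_mono[of 1 "2 * x - 1" "real k"] by auto
    then have "1 \<le> real k * (2 * x - 1) - real i"
      using i by linarith
    moreover have "min (2 * x) u = u" using that u by auto
    ultimately show ?thesis
      by (simp add: cut_path_def)
  qed
  ultimately show ?thesis
    by (auto simp: unit_path_def mono_def)
qed

text \<open>During the first half the breaks are those of \<open>c\<close> at double speed. During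
  the second half coordinate \<open>i\<close> moves only between \<open>(k + i) / (2 * k)\<close>
  and \<open>(k + i + 1) / (2 * k)\<close>, so the left ends suffice; the one for
  \<open>i = 0\<close> is 1/2 and separates the halves.\<close>

lemma breaks_cut_path:
  assumes F: "breaks k (\<lambda>i. c (Suc i)) F" and u: "0 \<le> u" "u \<le> 1"
  shows "breaks k (cut_path k u c) ((\<lambda>b. b / 2) ` F \<union> (\<lambda>i. (real k + real i) / (2 * real k)) ` {..<k})"
    (is "breaks _ _ (?F1 \<union> ?F2)")
  unfolding breaks_def
proof (intro conjI allI impI)
  show "finite (?F1 \<union> ?F2)"
    using F by (auto simp: breaks_def)
  fix x y i j assume xy: "x < y" "{x<..<y} \<inter> (?F1 \<union> ?F2) = {}" and ij: "i < k" "j < k"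
    and mi: "cut_path k u c i x \<noteq> cut_path k u c i y" and mj: "cut_path k u c j x \<noteq> cut_path k u c j y"
  have k: "real k > 0" using ij by auto
  have "1 / 2 \<in> ?F2"
    using ij k by (auto simp: image_iff intro!: bexI[of _ 0])
  then consider "y \<le> 1 / 2" | "1 / 2 \<le> x"
    using xy by force
  then show "i = j"
  proof cases
    case 1
    have z: "clip (real k * (2 * x' - 1) - real i') = 0" if "x' \<le> 1 / 2" for x' i'
    proof -
      have "real k * (2 * x' - 1) \<le> 0"
        using that by (intro mult_nonneg_nonpos) auto
      then show ?thesis by simp
    qed
    let ?x = "min (2 * x) u" and ?y = "min (2 * y) u"
    have m: "c (Suc i) ?x \<noteq> c (Suc i) ?y" "c (Suc j) ?x \<noteq> c (Suc j) ?y"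
      using mi mj 1 xy(1) z unfolding cut_path_def by auto
    have lt: "?x < ?y"
    proof (rule ccontr)
      assume "\<not> ?x < ?y"
      then have "?x = ?y" using xy(1) by linarith
      with m show False by simp
    qed
    moreover have "{?x<..<?y} \<inter> F = {}"
    proof (rule ccontr)
      assume "{?x<..<?y} \<inter> F \<noteq> {}"
      then obtain b where "b \<in> F" "b \<in> {?x<..<?y}" by blast
      then have "b / 2 \<in> {x<..<y} \<inter> ?F1"
        by (auto simp: min_less_iff_disj)
      with xy(2) show False by blast
    qed
    ultimately show ?thesis
      using F ij m unfolding breaks_def by blast
  next
    case 2
    let ?X = "real k * (2 * x - 1)" and ?Y = "real k * (2 * y - 1)"
    have "min (2 * x) u = u" "min (2 * y) u = u"
      using 2 u xy(1) by auto
    then have m: "clip (?X - real i) \<noteq> clip (?Y - real i)" "clip (?X - real j) \<noteq> clip (?Y - real j)"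
      using mi mj unfolding cut_path_def by auto
    have XY: "?X < ?Y" using xy(1) k by simp
    have b: "?X < real l + 1" "real l < ?Y" if "clip (?X - real l) \<noteq> clip (?Y - real l)" for l
      using clip_moves[OF XY that] by auto
    have no: "\<not> (?X < real l \<and> real l < ?Y)" if "l < k" for l
    proof
      assume a: "?X < real l \<and> real l < ?Y"
      have "x < (real k + real l) / (2 * real k)" "(real k + real l) / (2 * real k) < y"
        using a k by (auto simp: field_simps)
      moreover have "(real k + real l) / (2 * real k) \<in> ?F2"
        using that by auto
      ultimately have "(real k + real l) / (2 * real k) \<in> {x<..<y} \<inter> (?F1 \<union> ?F2)"
        by simp
      then show False using xy(2) by blast
    qed
    \<comment> \<open>If coordinates \<open>i < j\<close> both moved, then
      \<open>?X < i + 1 \<le> j < ?Y\<close> would put the starting point of \<open>j\<close>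
      strictly inside the interval.\<close>
    show ?thesis
    proof (rule ccontr)
      assume "i \<noteq> j"
      then consider "real i + 1 \<le> real j" | "real j + 1 \<le> real i" by linarith
      then show False
        using b[OF m(1)] b[OF m(2)] no[OF ij(1)] no[OF ij(2)] by cases linarith+
    qed
  qed
qed

lemma cut_path_in:
  assumes c: "c \<in> op_set k" and u: "0 \<le> u" "u \<le> 1"
  shows "mk_op k (c 0 0 + real k) (cut_path k u c) \<in> op_set k"
proof -
  obtain F where F: "breaks k (\<lambda>i. c (Suc i)) F" "real (card F) \<le> c 0 0"
    using op_setD(4)[OF c] by auto
  let ?F1 = "(\<lambda>b. b / 2) ` F" and ?F2 = "(\<lambda>i. (real k + real i) / (2 * real k)) ` {..<k}"
  have "card (?F1 \<union> ?F2) \<le> card F + k"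
    using F(1) card_Un_le[of ?F1 ?F2] card_image_le[of F "\<lambda>b. b / 2"]
      card_image_le[of "{..<k}" "\<lambda>i. (real k + real i) / (2 * real k)"]
    by (auto simp: breaks_def)
  then have "real (card (?F1 \<union> ?F2)) \<le> c 0 0 + real k"
    using F(2) by linarith
  then show ?thesis
    using op_setD(2)[OF c] unit_pathD(6)[OF op_setD(2)[OF c]] u
    by (intro mk_op_in[OF _ breaks_cut_path[OF F(1) u]] unit_path_cut_path) (auto simp: unit_path_def)
qed

text \<open>Speeding up only rescales the breaks. The bound is raised by \<open>s * real k\<close>
  all the same, so that at \<open>s = 1\<close> it equals the one in \<open>cut_path_in\<close> and
  the two homotopies fit together.\<close>

lemma speed_up_in:
  assumes c: "c \<in> op_set k" and s: "0 \<le> s"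
  shows "mk_op k (c 0 0 + s * real k) (\<lambda>i x. c (Suc i) ((1 + s) * x)) \<in> op_set k"
proof -
  obtain F where F: "breaks k (\<lambda>i. c (Suc i)) F" "real (card F) \<le> c 0 0"
    using op_setD(4)[OF c] by auto
  have "breaks k (\<lambda>i x. c (Suc i) ((1 + s) * x)) ((\<lambda>b. b / (1 + s)) ` F)"
    unfolding breaks_def
  proof (intro conjI allI impI)
    show "finite ((\<lambda>b. b / (1 + s)) ` F)" using F by (simp add: breaks_def)
    fix x y i j
    assume xy: "x < y" "{x<..<y} \<inter> (\<lambda>b. b / (1 + s)) ` F = {}" and ij: "i < k" "j < k"
      "c (Suc i) ((1 + s) * x) \<noteq> c (Suc i) ((1 + s) * y)"
      "c (Suc j) ((1 + s) * x) \<noteq> c (Suc j) ((1 + s) * y)"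
    have "{(1 + s) * x<..<(1 + s) * y} \<inter> F = {}"
    proof (rule ccontr)
      assume "{(1 + s) * x<..<(1 + s) * y} \<inter> F \<noteq> {}"
      then obtain b where b: "b \<in> F" "(1 + s) * x < b" "b < (1 + s) * y" by auto
      then have "x < b / (1 + s)" "b / (1 + s) < y"
        using s by (auto simp: field_simps)
      then have "b / (1 + s) \<in> {x<..<y} \<inter> (\<lambda>b. b / (1 + s)) ` F" using b(1) by auto
      with xy(2) show False by blast
    qed
    moreover have "(1 + s) * x < (1 + s) * y" using xy(1) s by simp
    ultimately show "i = j" using F(1) ij unfolding breaks_def by blast
  qed
  moreover have "unit_path (\<lambda>x. c (Suc i) ((1 + s) * x))" if i: "i < k" for i
  proof -
    note U = unit_pathD[OF op_setD(2)[OF c i]]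
    have "continuous_on UNIV (c (Suc i))"
      using op_setD(2)[OF c i] by (simp add: unit_path_def)
    then have "continuous_on UNIV (\<lambda>x. c (Suc i) ((1 + s) * x))"
      by (rule continuous_on_compose2) (auto intro!: continuous_intros)
    moreover have "1 \<le> (1 + s) * x" if "1 \<le> x" for x
      using that s mult_mono[of 1 "1 + s" 1 x] by auto
    moreover have "(1 + s) * x \<le> 0" if "x \<le> 0" for x
      using that s by (simp add: mult_nonneg_nonpos)
    ultimately show ?thesis
      using s U(3,4) by (auto simp: unit_path_def mono_def intro!: U(1) mult_left_mono)
  qed
  moreover have "real (card ((\<lambda>b. b / (1 + s)) ` F)) \<le> c 0 0 + s * real k"
    using card_image_le[of F "\<lambda>b. b / (1 + s)"] F s mult_nonneg_nonneg[of s "real k"]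
    unfolding breaks_def by (smt (verit) of_nat_0_le_iff of_nat_mono)
  ultimately show ?thesis by (intro mk_op_in)
qed

lemma cut_path_0: "c \<in> op_set k \<Longrightarrow> i < k \<Longrightarrow>
    cut_path k 0 c i = (\<lambda>x. clip (real k * (2 * x - 1) - real i))"
  using unit_pathD(3)[OF op_setD(2), of c k i] by (auto simp: cut_path_def fun_eq_iff)

lemma standard_path_in:
  assumes "real k \<le> t"
  shows "mk_op k t (\<lambda>i x. clip (real k * (2 * x - 1) - real i)) \<in> op_set k"
proof -
  let ?F2 = "(\<lambda>i. (real k + real i) / (2 * real k)) ` {..<k}"
  have eq: "cut_path k 0 (\<lambda>_ _. 0) = (\<lambda>i x. clip (real k * (2 * x - 1) - real i))"
    by (simp add: cut_path_def fun_eq_iff)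
  have "breaks k (\<lambda>i _. 0) {}"
    by (simp add: breaks_def)
  then have "breaks k (cut_path k 0 (\<lambda>_ _. 0)) ?F2"
    using breaks_cut_path[of k "\<lambda>_ _. 0" "{}" 0] by simp
  moreover have "unit_path (cut_path k 0 (\<lambda>_ _. 0) i)" if "i < k" for i
    using that by (intro unit_path_cut_path) (auto simp: mono_def)
  moreover have "real (card ?F2) \<le> t"
    using card_image_le[of "{..<k}" "\<lambda>i. (real k + real i) / (2 * real k)"] assms by simp
  ultimately show ?thesis
    unfolding eq by (intro mk_op_in)
qed

text \<open>The three homotopies double the speed, cut the path back to the standard one, and shrink
  the bound to \<open>k\<close>. At \<open>u = 1\<close> cutting changes nothing but the speed,
  because \<open>c\<close> is constantly 1 after time 1.\<close>

lemma contractible_op_space: "contractible_space (op_space k)"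
proof -
  let ?I = "top_of_set {0..1::real}"
  let ?Z = "prod_topology ?I (op_space k)"
  let ?std = "\<lambda>i x. clip (real k * (2 * x - 1) - real i)"
  have s: "continuous_map ?Z euclideanreal fst"
    using continuous_map_fst[of ?I "op_space k"] by (simp add: continuous_map_in_subtopology)
  have c: "continuous_map ?Z (op_space k) snd"
    by (rule continuous_map_snd)
  have co: "continuous_map ?Z euclideanreal (\<lambda>z. snd z n x)" for n x
    using continuous_map_compose[OF c continuous_map_op_coord] by (simp add: comp_def)
  note ev = continuous_map_op_eval[OF c]
  have id: "mk_op k (c 0 0) (\<lambda>i. c (Suc i)) = c" if "c \<in> op_set k" for c
    by (rule op_eqI[OF that]) auto
  have "homotopic_with (\<lambda>_. True) (op_space k) (op_space k) id
      (\<lambda>c. mk_op k (c 0 0 + real k) (\<lambda>i x. c (Suc i) (2 * x)))"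
  proof (subst homotopic_with, goal_cases)
    case 2
    have "continuous_map ?Z (op_space k) (\<lambda>z. mk_op k (snd z 0 0 + fst z * real k)
        (\<lambda>i x. snd z (Suc i) ((1 + fst z) * x)))"
      by (intro continuous_map_mk_op continuous_intros ev co s) (auto intro!: speed_up_in)
    then show ?case
      by (intro exI[of _ "\<lambda>z. mk_op k (snd z 0 0 + fst z * real k) (\<lambda>i x. snd z (Suc i) ((1 + fst z) * x))"])
         (auto simp: id)
  qed auto
  moreover have "homotopic_with (\<lambda>_. True) (op_space k) (op_space k)
      (\<lambda>c. mk_op k (c 0 0 + real k) (\<lambda>i x. c (Suc i) (2 * x))) (\<lambda>c. mk_op k (c 0 0 + real k) ?std)"
  proof (subst homotopic_with, goal_cases)
    case 2
    have "continuous_map ?Z (op_space k) (\<lambda>z. mk_op k (snd z 0 0 + real k) (cut_path k (1 - fst z) (snd z)))"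
      unfolding cut_path_def
      by (intro continuous_map_mk_op continuous_intros ev co s)
         (auto intro!: cut_path_in simp: cut_path_def[symmetric])
    moreover have "mk_op k (c 0 0 + real k) (cut_path k 1 c) = mk_op k (c 0 0 + real k) (\<lambda>i x. c (Suc i) (2 * x))"
      if c: "c \<in> op_set k" for c
    proof (rule op_eqI)
      show "mk_op k (c 0 0 + real k) (\<lambda>i x. c (Suc i) (2 * x)) \<in> op_set k"
        using speed_up_in[OF c, of 1] by simp
      fix i assume i: "i < k"
      show "cut_path k 1 c i = mk_op k (c 0 0 + real k) (\<lambda>i x. c (Suc i) (2 * x)) (Suc i)"
      proof
        fix x
        show "cut_path k 1 c i x = mk_op k (c 0 0 + real k) (\<lambda>i x. c (Suc i) (2 * x)) (Suc i) x"
          using i unit_pathD(4)[OF op_setD(2)[OF c i]] by (cases "2 * x \<le> 1") (auto simp: cut_path_def)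
      qed
    qed auto
    moreover have "mk_op k (c 0 0 + real k) (cut_path k 0 c) = mk_op k (c 0 0 + real k) ?std"
      if c: "c \<in> op_set k" for c
      by (auto simp: mk_op_def fun_eq_iff cut_path_0[OF c] split: nat.split)
    ultimately show ?case
      by (intro exI[of _ "\<lambda>z. mk_op k (snd z 0 0 + real k) (cut_path k (1 - fst z) (snd z))"]) auto
  qed auto
  moreover have "homotopic_with (\<lambda>_. True) (op_space k) (op_space k)
      (\<lambda>c. mk_op k (c 0 0 + real k) ?std) (\<lambda>_. mk_op k (real k) ?std)"
  proof (subst homotopic_with, goal_cases)
    case 2
    have "mk_op k ((1 - s) * c 0 0 + real k) ?std \<in> op_set k"
      if "c \<in> op_set k" "0 \<le> s" "s \<le> 1" for s c
      using that op_setD(5)[OF that(1)] by (intro standard_path_in) auto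
    then have "continuous_map ?Z (op_space k) (\<lambda>z. mk_op k ((1 - fst z) * snd z 0 0 + real k) ?std)"
      by (intro continuous_map_mk_op continuous_intros co s) auto
    then show ?case
      by (intro exI[of _ "\<lambda>z. mk_op k ((1 - fst z) * snd z 0 0 + real k) ?std"]) auto
  qed auto
  ultimately have "homotopic_with (\<lambda>_. True) (op_space k) (op_space k) id (\<lambda>_. mk_op k (real k) ?std)"
    by (blast intro: homotopic_with_trans)
  then show ?thesis
    by (auto simp: contractible_space_def)
qed

subsection \<open>Consecutive blocks\<close>

text \<open>Recovers block and position from \<open>offset js s + i\<close>; see
  \<open>unindex_offset\<close>.\<close>

fun unindex :: "nat list \<Rightarrow> nat \<Rightarrow> nat \<times> nat" where
  "unindex [] m = (0, m)"
| "unindex (j # js) m =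
     (if m < j then (0, m) else (case unindex js (m - j) of (s, i) \<Rightarrow> (Suc s, i)))"

lemma offset_simps [simp]: "offset js 0 = 0" "offset (j # js) (Suc s) = j + offset js s"
  by (auto simp: offset_def)

lemma unindex_offset [simp]:
  "s < length js \<Longrightarrow> i < js ! s \<Longrightarrow> unindex js (offset js s + i) = (s, i)"
proof (induction js arbitrary: s)
  case (Cons j js)
  then show ?case by (cases s) auto
qed simp

lemma offset_less [simp]: "s < length js \<Longrightarrow> i < js ! s \<Longrightarrow> offset js s + i < sum_list js"
proof (induction js arbitrary: s)
  case (Cons j js)
  then show ?case by (cases s) auto
qed simp

lemma block_cases:
  assumes "m < sum_list js"
  obtains s i where "s < length js" "i < js ! s" "m = offset js s + i"
  using assms
proof (induction js arbitrary: m thesis)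
  case (Cons j js)
  show ?case
  proof (cases "m < j")
    case True
    then show ?thesis using Cons.prems(1)[of 0 m] by simp
  next
    case False
    then have "m - j < sum_list js" using Cons.prems(2) by simp
    then obtain s i where "s < length js" "i < js ! s" "m - j = offset js s + i"
      using Cons.IH by blast
    then show ?thesis using Cons.prems(1)[of "Suc s" i] False by simp
  qed
qed simp

lemma sum_blocks:
  fixes h :: "nat \<Rightarrow> 'a::comm_monoid_add"
  shows "(\<Sum>m<sum_list js. h m) = (\<Sum>s<length js. \<Sum>i<js ! s. h (offset js s + i))"
proof (induction js arbitrary: h)
  case (Cons j js)
  have "(\<Sum>m<j + n. h m) = (\<Sum>m<j. h m) + (\<Sum>m<n. h (j + m))" for n
    by (induction n) (auto simp: add.assoc)
  then show ?case
    by (simp add: Cons.IH sum.lessThan_Suc_shift add.assoc del: sum.lessThan_Suc)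
qed simp

lemma concat_nth_offset:
  "s < length xss \<Longrightarrow> i < length (xss ! s) \<Longrightarrow> concat xss ! (offset (map length xss) s + i) = xss ! s ! i"
proof (induction xss arbitrary: s)
  case (Cons xs xss)
  then show ?case by (cases s) (auto simp: nth_append)
qed simp

lemma offset_concat:
  "s < length mss \<Longrightarrow> i \<le> length (mss ! s) \<Longrightarrow>
    offset (concat mss) (offset (map length mss) s + i) = offset (map sum_list mss) s + offset (mss ! s) i"
proof (induction mss arbitrary: s)
  case (Cons ms mss)
  then show ?case by (cases s) (auto simp: offset_def)
qed simp

lemma sum_list_concat: "sum_list (concat mss) = sum_list (map sum_list mss)"
  for mss :: "nat list list"
  by (induction mss) auto

lemma concat_map_offset:
  assumes "s < length js" "i < js ! s"
  shows "concat (map (\<lambda>s. map (g s) [0..<js ! s]) [0..<length js]) ! (offset js s + i) = g s i"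
proof -
  let ?xss = "map (\<lambda>s. map (g s) [0..<js ! s]) [0..<length js]"
  have "map length ?xss = js"
    by (rule nth_equalityI) auto
  then show ?thesis
    using concat_nth_offset[of s ?xss i] assms by simp
qed

lemma block_perm_offset:
  "s < length js \<Longrightarrow> i < js ! s \<Longrightarrow>
    block_perm \<sigma> js (offset js s + i) = offset (permute_blocks \<sigma> js) (\<sigma> s) + i"
  unfolding block_perm_def by (simp add: concat_map_offset)

lemma sum_perm_offset:
  "s < length js \<Longrightarrow> i < js ! s \<Longrightarrow> sum_perm \<tau> js (offset js s + i) = offset js s + \<tau> s i"
  unfolding sum_perm_def by (simp add: concat_map_offset)

subsection \<open>Operad structure\<close>

text \<open>Precomposing the indexing with \<open>\<sigma>\<close> itself, and not with its inverse,
  is what gives a right action.\<close>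

definition op_act :: "nat \<Rightarrow> (nat \<Rightarrow> real \<Rightarrow> real) \<Rightarrow> (nat \<Rightarrow> nat) \<Rightarrow> nat \<Rightarrow> real \<Rightarrow> real" where
  "op_act k c \<sigma> = mk_op k (c 0 0) (\<lambda>i. c (Suc (\<sigma> i)))"

definition op_one :: "nat \<Rightarrow> real \<Rightarrow> real" where
  "op_one = mk_op 1 0 (\<lambda>_. clip)"

text \<open>The coordinate \<open>c s\<close> serves as the clock of the path
  \<open>d s\<close>.\<close>

definition op_comp :: "nat list \<Rightarrow> (nat \<Rightarrow> real \<Rightarrow> real) \<times> (nat \<Rightarrow> nat \<Rightarrow> real \<Rightarrow> real)
    \<Rightarrow> nat \<Rightarrow> real \<Rightarrow> real" where
  "op_comp js = (\<lambda>(c, d). mk_op (sum_list js) (c 0 0 + (\<Sum>s<length js. d s 0 0))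
     (\<lambda>m x. d (fst (unindex js m)) (Suc (snd (unindex js m))) (c (Suc (fst (unindex js m))) x)))"

lemma op_comp_0 [simp]: "op_comp js (c, d) 0 x = c 0 0 + (\<Sum>s<length js. d s 0 0)"
  by (simp add: op_comp_def)

lemma op_comp_Suc [simp]:
  "s < length js \<Longrightarrow> i < js ! s \<Longrightarrow>
    op_comp js (c, d) (Suc (offset js s + i)) = (\<lambda>x. d s (Suc i) (c (Suc s) x))"
  by (simp add: op_comp_def)

lemma op_act_in:
  assumes c: "c \<in> op_set k" and \<sigma>: "\<sigma> permutes {..<k}"
  shows "op_act k c \<sigma> \<in> op_set k"
proof -
  obtain F where F: "breaks k (\<lambda>i. c (Suc i)) F" "real (card F) \<le> c 0 0"
    using op_setD(4)[OF c] by auto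
  have \<sigma>k: "\<sigma> i < k" if "i < k" for i
    using permutes_in_image[OF \<sigma>, of i] that by simp
  have "breaks k (\<lambda>i. c (Suc (\<sigma> i))) F"
    using F(1) \<sigma>k permutes_inj[OF \<sigma>] unfolding breaks_def inj_def by blast
  then show ?thesis
    unfolding op_act_def using F(2) op_setD(2)[OF c] \<sigma>k by (intro mk_op_in) auto
qed

lemma op_one_in: "op_one \<in> op_set 1"
  unfolding op_one_def
  by (rule mk_op_in[of _ _ "{}"]) (auto simp: unit_path_clip breaks_def)

lemma unit_path_surj:
  assumes "unit_path g" "g x < b" "b < g y"
  shows "\<exists>z. g z = b \<and> x < z \<and> z < y"
proof -
  have "x \<le> y"
    using unit_pathD(1)[OF assms(1), of y x] assms by (meson linear not_less order.trans order.strict_trans)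
  then obtain z where z: "x \<le> z" "z \<le> y" "g z = b"
    using IVT'[of g x b y] assms unfolding unit_path_def
    by (meson continuous_on_subset less_imp_le top_greatest)
  then show ?thesis
    using assms by (metis less_irrefl order_le_less)
qed

text \<open>Between two breaks of \<open>c\<close> only one clock runs, so only coordinates of one
  block can move, and within that block the breaks of \<open>d s\<close> separate them.\<close>

lemma op_comp_in:
  assumes c: "c \<in> op_set (length js)" and d: "\<And>s. s < length js \<Longrightarrow> d s \<in> op_set (js ! s)"
  shows "op_comp js (c, d) \<in> op_set (sum_list js)"
proof -
  obtain F where F: "breaks (length js) (\<lambda>i. c (Suc i)) F" "real (card F) \<le> c 0 0"
    using op_setD(4)[OF c] by auto
  have "\<forall>s. \<exists>G. s < length js \<longrightarrow> breaks (js ! s) (\<lambda>i. d s (Suc i)) G \<and> real (card G) \<le> d s 0 0"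
    using op_setD(4)[OF d] by blast
  then obtain G where G: "\<And>s. s < length js \<Longrightarrow> breaks (js ! s) (\<lambda>i. d s (Suc i)) (G s)"
    "\<And>s. s < length js \<Longrightarrow> real (card (G s)) \<le> d s 0 0"
    by metis
  \<comment> \<open>One preimage of each break \<open>b\<close> of \<open>d s\<close> is enough,
    even where \<open>c s\<close> rests at \<open>b\<close>: an interval on which \<open>c s\<close>
    passes strictly from below \<open>b\<close> to above \<open>b\<close> contains every preimage of
    \<open>b\<close>. Hence the bounds add.\<close>
  define pre where "pre s b = (SOME z. c (Suc s) z = b)" for s b
  define H where "H = F \<union> (\<Union>s<length js. pre s ` G s)"
  have "finite H"
    using F(1) G(1) by (auto simp: H_def breaks_def)
  have "card H \<le> card F + (\<Sum>s<length js. card (G s))"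
  proof -
    have "card H \<le> card F + card (\<Union>s<length js. pre s ` G s)"
      unfolding H_def by (rule card_Un_le)
    also have "card (\<Union>s<length js. pre s ` G s) \<le> (\<Sum>s<length js. card (pre s ` G s))"
      by (rule card_UN_le) simp
    also have "\<dots> \<le> (\<Sum>s<length js. card (G s))"
      using G(1) by (intro sum_mono card_image_le) (auto simp: breaks_def)
    finally show ?thesis by simp
  qed
  then have "real (card H) \<le> real (card F) + (\<Sum>s<length js. real (card (G s)))"
    by (metis of_nat_add of_nat_le_iff of_nat_sum)
  also have "\<dots> \<le> c 0 0 + (\<Sum>s<length js. d s 0 0)"
    using F(2) G(2) by (intro add_mono sum_mono) auto
  finally have cardH: "real (card H) \<le> c 0 0 + (\<Sum>s<length js. d s 0 0)" .
  let ?g = "\<lambda>m x. d (fst (unindex js m)) (Suc (snd (unindex js m))) (c (Suc (fst (unindex js m))) x)"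
  have "breaks (sum_list js) ?g H"
    unfolding breaks_def
  proof (intro conjI allI impI)
    show "finite H" by fact
    fix x y m n assume xy: "x < y" "{x<..<y} \<inter> H = {}" and mn: "m < sum_list js" "n < sum_list js"
      and mv: "?g m x \<noteq> ?g m y" "?g n x \<noteq> ?g n y"
    obtain s i where s: "s < length js" "i < js ! s" "m = offset js s + i"
      using block_cases[OF mn(1)] by blast
    obtain s' i' where s': "s' < length js" "i' < js ! s'" "n = offset js s' + i'"
      using block_cases[OF mn(2)] by blast
    have di: "d s (Suc i) (c (Suc s) x) \<noteq> d s (Suc i) (c (Suc s) y)"
      "d s' (Suc i') (c (Suc s') x) \<noteq> d s' (Suc i') (c (Suc s') y)"
      using mv s s' by auto
    then have cm: "c (Suc s) x \<noteq> c (Suc s) y" "c (Suc s') x \<noteq> c (Suc s') y"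
      by auto
    have "{x<..<y} \<inter> F = {}"
      using xy(2) by (auto simp: H_def)
    with F(1) xy(1) cm s s' have ss: "s = s'"
      unfolding breaks_def by blast
    note U = op_setD(2)[OF c s(1)]
    have lt: "c (Suc s) x < c (Suc s) y"
      using unit_pathD(1)[OF U, of x y] xy(1) cm(1) by auto
    have "{c (Suc s) x<..<c (Suc s) y} \<inter> G s = {}"
    proof (rule ccontr)
      assume "{c (Suc s) x<..<c (Suc s) y} \<inter> G s \<noteq> {}"
      then obtain b where b: "b \<in> G s" "c (Suc s) x < b" "b < c (Suc s) y" by auto
      from unit_path_surj[OF U b(2,3)] have "c (Suc s) (pre s b) = b"
        unfolding pre_def by (metis (mono_tags, lifting) someI_ex)
      then have "x < pre s b" "pre s b < y"
        using b unit_pathD(1)[OF U, of "pre s b" x] unit_pathD(1)[OF U, of y "pre s b"]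
        by (auto simp: not_le[symmetric])
      moreover have "pre s b \<in> H"
        using b(1) s(1) by (auto simp: H_def)
      ultimately show False using xy(2) by auto
    qed
    then have "i = i'"
      using G(1)[OF s(1)] lt di s s' ss unfolding breaks_def by blast
    then show "m = n" using s s' ss by simp
  qed
  moreover have "unit_path (?g m)" if m: "m < sum_list js" for m
  proof -
    obtain s i where s: "s < length js" "i < js ! s" "m = offset js s + i"
      using block_cases[OF m] by blast
    have "unit_path (\<lambda>x. d s (Suc i) (c (Suc s) x))"
      by (rule unit_path_compose[OF op_setD(2)[OF d[OF s(1)] s(2)] op_setD(2)[OF c s(1)]])
    then show ?thesis using s by simp
  qed
  ultimately show ?thesis
    unfolding op_comp_def using cardH by (simp add: mk_op_in)
qed

lemma op_ext:
  assumes "c \<in> op_set k" "c' \<in> op_set k" "c 0 0 = c' 0 0" "\<And>i. i < k \<Longrightarrow> c (Suc i) = c' (Suc i)"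
  shows "c = c'"
  using op_eqI[OF assms(1), of "c 0 0" "\<lambda>i. c (Suc i)"]
    op_eqI[OF assms(2), of "c 0 0" "\<lambda>i. c (Suc i)"] assms(3,4) by simp

lemma unit_path_clip_arg: "unit_path g \<Longrightarrow> g (clip x) = g x"
  using unit_pathD(3,4)[of g x] by (cases "x \<le> 0"; cases "1 \<le> x") (auto simp: unit_pathD(3,4))

lemma unit_path_clip_val: "unit_path g \<Longrightarrow> clip (g x) = g x"
  using unit_pathD(5,6)[of g x] by simp

lemma lattice_path_operad: "operad op_space op_act op_one op_comp"
proof
  fix \<sigma> :: "nat \<Rightarrow> nat" and k assume \<sigma>: "\<sigma> permutes {..<k}"
  show "continuous_map (op_space k) (op_space k) (\<lambda>c. op_act k c \<sigma>)"
    unfolding op_act_def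
    by (intro continuous_map_mk_op continuous_map_op_coord)
       (use op_act_in[OF _ \<sigma>] in \<open>simp add: op_act_def\<close>)
next
  fix c k assume "c \<in> topspace (op_space k)"
  then show "op_act k c id = c"
    unfolding op_act_def by (intro op_eqI) auto
next
  fix c k \<sigma> \<sigma>' assume c: "c \<in> topspace (op_space k)" and \<sigma>: "\<sigma> permutes {..<k}" "\<sigma>' permutes {..<k}"
  have "\<sigma>' i < k" if "i < k" for i
    using permutes_in_image[OF \<sigma>(2), of i] that by simp
  then show "op_act k (op_act k c \<sigma>) \<sigma>' = op_act k c (\<sigma> \<circ> \<sigma>')"
    unfolding op_act_def by (auto simp: mk_op_def fun_eq_iff split: nat.split)
next
  show "op_one \<in> topspace (op_space 1)"
    using op_one_in by simp
next
  fix js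
  let ?Z = "prod_topology (op_space (length js)) (product_topology (\<lambda>i. op_space (js ! i)) {..<length js})"
  have c: "continuous_map ?Z (op_space (length js)) fst"
    by (rule continuous_map_fst)
  have d: "continuous_map ?Z (op_space (js ! s)) (\<lambda>z. snd z s)" if "s < length js" for s
    using continuous_map_compose[OF continuous_map_snd continuous_map_product_projection,
        of s "{..<length js}" "op_space (length js)" "\<lambda>i. op_space (js ! i)"] that by (simp add: comp_def)
  have co: "continuous_map ?Z euclideanreal (\<lambda>z. fst z n x)" for n x
    using continuous_map_compose[OF c continuous_map_op_coord] by (simp add: comp_def)
  have do: "continuous_map ?Z euclideanreal (\<lambda>z. snd z s n x)" if "s < length js" for s n x
    using continuous_map_compose[OF d[OF that] continuous_map_op_coord] by (simp add: comp_def)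
  have "continuous_map ?Z (op_space (sum_list js)) (\<lambda>z. mk_op (sum_list js)
      (fst z 0 0 + (\<Sum>s<length js. snd z s 0 0))
      (\<lambda>m x. snd z (fst (unindex js m)) (Suc (snd (unindex js m))) (fst z (Suc (fst (unindex js m))) x)))"
  proof (rule continuous_map_mk_op)
    show "continuous_map ?Z euclideanreal (\<lambda>z. fst z 0 0 + (\<Sum>s<length js. snd z s 0 0))"
      by (intro continuous_intros co do) auto
  next
    fix m x assume "m < sum_list js"
    then obtain s i where "s < length js" "i < js ! s" "m = offset js s + i"
      using block_cases by blast
    then show "continuous_map ?Z euclideanreal (\<lambda>z. snd z (fst (unindex js m)) (Suc (snd (unindex js m)))
        (fst z (Suc (fst (unindex js m))) x))"
      using continuous_map_op_eval[OF d co] by simp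
  next
    fix z assume "z \<in> topspace ?Z"
    then have "fst z \<in> op_set (length js)" "\<And>s. s < length js \<Longrightarrow> snd z s \<in> op_set (js ! s)"
      by (simp_all add: mem_Times_iff PiE_iff)
    from op_comp_in[OF this] show "mk_op (sum_list js)
      (fst z 0 0 + (\<Sum>s<length js. snd z s 0 0))
      (\<lambda>m x. snd z (fst (unindex js m)) (Suc (snd (unindex js m))) (fst z (Suc (fst (unindex js m))) x))
      \<in> op_set (sum_list js)"
      by (simp add: op_comp_def case_prod_unfold)
  qed
  then show "continuous_map ?Z (op_space (sum_list js)) (op_comp js)"
    by (simp add: op_comp_def case_prod_unfold)
next
  fix c k assume c: "c \<in> topspace (op_space k)"
  show "op_comp [k] (op_one, \<lambda>i\<in>{..<1}. c) = c"
  proof (rule op_ext[of _ k])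
    show "op_comp [k] (op_one, \<lambda>i\<in>{..<1}. c) \<in> op_set k"
      using op_comp_in[of op_one "[k]" "\<lambda>i\<in>{..<1}. c"] c op_one_in by simp
    fix i assume i: "i < k"
    \<comment> \<open>The unit inserts \<open>clip\<close> into the argument, which paths constant
      outside [0, 1] do not notice.\<close>
    have "op_comp [k] (op_one, \<lambda>i\<in>{..<1}. c) (Suc i) = (\<lambda>x. c (Suc i) (clip x))"
      using op_comp_Suc[of 0 "[k]" i op_one "\<lambda>i\<in>{..<1}. c"] i by (simp add: op_one_def)
    then show "op_comp [k] (op_one, \<lambda>i\<in>{..<1}. c) (Suc i) = c (Suc i)"
      using unit_path_clip_arg[OF op_setD(2)[of c k i]] c i by simp
  qed (use c in \<open>auto simp: op_one_def\<close>)
next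
  fix c k assume c: "c \<in> topspace (op_space k)"
  have off: "offset (replicate k 1) i = i" if "i \<le> k" for i
    using that by (simp add: offset_def sum_list_replicate)
  show "op_comp (replicate k 1) (c, \<lambda>i\<in>{..<k}. op_one) = c"
  proof (rule op_ext[of _ k])
    show "op_comp (replicate k 1) (c, \<lambda>i\<in>{..<k}. op_one) \<in> op_set k"
      using op_comp_in[of c "replicate k 1" "\<lambda>i\<in>{..<k}. op_one"] c op_one_in
      by (simp add: sum_list_replicate)
    fix i assume i: "i < k"
    have "op_comp (replicate k 1) (c, \<lambda>i\<in>{..<k}. op_one) (Suc i) = (\<lambda>x. clip (c (Suc i) x))"
      using op_comp_Suc[of i "replicate k 1" 0 c "\<lambda>i\<in>{..<k}. op_one"] i by (simp add: op_one_def off[unfolded One_nat_def])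
    then show "op_comp (replicate k 1) (c, \<lambda>i\<in>{..<k}. op_one) (Suc i) = c (Suc i)"
      using unit_path_clip_val[OF op_setD(2)[of c k i]] c i by simp
  qed (use c in \<open>auto simp: op_one_def\<close>)
next
  fix c mss d e
  assume c: "c \<in> topspace (op_space (length mss))"
    and d: "d \<in> (\<Pi>\<^sub>E s\<in>{..<length mss}. topspace (op_space (length (mss ! s))))"
    and e: "e \<in> (\<Pi>\<^sub>E i\<in>{..<length (concat mss)}. topspace (op_space (concat mss ! i)))"
  let ?L = "map length mss" and ?S = "map sum_list mss"
  let ?B = "\<lambda>s. block ?L e s"
  have cd: "op_comp ?L (c, d) \<in> op_set (length (concat mss))"
    using op_comp_in[of c ?L d] c d by (auto simp: length_concat PiE_iff)
  have ein: "e (offset ?L s + i) \<in> op_set (mss ! s ! i)" if "s < length mss" "i < length (mss ! s)" for s i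
  proof -
    have "offset ?L s + i < length (concat mss)"
      using that offset_less[of s ?L i] by (simp add: length_concat)
    then have "e (offset ?L s + i) \<in> op_set (concat mss ! (offset ?L s + i))"
      using e unfolding PiE_iff topspace_op_space by blast
    then show ?thesis using concat_nth_offset[OF that] by simp
  qed
  have inner: "op_comp (mss ! s) (d s, ?B s) \<in> op_set (sum_list (mss ! s))" if s: "s < length mss" for s
    using d s ein[OF s] by (intro op_comp_in) (auto simp: PiE_iff block_def)
  show "op_comp (concat mss) (op_comp ?L (c, d), e)
      = op_comp ?S (c, \<lambda>s\<in>{..<length mss}. op_comp (mss ! s) (d s, ?B s))"
  proof (rule op_ext)
    show "op_comp (concat mss) (op_comp ?L (c, d), e) \<in> op_set (sum_list (concat mss))"
      using cd e by (intro op_comp_in) (auto simp: PiE_iff)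
    show "op_comp ?S (c, \<lambda>s\<in>{..<length mss}. op_comp (mss ! s) (d s, ?B s)) \<in> op_set (sum_list (concat mss))"
      using c inner op_comp_in[of c ?S "\<lambda>s\<in>{..<length mss}. op_comp (mss ! s) (d s, ?B s)"]
      by (auto simp: sum_list_concat)
    have "(\<Sum>m<length (concat mss). e m 0 0) = (\<Sum>s<length mss. \<Sum>i<length (mss ! s). e (offset ?L s + i) 0 0)"
      using sum_blocks[of "\<lambda>m. e m 0 0" ?L] by (simp add: length_concat)
    also have "\<dots> = (\<Sum>s<length mss. \<Sum>i<length (mss ! s). ?B s i 0 0)"
      by (intro sum.cong) (auto simp: block_def)
    finally show "op_comp (concat mss) (op_comp ?L (c, d), e) 0 0
      = op_comp ?S (c, \<lambda>s\<in>{..<length mss}. op_comp (mss ! s) (d s, ?B s)) 0 0"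
      by (simp add: sum.distrib)
    fix n assume "n < sum_list (concat mss)"
    then have "n < sum_list ?S" by (simp add: sum_list_concat)
    then obtain s m where s: "s < length mss" "m < sum_list (mss ! s)" "n = offset ?S s + m"
      by (auto elim: block_cases)
    obtain i j where i: "i < length (mss ! s)" "j < mss ! s ! i" "m = offset (mss ! s) i + j"
      using block_cases[OF s(2)] by blast
    have n: "n = offset (concat mss) (offset ?L s + i) + j"
      using s i offset_concat[of s mss i] by simp
    have l: "offset ?L s + i < length (concat mss)" "j < concat mss ! (offset ?L s + i)"
      using s i offset_less[of s ?L i] concat_nth_offset[of s mss i] by (auto simp: length_concat)
    have "op_comp (concat mss) (op_comp ?L (c, d), e) (Suc n)
      = (\<lambda>x. e (offset ?L s + i) (Suc j) (d s (Suc i) (c (Suc s) x)))"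
      unfolding n using l s i op_comp_Suc[of s ?L i c d] by simp
    moreover have "op_comp ?S (c, \<lambda>s\<in>{..<length mss}. op_comp (mss ! s) (d s, ?B s)) (Suc n)
      = (\<lambda>x. e (offset ?L s + i) (Suc j) (d s (Suc i) (c (Suc s) x)))"
      using s i by (simp add: block_def)
    ultimately show "op_comp (concat mss) (op_comp ?L (c, d), e) (Suc n)
      = op_comp ?S (c, \<lambda>s\<in>{..<length mss}. op_comp (mss ! s) (d s, ?B s)) (Suc n)" by simp
  qed
next
  fix c js d \<sigma>
  assume c: "c \<in> topspace (op_space (length js))"
    and d: "d \<in> (\<Pi>\<^sub>E s\<in>{..<length js}. topspace (op_space (js ! s)))" and \<sigma>: "\<sigma> permutes {..<length js}"
  let ?k = "length js" and ?js = "permute_blocks \<sigma> js" and ?d = "permute_tuple (length js) \<sigma> d"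
  define \<tau> where "\<tau> = inv_into UNIV \<sigma>"
  have \<tau>: "\<tau> permutes {..<?k}" "\<And>s. \<tau> (\<sigma> s) = s"
    using permutes_inv[OF \<sigma>] permutes_inverses(2)[OF \<sigma>] by (auto simp: \<tau>_def)
  have in\<sigma>: "s < ?k \<Longrightarrow> \<sigma> s < ?k" "s < ?k \<Longrightarrow> \<tau> s < ?k" for s
    using permutes_in_image[OF \<sigma>, of s] permutes_in_image[OF \<tau>(1), of s] by auto
  have len: "length ?js = ?k" and nth: "\<And>p. p < ?k \<Longrightarrow> ?js ! p = js ! \<tau> p"
    by (auto simp: permute_blocks_def \<tau>_def)
  have dp: "?d p = d (\<tau> p)" if "p < ?k" for p
    using that by (simp add: permute_tuple_def \<tau>_def)
  have sumjs: "sum_list ?js = sum_list js"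
  proof -
    have "sum_list ?js = (\<Sum>p<?k. ?js ! p)"
      by (simp add: sum_list_sum_nth len atLeast0LessThan)
    also have "\<dots> = (\<Sum>p<?k. js ! \<tau> p)"
      by (simp add: nth)
    also have "\<dots> = (\<Sum>p<?k. js ! p)"
      using sum.permute[OF \<tau>(1), of "\<lambda>p. js ! p"] by (simp add: comp_def)
    finally show ?thesis by (simp add: sum_list_sum_nth atLeast0LessThan)
  qed
  show "op_comp js (op_act ?k c \<sigma>, d) = op_act (sum_list js) (op_comp ?js (c, ?d)) (block_perm \<sigma> js)"
    unfolding op_act_def[of "sum_list js"]
  proof (rule op_eqI[symmetric])
    show "op_comp js (op_act ?k c \<sigma>, d) \<in> op_set (sum_list js)"
      using op_act_in[OF _ \<sigma>] c d by (intro op_comp_in) (auto simp: PiE_iff)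
    have "(\<Sum>s<?k. ?d s 0 0) = (\<Sum>s<?k. d (\<tau> s) 0 0)"
      by (simp add: dp)
    also have "\<dots> = (\<Sum>s<?k. d s 0 0)"
      using sum.permute[OF \<tau>(1), of "\<lambda>p. d p 0 0"] by (simp add: comp_def)
    finally show "op_comp ?js (c, ?d) 0 0 = op_comp js (op_act ?k c \<sigma>, d) 0 0"
      by (simp add: len op_act_def)
    fix n assume "n < sum_list js"
    then obtain s i where s: "s < ?k" "i < js ! s" "n = offset js s + i"
      using block_cases by blast
    then show "op_comp ?js (c, ?d) (Suc (block_perm \<sigma> js n)) = op_comp js (op_act ?k c \<sigma>, d) (Suc n)"
      using in\<sigma>[of s] op_comp_Suc[of "\<sigma> s" ?js i c ?d]
      by (simp add: block_perm_offset len nth \<tau> dp op_act_def)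
  qed
next
  fix c js d \<tau>
  assume c: "c \<in> topspace (op_space (length js))"
    and d: "d \<in> (\<Pi>\<^sub>E s\<in>{..<length js}. topspace (op_space (js ! s)))"
    and \<tau>: "\<And>s. s < length js \<Longrightarrow> \<tau> s permutes {..<js ! s}"
  have in\<tau>: "\<tau> s i < js ! s" if "s < length js" "i < js ! s" for s i
    using permutes_in_image[OF \<tau>[OF that(1)], of i] that by simp
  show "op_comp js (c, \<lambda>s\<in>{..<length js}. op_act (js ! s) (d s) (\<tau> s))
      = op_act (sum_list js) (op_comp js (c, d)) (sum_perm \<tau> js)"
    unfolding op_act_def[of "sum_list js"]
  proof (rule op_eqI[symmetric])
    show "op_comp js (c, \<lambda>s\<in>{..<length js}. op_act (js ! s) (d s) (\<tau> s)) \<in> op_set (sum_list js)"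
      using op_act_in[OF _ \<tau>] c d by (intro op_comp_in) (auto simp: PiE_iff)
    show "op_comp js (c, d) 0 0 = op_comp js (c, \<lambda>s\<in>{..<length js}. op_act (js ! s) (d s) (\<tau> s)) 0 0"
      by (simp add: op_act_def)
    fix n assume "n < sum_list js"
    then obtain s i where s: "s < length js" "i < js ! s" "n = offset js s + i"
      using block_cases by blast
    then show "op_comp js (c, d) (Suc (sum_perm \<tau> js n))
        = op_comp js (c, \<lambda>s\<in>{..<length js}. op_act (js ! s) (d s) (\<tau> s)) (Suc n)"
      using in\<tau>[OF s(1,2)] by (simp add: sum_perm_offset op_act_def)
  qed
qed

lemma lattice_path_E_infinity: "E_infinity_operad op_space op_act op_one op_comp"
proof -
  interpret operad op_space op_act op_one op_comp
    by (rule lattice_path_operad)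
  have "topspace (op_space k) \<noteq> {}" for k
    using standard_path_in[of k "real k"] by auto
  then show ?thesis
    using contractible_op_space
    by unfold_locales (intro contractible_imp_weakly_equivalent_to_point)
qed

section \<open>The action on the totalization\<close>

lemma sum_simplex_push:
  assumes "finite (Field r)" "finite B"
  shows "(\<Sum>j\<in>B. simplex_push r r' \<psi> p j) = (\<Sum>i\<in>{i \<in> Field r. \<psi> i \<in> B}. p i)"
proof -
  have "(\<Sum>j\<in>B. \<Sum>i\<in>{i \<in> {i \<in> Field r. \<psi> i \<in> B}. \<psi> i = j}. p i) = (\<Sum>i\<in>{i \<in> Field r. \<psi> i \<in> B}. p i)"
    using assms by (intro sum.group) auto
  moreover have "{i \<in> {i \<in> Field r. \<psi> i \<in> B}. \<psi> i = j} = {i \<in> Field r. \<psi> i = j}" if "j \<in> B" for j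
    using that by auto
  ultimately show ?thesis
    by (simp add: simplex_push_def)
qed

context
  fixes r r' \<psi> p
  assumes r: "r \<in> fin_ord" and r': "r' \<in> fin_ord" and \<psi>: "\<psi> \<in> ord_hom r r'"
    and p: "p \<in> topspace (simplex_space r)"
begin

lemma simplex_push_in: "simplex_push r r' \<psi> p \<in> topspace (simplex_space r')"
proof -
  have "{i \<in> Field r. \<psi> i \<in> Field r'} = Field r"
    using ord_homD(2)[OF \<psi>] by auto
  then have "(\<Sum>j\<in>Field r'. simplex_push r r' \<psi> p j) = 1"
    using sum_simplex_push[OF fin_ordD(1)[OF r] fin_ordD(1)[OF r'], of r' \<psi> p] simplexD(3)[OF p] by simp
  moreover have "simplex_push r r' \<psi> p j = 0" if "j \<notin> Field r'" for j
    using ord_homD(2)[OF \<psi>] that unfolding simplex_push_def by (intro sum.neutral) auto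
  moreover have "0 \<le> simplex_push r r' \<psi> p j" for j
    using simplexD(1)[OF p] by (simp add: simplex_push_def sum_nonneg)
  ultimately show ?thesis by (simp add: simplex_space_topspace)
qed

text \<open>Pushing a point forward merges consecutive cells, so the cell of \<open>\<psi> i\<close>
  contains the cell of \<open>i\<close>. Together with \<open>upper_simplex_push\<close> this lets
  the same intervals subdivide for both points.\<close>

lemma lower_simplex_push:
  assumes i: "i \<in> Field r"
  shows "lower r' (simplex_push r r' \<psi> p) (\<psi> i) \<le> lower r p i"
proof -
  have "lower r' (simplex_push r r' \<psi> p) (\<psi> i)
      = (\<Sum>l\<in>{l \<in> Field r. \<psi> l \<in> {j \<in> Field r'. (j, \<psi> i) \<in> r' \<and> j \<noteq> \<psi> i}}. p l)"
    unfolding lower_def using fin_ordD(1)[OF r] fin_ordD(1)[OF r'] by (intro sum_simplex_push) auto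
  also have "\<dots> \<le> lower r p i"
    unfolding lower_def
  proof (rule sum_mono2)
    show "{l \<in> Field r. \<psi> l \<in> {j \<in> Field r'. (j, \<psi> i) \<in> r' \<and> j \<noteq> \<psi> i}}
        \<subseteq> {j \<in> Field r. (j, i) \<in> r \<and> j \<noteq> i}"
      using fin_ordD(6)[OF r i] ord_homD(3)[OF \<psi>] fin_ordD(4)[OF r'] by blast
  qed (use fin_ordD(1)[OF r] simplexD(1)[OF p] in auto)
  finally show ?thesis .
qed

lemma upper_simplex_push:
  assumes i: "i \<in> Field r"
  shows "upper r p i \<le> upper r' (simplex_push r r' \<psi> p) (\<psi> i)"
proof -
  have "upper r p i \<le> (\<Sum>l\<in>{l \<in> Field r. \<psi> l \<in> {j \<in> Field r'. (j, \<psi> i) \<in> r'}}. p l)"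
    unfolding upper_def
  proof (rule sum_mono2)
    show "{j \<in> Field r. (j, i) \<in> r} \<subseteq> {l \<in> Field r. \<psi> l \<in> {j \<in> Field r'. (j, \<psi> i) \<in> r'}}"
      using ord_homD(2,3)[OF \<psi>] by blast
  qed (use fin_ordD(1)[OF r] simplexD(1)[OF p] in auto)
  also have "\<dots> = upper r' (simplex_push r r' \<psi> p) (\<psi> i)"
    unfolding upper_def using fin_ordD(1)[OF r] fin_ordD(1)[OF r']
    by (intro sum_simplex_push[symmetric]) auto
  finally show ?thesis .
qed

lemma subdivision_push:
  assumes sub: "subdivision k c r p S f \<phi> a b"
  shows "subdivision k c r' (simplex_push r r' \<psi> p) S f (compose (Field S) \<psi> \<phi>) a b"
proof -
  note D = subdivisionD[OF sub]
  have "lower r' (simplex_push r r' \<psi> p) (compose (Field S) \<psi> \<phi> s) \<le> a s \<and>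
      b s \<le> upper r' (simplex_push r r' \<psi> p) (compose (Field S) \<psi> \<phi> s)" if s: "s \<in> Field S" for s
    using lower_simplex_push[OF ord_homD(2)[OF D(3) s]] upper_simplex_push[OF ord_homD(2)[OF D(3) s]]
      D(6)[OF s] s by (auto simp: compose_def)
  then show ?thesis
    using ord_hom_compose[OF D(1,3) \<psi>] sub unfolding subdivision_def by auto
qed

end

section \<open>Subdivisions depending on parameters\<close>

lemma continuous_map_cumulative:
  assumes "continuous_map Z (simplex_space r) p" "finite (Field r)"
  shows "continuous_map Z euclideanreal (\<lambda>z. lower r (p z) i)"
    "continuous_map Z euclideanreal (\<lambda>z. upper r (p z) i)"
  unfolding lower_def upper_def
  using continuous_map_compose[OF assms(1) continuous_map_simplex_coord] assms(2)
  by (auto simp: comp_def intro!: continuous_map_sum)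

text \<open>With the combinatorial type fixed, only weak inequalities and equations between
  continuous functions remain; \<open>continuous_map_op_eval\<close> handles the endpoints varying
  together with the path.\<close>

lemma closedin_subdivision:
  assumes S: "S \<in> fin_ord" "f \<in> Field S \<rightarrow>\<^sub>E {..<k}" "\<phi> \<in> ord_hom S r" and r: "r \<in> fin_ord"
    and c: "continuous_map Z (op_space k) c" and p: "continuous_map Z (simplex_space r) p"
    and a: "\<And>s. continuous_map Z euclideanreal (\<lambda>z. a z s)"
    and b: "\<And>s. continuous_map Z euclideanreal (\<lambda>z. b z s)"
  shows "closedin Z {z \<in> topspace Z. subdivision k (\<lambda>i. c z (Suc i)) r (p z) S f \<phi> (a z) (b z)}"
proof -
  have finS: "finite (Field S)"
    using fin_ordD(1)[OF S(1)] .
  have eq: "subdivision k (\<lambda>i. c z (Suc i)) r (p z) S f \<phi> (a z) (b z) \<longleftrightarrow>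
     (\<forall>s\<in>Field S. 0 \<le> a z s \<and> a z s \<le> b z s \<and> b z s \<le> 1) \<and>
     (\<forall>u\<in>{u \<in> S. fst u \<noteq> snd u}. b z (fst u) \<le> a z (snd u)) \<and>
     (\<forall>s\<in>Field S. lower r (p z) (\<phi> s) \<le> a z s \<and> b z s \<le> upper r (p z) (\<phi> s)) \<and>
     (\<forall>i\<in>{..<k}. (\<Sum>s\<in>{s \<in> Field S. f s = i}. c z (Suc i) (b z s) - c z (Suc i) (a z s)) = 1)" for z
    using S unfolding subdivision_def by auto
  have const: "continuous_map Z euclideanreal (\<lambda>_. x)" for x
    by simp
  show ?thesis
    unfolding eq
    by (intro closedin_conj closedin_Ball closedin_le closedin_eq a b const
        continuous_map_cumulative[OF p fin_ordD(1)[OF r]] continuous_map_sum continuous_map_diff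
        continuous_map_op_eval[OF c]) (use finS in auto)
qed

text \<open>Up to time \<open>a t\<close> the coordinate \<open>c i\<close> has increased exactly on
  the earlier intervals labelled \<open>i\<close>. So the cells of the point \<open>q i\<close> are
  bounded by the images of the interval ends under \<open>c i\<close>, which allows subdivisions of
  these cells to be pulled back along \<open>c i\<close>.\<close>

lemma subdivision_lower_upper:
  assumes sub: "subdivision k c r p S f \<phi> a b" and i: "i < k" "unit_path (c i)"
    and t: "t \<in> Field S" "f t = i"
  shows "lower (preimage_ord S f {i}) (weight c S f a b i) t = c i (a t)"
    and "upper (preimage_ord S f {i}) (weight c S f a b i) t = c i (b t)"
proof -
  note D = subdivisionD[OF sub]
  let ?P = "preimage_ord S f {i}" and ?q = "weight c S f a b i"
  have "lower ?P ?q t = (\<Sum>s\<in>{s \<in> Field S. f s = i}. mass (c i) ({0<..a t} \<inter> {a s<..b s}))"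
    unfolding lower_def
  proof (rule sum.mono_neutral_cong_left)
    show "finite {s \<in> Field S. f s = i}"
      using fin_ordD(1)[OF D(1)] by simp
    show "{j \<in> Field ?P. (j, t) \<in> ?P \<and> j \<noteq> t} \<subseteq> {s \<in> Field S. f s = i}"
      using D(1) by auto
    show "\<forall>s\<in>{s \<in> Field S. f s = i} - {j \<in> Field ?P. (j, t) \<in> ?P \<and> j \<noteq> t}.
        mass (c i) ({0<..a t} \<inter> {a s<..b s}) = 0"
    proof
      fix s assume s: "s \<in> {s \<in> Field S. f s = i} - {j \<in> Field ?P. (j, t) \<in> ?P \<and> j \<noteq> t}"
      then have sS: "s \<in> Field S" "f s = i" by auto
      have "s = t \<or> (s, t) \<notin> S"
        using s t D(1) by (auto simp: preimage_ord_def[of S f] Field_Restr)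
      then have "a t \<le> a s"
        using fin_ordD(6)[OF D(1) sS(1) t(1)] D(5)[of t s] D(4)[OF t(1)] by (cases "s = t") auto
      then have "{0<..a t} \<inter> {a s<..b s} = {}" by auto
      then show "mass (c i) ({0<..a t} \<inter> {a s<..b s}) = 0"
        by (simp only: mass_empty)
    qed
    fix s assume "s \<in> {j \<in> Field ?P. (j, t) \<in> ?P \<and> j \<noteq> t}"
    then have s: "s \<in> Field S" "f s = i" "(s, t) \<in> S" "s \<noteq> t"
      using D(1) by (auto simp: preimage_ord_def)
    then have "{0<..a t} \<inter> {a s<..b s} = {a s<..b s}"
      using D(5)[OF s(3,4)] D(4)[OF s(1)] by auto
    then show "?q s = mass (c i) ({0<..a t} \<inter> {a s<..b s})"
      using s D(4)[OF s(1)] mass_Ioc[OF i(2), of "a s" "b s"]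
      by (simp add: weight_def del: Int_greaterThanAtMost)
  qed
  also have "\<dots> = c i (a t) - c i 0"
    using D(4)[OF t(1)] by (intro subdivision_mass_split[OF sub i]) auto
  finally show l: "lower ?P ?q t = c i (a t)"
    using unit_pathD(3)[OF i(2)] by simp
  have "upper ?P ?q t = lower ?P ?q t + ?q t"
    using D(1) t weight_in_simplex[of k c r p S f \<phi> a b i] sub i by (intro upper_eq) auto
  then show "upper ?P ?q t = c i (b t)"
    using l t by (simp add: weight_def)
qed

section \<open>Definition and continuity of the action\<close>

context cosimplicial_brackets
begin

lemma continuous_map_Tot_component:
  assumes "r \<in> fin_ord"
  shows "continuous_map (Tot X push) (compact_open_topology (simplex_space r) (X r)) (\<lambda>h. h r)"
  unfolding Tot_def
  using assms by (intro continuous_map_from_subtopology continuous_map_product_projection)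

text \<open>Evaluating \<open>y z i\<close> at a moving point of the simplex is jointly continuous
  because simplices are compact Hausdorff; with \<open>S\<close>, \<open>f\<close>,
  \<open>\<phi>\<close> fixed, the rest is composition of continuous maps.\<close>

lemma val_continuous:
  assumes S: "S \<in> fin_ord" "f \<in> Field S \<rightarrow> {..<k}" "\<phi> \<in> ord_hom S r" and r: "r \<in> fin_ord"
    and c: "continuous_map Z (op_space k) c"
    and y: "\<And>i. i < k \<Longrightarrow> continuous_map Z (Tot X push) (\<lambda>z. y z i)"
    and a: "\<And>s. continuous_map Z euclideanreal (\<lambda>z. a z s)"
    and b: "\<And>s. continuous_map Z euclideanreal (\<lambda>z. b z s)"
    and sub: "\<And>z. z \<in> topspace Z \<Longrightarrow> subdivision k (\<lambda>i. c z (Suc i)) r (p z) S f \<phi> (a z) (b z)"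
  shows "continuous_map Z (X r) (\<lambda>z. val k (y z) S r f \<phi> (weight (\<lambda>i. c z (Suc i)) S f (a z) (b z)))"
proof -
  let ?P = "\<lambda>i. preimage_ord S f {i}"
  let ?q = "\<lambda>z. weight (\<lambda>i. c z (Suc i)) S f (a z) (b z)"
  have P: "?P i \<in> fin_ord" for i
    using S by auto
  have cz: "c z \<in> op_set k" if "z \<in> topspace Z" for z
    using continuous_map_funspace[OF c] that by auto
  have "continuous_map Z (X (preimage_ord S f {..<k})) (\<lambda>z. brs S {..<k} f (\<lambda>i. y z i (?P i) (?q z i)))"
  proof (rule brs_continuous[OF S(1)])
    fix i assume "i \<in> {..<k}"
    then have i: "i < k" by simp
    have q: "continuous_map Z (simplex_space (?P i)) (\<lambda>z. ?q z i)"
    proof (rule continuous_map_into_simplex)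
      show "continuous_map Z euclideanreal (\<lambda>z. ?q z i s)" for s
        unfolding weight_def
        by (cases "s \<in> Field S \<and> f s = i")
           (use i in \<open>auto intro!: continuous_map_diff continuous_map_op_eval[OF c] a b\<close>)
      show "?q z i \<in> topspace (simplex_space (?P i))" if "z \<in> topspace Z" for z
        using weight_in_simplex[OF sub[OF that] i] op_setD(2)[OF cz[OF that] i] by simp
    qed
    have "continuous_map Z (compact_open_topology (simplex_space (?P i)) (X (?P i))) (\<lambda>z. y z i (?P i))"
      using continuous_map_compose[OF y[OF i] continuous_map_Tot_component[OF P[of i]]] by (simp add: comp_def)
    with q have "continuous_map Z (prod_topology (compact_open_topology (simplex_space (?P i)) (X (?P i)))
        (simplex_space (?P i))) (\<lambda>z. (y z i (?P i), ?q z i))"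
      by (simp add: continuous_map_pairwise comp_def)
    from continuous_map_compose[OF this continuous_map_compact_open_eval[OF
          compact_simplex_space[OF fin_ordD(1)[OF P]] Hausdorff_simplex_space]]
    show "continuous_map Z (X (?P i)) (\<lambda>z. y z i (?P i) (?q z i))"
      by (simp add: comp_def)
  qed simp
  then have "continuous_map Z (X S) (\<lambda>z. brs S {..<k} f (\<lambda>i. y z i (?P i) (?q z i)))"
    by (simp only: preimage_ord_all[OF S(2)])
  from continuous_map_compose[OF this push_continuous[OF S(1) r S(3)]] show ?thesis
    unfolding val_def by (simp add: comp_def)
qed

text \<open>The choice is harmless by \<open>val_unique\<close>; \<open>action_val_eq\<close>
  permits computing with any subdivision.\<close>

definition action_val :: "nat \<Rightarrow> (nat \<Rightarrow> real \<Rightarrow> real) \<Rightarrow> (nat \<Rightarrow> nat rel \<Rightarrow> (nat \<Rightarrow> real) \<Rightarrow> 'a)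
    \<Rightarrow> nat rel \<Rightarrow> (nat \<Rightarrow> real) \<Rightarrow> 'a" where
  "action_val k c y r p = (SOME v. \<exists>S f \<phi> a b. subdivision k (\<lambda>i. c (Suc i)) r p S f \<phi> a b \<and>
     v = val k y S r f \<phi> (weight (\<lambda>i. c (Suc i)) S f a b))"

definition action :: "nat \<Rightarrow> (nat \<Rightarrow> real \<Rightarrow> real) \<times> (nat \<Rightarrow> nat rel \<Rightarrow> (nat \<Rightarrow> real) \<Rightarrow> 'a)
    \<Rightarrow> nat rel \<Rightarrow> (nat \<Rightarrow> real) \<Rightarrow> 'a" where
  "action k = (\<lambda>(c, y). \<lambda>r\<in>fin_ord. \<lambda>p\<in>topspace (simplex_space r). action_val k c y r p)"

text \<open>The strict inequality with \<open>n + 1\<close> is an open condition on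
  \<open>c\<close>, and as cardinalities are integers it still leaves at most \<open>n\<close>
  breaks.\<close>

lemma op_subdivision_exists:
  assumes "c \<in> op_set k" "r \<in> fin_ord" "p \<in> topspace (simplex_space r)" "c 0 0 < real n + 1" "inj e"
  shows "\<exists>S f \<phi> a b. subdivision k (\<lambda>i. c (Suc i)) r p S f \<phi> a b \<and>
    Field S \<subseteq> e ` {..<n + 2 * card (Field r) + 2}"
proof -
  obtain F where F: "breaks k (\<lambda>i. c (Suc i)) F" "real (card F) \<le> c 0 0"
    using op_setD(4)[OF assms(1)] by auto
  then have "card F \<le> n"
    using assms(4) by linarith
  then show ?thesis
    using subdivision_exists[where c = "\<lambda>i. c (Suc i)", OF assms(2,3) op_setD(2)[OF assms(1)] F(1) _ assms(5)]
    by simp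
qed

lemma op_subdivision_exists_range:
  fixes e :: "nat \<Rightarrow> nat"
  assumes "c \<in> op_set k" "r \<in> fin_ord" "p \<in> topspace (simplex_space r)" "inj e"
  shows "\<exists>S f \<phi> a b. subdivision k (\<lambda>i. c (Suc i)) r p S f \<phi> a b \<and> Field S \<subseteq> range e"
proof -
  have "c 0 0 < real (nat \<lceil>c 0 0\<rceil>) + 1"
    by linarith
  from op_subdivision_exists[OF assms(1-3) this assms(4)] show ?thesis
    by (elim ex_forward conj_forward) auto
qed

lemma action_val_eq:
  assumes c: "c \<in> op_set k" and r: "r \<in> fin_ord" and p: "p \<in> topspace (simplex_space r)"
    and y: "\<And>i. i < k \<Longrightarrow> y i \<in> topspace (Tot X push)"
    and sub: "subdivision k (\<lambda>i. c (Suc i)) r p S f \<phi> a b"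
  shows "action_val k c y r p = val k y S r f \<phi> (weight (\<lambda>i. c (Suc i)) S f a b)"
proof -
  let ?Q = "\<lambda>v. \<exists>S f \<phi> a b. subdivision k (\<lambda>i. c (Suc i)) r p S f \<phi> a b \<and>
     v = val k y S r f \<phi> (weight (\<lambda>i. c (Suc i)) S f a b)"
  have "?Q (val k y S r f \<phi> (weight (\<lambda>i. c (Suc i)) S f a b))"
    using sub by blast
  from someI[of ?Q, OF this] obtain S' f' \<phi>' a' b'
    where s': "subdivision k (\<lambda>i. c (Suc i)) r p S' f' \<phi>' a' b'"
      "action_val k c y r p = val k y S' r f' \<phi>' (weight (\<lambda>i. c (Suc i)) S' f' a' b')"
    unfolding action_val_def by blast
  show ?thesis
    unfolding s'(2) by (rule val_unique[OF r p _ y s'(1) sub]) (rule op_setD(2)[OF c])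
qed

lemma val_in:
  assumes r: "r \<in> fin_ord" and c: "\<And>i. i < k \<Longrightarrow> unit_path (c i)"
    and y: "\<And>i. i < k \<Longrightarrow> y i \<in> topspace (Tot X push)"
    and sub: "subdivision k c r p S f \<phi> a b"
  shows "brs S {..<k} f (\<lambda>i. y i (preimage_ord S f {i}) (weight c S f a b i)) \<in> topspace (X S)"
    and "val k y S r f \<phi> (weight c S f a b) \<in> topspace (X r)"
proof -
  note D = subdivisionD[OF sub]
  show 1: "brs S {..<k} f (\<lambda>i. y i (preimage_ord S f {i}) (weight c S f a b i)) \<in> topspace (X S)"
  proof (rule brs_in[OF D(1)])
    show "f \<in> Field S \<rightarrow> {..<k}" using D(2) by auto
    show "y i (preimage_ord S f {i}) (weight c S f a b i) \<in> topspace (X (preimage_ord S f {i}))"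
      if "i \<in> {..<k}" for i
      using that D(1) weight_in_simplex[OF sub _ c, of i] by (intro TotD(4) y) auto
  qed simp
  show "val k y S r f \<phi> (weight c S f a b) \<in> topspace (X r)"
    unfolding val_def using push_in[OF D(1) r D(3) 1] .
qed

text \<open>By \<open>subdivision_push\<close> one subdivision computes the value at
  \<open>p\<close> and at its image, and the two results differ only by a push along
  \<open>\<psi>\<close>.\<close>

lemma action_val_natural:
  assumes c: "c \<in> op_set k" and r: "r \<in> fin_ord" "r' \<in> fin_ord" and \<psi>: "\<psi> \<in> ord_hom r r'"
    and p: "p \<in> topspace (simplex_space r)"
    and y: "\<And>i. i < k \<Longrightarrow> y i \<in> topspace (Tot X push)"
  shows "action_val k c y r' (simplex_push r r' \<psi> p) = push r r' \<psi> (action_val k c y r p)"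
proof -
  obtain S f \<phi> a b where sub: "subdivision k (\<lambda>i. c (Suc i)) r p S f \<phi> a b"
    using op_subdivision_exists_range[OF c r(1) p inj_on_id] by (elim exE conjE)
  note D = subdivisionD[OF sub]
  have "action_val k c y r' (simplex_push r r' \<psi> p)
      = val k y S r' f (compose (Field S) \<psi> \<phi>) (weight (\<lambda>i. c (Suc i)) S f a b)"
    by (rule action_val_eq[OF c r(2) simplex_push_in[OF r \<psi> p] y subdivision_push[OF r \<psi> p sub]])
  also have "\<dots> = push r r' \<psi> (val k y S r f \<phi> (weight (\<lambda>i. c (Suc i)) S f a b))"
    unfolding val_def
    using push_compose[OF D(1) r D(3) \<psi> val_in(1)[OF r(1) op_setD(2)[OF c] y sub]] .
  also have "val k y S r f \<phi> (weight (\<lambda>i. c (Suc i)) S f a b) = action_val k c y r p"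
    by (rule action_val_eq[OF c r(1) p y sub, symmetric])
  finally show ?thesis .
qed

lemma action_val_continuous:
  assumes r: "r \<in> fin_ord"
  shows "continuous_map (prod_topology (prod_topology (op_space k)
      (product_topology (\<lambda>_. Tot X push) {..<k})) (simplex_space r)) (X r)
      (\<lambda>z. action_val k (fst (fst z)) (snd (fst z)) r (snd z))"
proof -
  let ?Z = "prod_topology (prod_topology (op_space k) (product_topology (\<lambda>_. Tot X push) {..<k})) (simplex_space r)"
  let ?g = "\<lambda>z. action_val k (fst (fst z)) (snd (fst z)) r (snd z)"
  \<comment> \<open>These open sets exhaust the space, and on each of them all subdivisions can be
    found in a fixed finite set of names.\<close>
  let ?T = "\<lambda>n::nat. {z \<in> topspace ?Z. fst (fst z) 0 0 < real n + 1}"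
  have cZ: "continuous_map ?Z (op_space k) (\<lambda>z. fst (fst z))"
    using continuous_map_compose[OF continuous_map_fst continuous_map_fst] by (simp add: comp_def)
  have yZ: "continuous_map ?Z (Tot X push) (\<lambda>z. snd (fst z) i)" if "i < k" for i
    using continuous_map_compose[OF continuous_map_compose[OF continuous_map_fst continuous_map_snd]
        continuous_map_product_projection, of i "{..<k}"] that by (simp add: comp_def)
  have mem: "fst (fst z) \<in> op_set k" "\<And>i. i < k \<Longrightarrow> snd (fst z) i \<in> topspace (Tot X push)"
    "snd z \<in> topspace (simplex_space r)" if "z \<in> topspace ?Z" for z
    using that by (simp_all add: mem_Times_iff PiE_iff)
  have gin: "?g z \<in> topspace (X r)" if z: "z \<in> topspace ?Z" for z
  proof -
    obtain S f \<phi> a b where sub: "subdivision k (\<lambda>i. fst (fst z) (Suc i)) r (snd z) S f \<phi> a b"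
      using op_subdivision_exists_range[OF mem(1)[OF z] r mem(3)[OF z] inj_on_id] by (elim exE conjE)
    have "?g z = val k (snd (fst z)) S r f \<phi> (weight (\<lambda>i. fst (fst z) (Suc i)) S f a b)"
      by (rule action_val_eq[OF mem(1)[OF z] r mem(3)[OF z] mem(2)[OF z] sub])
    moreover have "val k (snd (fst z)) S r f \<phi> (weight (\<lambda>i. fst (fst z) (Suc i)) S f a b) \<in> topspace (X r)"
      by (rule val_in(2)[OF r _ mem(2)[OF z] sub]) (rule op_setD(2)[OF mem(1)[OF z]])
    ultimately show ?thesis by simp
  qed
  have main: "continuous_map (subtopology ?Z (?T n)) (X r) ?g" for n
    unfolding continuous_map_closedin
  proof (intro conjI allI impI)
    let ?Zn = "subtopology ?Z (?T n)"
    show "?g \<in> topspace ?Zn \<rightarrow> topspace (X r)"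
      using gin by auto
  next
    let ?Zn = "subtopology ?Z (?T n)"
    have top: "z \<in> topspace ?Z" "fst (fst z) 0 0 < real n + 1" if "z \<in> topspace ?Zn" for z
      using that by auto
    let ?N = "n + 2 * card (Field r) + 2"
    define cfg where "cfg = {(S, f, \<phi>). S \<in> fin_ord \<and> Field S \<subseteq> {..<?N} \<and> f \<in> Field S \<rightarrow>\<^sub>E {..<k} \<and> \<phi> \<in> ord_hom S r}"
    have "cfg \<subseteq> (SIGMA S : Pow ({..<?N} \<times> {..<?N}). (Field S \<rightarrow>\<^sub>E {..<k}) \<times> (Field S \<rightarrow>\<^sub>E Field r))"
      by (auto simp: cfg_def ord_hom_def Field_def)
    moreover have "finite (SIGMA S : Pow ({..<?N} \<times> {..<?N}). (Field S \<rightarrow>\<^sub>E {..<k}) \<times> (Field S \<rightarrow>\<^sub>E Field r))"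
    proof (rule finite_SigmaI)
      fix S :: "nat rel" assume "S \<in> Pow ({..<?N} \<times> {..<?N})"
      then have "finite S"
        by (metis Pow_iff finite_SigmaI finite_lessThan finite_subset)
      then have "finite (Field S)"
        by (rule finite_Field)
      then show "finite ((Field S \<rightarrow>\<^sub>E {..<k}) \<times> (Field S \<rightarrow>\<^sub>E Field r))"
        using fin_ordD(1)[OF r] by (intro finite_cartesian_product finite_PiE) auto
    qed simp
    ultimately have fincfg: "finite cfg"
      by (rule finite_subset)
    \<comment> \<open>The endpoints \<open>a\<close> and \<open>b\<close> are points of this compact
      cube, so forgetting them is a closed map from \<open>?W\<close> to \<open>?Zn\<close>.\<close>
    let ?K = "product_topology (\<lambda>_::nat. top_of_set {0..1::real}) UNIV"
    let ?W = "prod_topology ?Zn (prod_topology ?K ?K)"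
    have K: "compact_space (prod_topology ?K ?K)"
      by (simp add: compact_space_prod_topology compact_space_product_topology compact_space_subtopology)
    let ?c = "\<lambda>w. fst (fst (fst w))" and ?y = "\<lambda>w. snd (fst (fst w))" and ?p = "\<lambda>w. snd (fst w)"
    let ?a = "\<lambda>w. fst (snd w)" and ?b = "\<lambda>w. snd (snd w)"
    have fW: "continuous_map ?W ?Z fst"
      using continuous_map_fst[of ?Zn "prod_topology ?K ?K"] by (simp add: continuous_map_in_subtopology)
    have cW: "continuous_map ?W (op_space k) ?c"
      using continuous_map_compose[OF fW cZ] by (simp add: comp_def)
    have yW: "continuous_map ?W (Tot X push) (\<lambda>w. ?y w i)" if "i < k" for i
      using continuous_map_compose[OF fW yZ[OF that]] by (simp add: comp_def)
    have pW: "continuous_map ?W (simplex_space r) ?p"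
      using continuous_map_compose[OF fW continuous_map_snd] by (simp add: comp_def)
    have Ks: "continuous_map ?K euclideanreal (\<lambda>a. a s)" for s
      using continuous_map_product_projection[of s UNIV "\<lambda>_. top_of_set {0..1::real}"]
      by (simp add: continuous_map_in_subtopology)
    have aW: "continuous_map ?W euclideanreal (\<lambda>w. ?a w s)" for s
      using continuous_map_compose[OF continuous_map_compose[OF continuous_map_snd continuous_map_fst] Ks]
      by (simp add: comp_def)
    have bW: "continuous_map ?W euclideanreal (\<lambda>w. ?b w s)" for s
      using continuous_map_compose[OF continuous_map_compose[OF continuous_map_snd continuous_map_snd] Ks]
      by (simp add: comp_def)
    fix C assume C: "closedin (X r) C"
    \<comment> \<open>The parameters and endpoints that form a subdivision of a given type. Only
      over \<open>E\<close> do the weights lie in simplices, so \<open>V\<close> is shown continuous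
      on \<open>E\<close>, and closedness of \<open>E\<close> transfers the result to
      \<open>?W\<close>.\<close>
    define E where "E = (\<lambda>(S, f, \<phi>). {w \<in> topspace ?W. subdivision k (\<lambda>i. ?c w (Suc i)) r (?p w) S f \<phi> (?a w) (?b w)})"
    define V where "V = (\<lambda>(S, f, \<phi>) (w :: (_ \<times> (nat \<Rightarrow> real)) \<times> _). val k (?y w) S r f \<phi> (weight (\<lambda>i. ?c w (Suc i)) S f (?a w) (?b w)))"
    have closedE: "closedin ?W {w \<in> E x. V x w \<in> C}" if "x \<in> cfg" for x
    proof -
      obtain S f \<phi> where x: "x = (S, f, \<phi>)" by (cases x)
      have S: "S \<in> fin_ord" "f \<in> Field S \<rightarrow>\<^sub>E {..<k}" "\<phi> \<in> ord_hom S r"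
        using that x by (auto simp: cfg_def)
      have Ecl: "closedin ?W (E x)"
        unfolding x E_def prod.case
        by (rule closedin_subdivision[OF S r cW pW aW bW])
      have "continuous_map (subtopology ?W (E x)) (X r) (V x)"
        unfolding x V_def prod.case
      proof (rule val_continuous[OF S(1) _ S(3) r])
        show "f \<in> Field S \<rightarrow> {..<k}" using S(2) by auto
        show "subdivision k (\<lambda>i. ?c w (Suc i)) r (?p w) S f \<phi> (?a w) (?b w)"
          if "w \<in> topspace (subtopology ?W (E (S, f, \<phi>)))" for w
          using that unfolding topspace_subtopology E_def by blast
      qed (intro continuous_map_from_subtopology cW yW aW bW; assumption)+
      from closedin_continuous_map_preimage[OF this C]
      have "closedin (subtopology ?W (E x)) {w \<in> E x. V x w \<in> C}"
        using closedin_subset[OF Ecl] by (simp add: Int_absorb1 topspace_subtopology del: topspace_prod_topology)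
      then show ?thesis
        using Ecl by (rule closedin_trans_full)
    qed
    have "closedin ?Zn (\<Union>x\<in>cfg. fst ` {w \<in> E x. V x w \<in> C})"
      using fincfg closedE closed_map_fst[OF K, of ?Zn]
      by (intro closedin_Union) (auto simp: closed_map_def)
    also have "(\<Union>x\<in>cfg. fst ` {w \<in> E x. V x w \<in> C}) = {z \<in> topspace ?Zn. ?g z \<in> C}"
    proof (intro equalityI subsetI)
      fix z assume "z \<in> (\<Union>x\<in>cfg. fst ` {w \<in> E x. V x w \<in> C})"
      then obtain x w where xw: "w \<in> E x" "V x w \<in> C" "z = fst w" by blast
      obtain S f \<phi> where x: "x = (S, f, \<phi>)" by (cases x)
      have w: "w \<in> topspace ?W" and sub: "subdivision k (\<lambda>i. ?c w (Suc i)) r (?p w) S f \<phi> (?a w) (?b w)"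
        using xw(1) unfolding x E_def by auto
      have z: "z \<in> topspace ?Zn"
        using w xw(3) unfolding topspace_prod_topology mem_Times_iff by blast
      note m = mem[OF top(1)[OF z], unfolded xw(3)]
      have "?g z = V x w"
        unfolding xw(3) x V_def prod.case by (rule action_val_eq[OF m(1) r m(3) m(2) sub])
      with xw(2) z show "z \<in> {z \<in> topspace ?Zn. ?g z \<in> C}" by simp
    next
      fix z assume "z \<in> {z \<in> topspace ?Zn. ?g z \<in> C}"
      then have z: "z \<in> topspace ?Zn" "?g z \<in> C" by auto
      note m = mem[OF top(1)[OF z(1)]]
      obtain S f \<phi> a b where sub: "subdivision k (\<lambda>i. fst (fst z) (Suc i)) r (snd z) S f \<phi> a b"
        and N: "Field S \<subseteq> id ` {..<?N}"
        using op_subdivision_exists[OF m(1) r m(3) top(2)[OF z(1)] inj_on_id] by (elim exE conjE)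
      note D = subdivisionD[OF sub]
      \<comment> \<open>Endpoints are set to 0 off \<open>Field S\<close>, where a subdivision does
        not constrain them, to obtain a point of the cube.\<close>
      define a' where "a' s = (if s \<in> Field S then a s else 0)" for s
      define b' where "b' s = (if s \<in> Field S then b s else 0)" for s
      have "(\<Sum>s\<in>{s \<in> Field S. f s = i}. fst (fst z) (Suc i) (b' s) - fst (fst z) (Suc i) (a' s)) = 1"
        if "i < k" for i
        unfolding D(7)[OF that, symmetric] by (intro sum.cong) (auto simp: a'_def b'_def)
      moreover have "s \<in> Field S" "s' \<in> Field S" if "(s, s') \<in> S" for s s'
        using that by (auto intro: FieldI1 FieldI2)
      ultimately have sub': "subdivision k (\<lambda>i. fst (fst z) (Suc i)) r (snd z) S f \<phi> a' b'"
        using sub unfolding subdivision_def by (auto simp: a'_def b'_def)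
      let ?w = "(z, (a', b'))"
      have "a' s \<in> {0..1}" "b' s \<in> {0..1}" for s
        using D(4)[of s] by (auto simp: a'_def b'_def)
      then have w: "?w \<in> topspace ?W"
        using z(1) unfolding topspace_prod_topology mem_Times_iff by (simp add: PiE_iff)
      have "?w \<in> E (S, f, \<phi>)"
        using w sub' unfolding E_def by simp
      moreover have "V (S, f, \<phi>) ?w = ?g z"
        unfolding V_def prod.case using action_val_eq[OF m(1) r m(3) m(2) sub'] by simp
      moreover have "(S, f, \<phi>) \<in> cfg"
        using D(1,2,3) N by (auto simp: cfg_def)
      ultimately show "z \<in> (\<Union>x\<in>cfg. fst ` {w \<in> E x. V x w \<in> C})"
        using z(2) by (intro UN_I[of "(S, f, \<phi>)"] image_eqI[of _ _ ?w]) auto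
    qed
    finally show "closedin ?Zn {z \<in> topspace ?Zn. ?g z \<in> C}" .
  qed
  show ?thesis
  proof (rule pasting_lemma[where I = UNIV and T = ?T and f = "\<lambda>_. ?g"])
    fix n :: nat
    have "continuous_map ?Z euclideanreal (\<lambda>z. fst (fst z) 0 0)"
      using continuous_map_compose[OF cZ continuous_map_op_coord] by (simp add: comp_def)
    then show "openin ?Z (?T n)"
      unfolding continuous_map_upper_lower_semicontinuous_lt by blast
  next
    fix z assume z: "z \<in> topspace ?Z"
    have "fst (fst z) 0 0 < real (nat \<lceil>fst (fst z) 0 0\<rceil>) + 1"
      by linarith
    with z show "\<exists>n. n \<in> UNIV \<and> z \<in> ?T n \<and> ?g z = ?g z" by blast
  next
    fix n :: nat
    show "continuous_map (subtopology ?Z (?T n)) (X r) ?g" by (rule main)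
  qed (rule refl)
qed

lemma action_in:
  assumes c: "c \<in> op_set k" and y: "\<And>i. i < k \<Longrightarrow> y i \<in> topspace (Tot X push)"
    and yE: "y \<in> extensional {..<k}"
  shows "action k (c, y) \<in> topspace (Tot X push)"
proof -
  let ?A = "prod_topology (op_space k) (product_topology (\<lambda>_. Tot X push) {..<k})"
  have cy: "(c, y) \<in> topspace ?A"
    using c y yE by (auto simp: PiE_iff)
  have "restrict (action_val k c y r) (topspace (simplex_space r)) \<in>
        topspace (compact_open_topology (simplex_space r) (X r))" if r: "r \<in> fin_ord" for r
  proof -
    have "continuous_map ?A (compact_open_topology (simplex_space r) (X r))
        (\<lambda>z. restrict (action_val k (fst z) (snd z) r) (topspace (simplex_space r)))"
      using action_val_continuous[OF r, of k]
      by (intro continuous_map_into_compact_open) (simp add: case_prod_unfold)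
    from funcset_mem[OF continuous_map_funspace[OF this] cy] show ?thesis by simp
  qed
  then have "action k (c, y) \<in>
      topspace (product_topology (\<lambda>r. compact_open_topology (simplex_space r) (X r)) fin_ord)"
    unfolding topspace_product_topology action_def by (auto simp del: topspace_compact_open)
  moreover have "action k (c, y) r' (simplex_push r r' \<psi> p) = push r r' \<psi> (action k (c, y) r p)"
    if "r \<in> fin_ord" "r' \<in> fin_ord" "\<psi> \<in> ord_hom r r'" "p \<in> topspace (simplex_space r)" for r r' \<psi> p
    using action_val_natural[OF c that y] simplex_push_in[OF that] that by (simp add: action_def)
  ultimately show ?thesis
    unfolding Tot_def topspace_subtopology by blast
qed

text \<open>Continuity into the mapping spaces follows, by the exponential law, from joint
  continuity in operation, arguments and point of the simplex.\<close>

lemma action_continuous: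
  "continuous_map (prod_topology (op_space k) (product_topology (\<lambda>_. Tot X push) {..<k}))
     (Tot X push) (action k)"
proof -
  let ?A = "prod_topology (op_space k) (product_topology (\<lambda>_. Tot X push) {..<k})"
  let ?P = "product_topology (\<lambda>r. compact_open_topology (simplex_space r) (X r)) fin_ord"
  let ?N = "{h. \<forall>r \<in> fin_ord. \<forall>r' \<in> fin_ord. \<forall>\<phi> \<in> ord_hom r r'. \<forall>p \<in> topspace (simplex_space r).
    h r' (simplex_push r r' \<phi> p) = push r r' \<phi> (h r p)}"
  have comp: "continuous_map ?A (compact_open_topology (simplex_space r) (X r)) (\<lambda>z. action k z r)"
    if r: "r \<in> fin_ord" for r
  proof -
    have "continuous_map ?A (compact_open_topology (simplex_space r) (X r))
        (\<lambda>z. restrict (action_val k (fst z) (snd z) r) (topspace (simplex_space r)))"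
      using action_val_continuous[OF r, of k]
      by (intro continuous_map_into_compact_open) (simp add: case_prod_unfold)
    then show ?thesis
      using r by (simp add: action_def case_prod_unfold)
  qed
  have "action k z \<in> topspace (Tot X push)" if "z \<in> topspace ?A" for z
    using action_in[of "fst z" k "snd z"] that by (simp add: mem_Times_iff PiE_iff)
  moreover have "topspace (Tot X push) \<subseteq> ?N"
    unfolding Tot_def by auto
  ultimately have "action k \<in> topspace ?A \<rightarrow> ?N"
    by blast
  moreover have "continuous_map ?A ?P (action k)"
    unfolding continuous_map_componentwise using comp by (auto simp: action_def case_prod_unfold)
  ultimately have "continuous_map ?A (subtopology ?P ?N) (action k)"
    unfolding continuous_map_in_subtopology by blast
  then show ?thesis
    by (simp only: Tot_def)
qed

lemma action_apply:
  "r \<in> fin_ord \<Longrightarrow> p \<in> topspace (simplex_space r) \<Longrightarrow> action k (c, y) r p = action_val k c y r p"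
  by (simp add: action_def)

lemma Tot_eqI:
  assumes "h \<in> topspace (Tot X push)" "h' \<in> topspace (Tot X push)"
    and "\<And>r p. r \<in> fin_ord \<Longrightarrow> p \<in> topspace (simplex_space r) \<Longrightarrow> h r p = h' r p"
  shows "h = h'"
proof (rule extensionalityI[OF TotD(1)[OF assms(1)] TotD(1)[OF assms(2)]])
  fix r :: "nat rel" assume r: "r \<in> fin_ord"
  show "h r = h' r"
    by (rule extensionalityI[OF TotD(2)[OF assms(1) r] TotD(2)[OF assms(2) r] assms(3)[OF r]])
qed

section \<open>Unit and equivariance of the action\<close>

lemma action_one:
  assumes h: "h \<in> topspace (Tot X push)"
  shows "action 1 (op_one, \<lambda>i\<in>{..<1}. h) = h"
proof (rule Tot_eqI[OF action_in h])
  fix r p assume r: "r \<in> fin_ord" and p: "p \<in> topspace (simplex_space r)"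
  let ?c = "\<lambda>i. op_one (Suc i)" and ?f = "\<lambda>s\<in>Field r. 0::nat" and ?y = "\<lambda>i\<in>{..<1::nat}. h"
  have y: "?y i \<in> topspace (Tot X push)" if "i < 1" for i
    using h that by simp
  have c0: "?c 0 = clip"
    by (simp add: op_one_def)
  have lu: "0 \<le> lower r p s" "upper r p s = lower r p s + p s" "upper r p s \<le> 1" "0 \<le> p s"
    if "s \<in> Field r" for s
    using lower_nonneg[OF r p, of s] upper_le_one[OF r p, of s] upper_eq[OF r p that] simplexD(1)[OF p, of s]
    by auto
  have cl: "clip (upper r p s) - clip (lower r p s) = p s" if "s \<in> Field r" for s
    using lu[OF that] by simp
  \<comment> \<open>For the unit operation the cells of \<open>p\<close> themselves, all labelled 0,
    form a subdivision, and its weights are \<open>p\<close>.\<close>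
  have sub: "subdivision 1 ?c r p r ?f (\<lambda>s\<in>Field r. s) (lower r p) (upper r p)"
    unfolding subdivision_def
  proof (intro conjI ballI allI impI r ord_hom_id)
    fix i :: nat assume "i < 1"
    then have i: "i = 0" by simp
    have "{s \<in> Field r. ?f s = i} = Field r" by (auto simp: i)
    then show "(\<Sum>s\<in>{s \<in> Field r. ?f s = i}. ?c i (upper r p s) - ?c i (lower r p s)) = 1"
      using simplexD(3)[OF p] cl by (simp add: i c0)
  next
    fix u assume "u \<in> r"
    then show "case u of (s, s') \<Rightarrow> s \<noteq> s' \<longrightarrow> upper r p s \<le> lower r p s'"
      using upper_le_lower[OF r p] by auto
  qed (use lu in auto)
  have q: "weight ?c r ?f (lower r p) (upper r p) 0 = p"
    using cl simplexD(2)[OF p] by (auto simp: weight_def c0 fun_eq_iff)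
  have P: "preimage_ord r ?f {0} = r"
    by (rule preimage_ord_all) auto
  have hr: "h r p \<in> topspace (X r)"
    by (rule TotD(4)[OF h r p])
  have "action 1 (op_one, ?y) r p = val 1 ?y r r ?f (\<lambda>s\<in>Field r. s) (weight ?c r ?f (lower r p) (upper r p))"
    unfolding action_apply[OF r p] by (rule action_val_eq[OF op_one_in r p y sub])
  also have "\<dots> = push r r (\<lambda>s\<in>Field r. s) (h r p)"
  proof -
    have "{..<1::nat} = {0}" by auto
    then show ?thesis
      unfolding val_def using brs_singleton[OF r, of "\<lambda>i. ?y i (preimage_ord r ?f {i})
        (weight ?c r ?f (lower r p) (upper r p) i)" 0 ?f] hr by (simp add: P q)
  qed
  also have "\<dots> = h r p"
    by (rule push_id[OF r hr])
  finally show "action 1 (op_one, ?y) r p = h r p" .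
qed (use h op_one_in in auto)

lemma action_equivariant:
  assumes c: "c \<in> op_set k" and y: "y \<in> {..<k} \<rightarrow>\<^sub>E topspace (Tot X push)" and \<sigma>: "\<sigma> permutes {..<k}"
  shows "action k (op_act k c \<sigma>, y) = action k (c, permute_tuple k \<sigma> y)"
proof -
  define \<tau> where "\<tau> = inv_into UNIV \<sigma>"
  have \<tau>: "\<tau> permutes {..<k}" "\<And>i. \<tau> (\<sigma> i) = i" "\<And>i. \<sigma> (\<tau> i) = i"
    using permutes_inv[OF \<sigma>] permutes_inverses[OF \<sigma>] by (auto simp: \<tau>_def)
  have ink: "i < k \<Longrightarrow> \<sigma> i < k" "i < k \<Longrightarrow> \<tau> i < k" for i
    using permutes_in_image[OF \<sigma>, of i] permutes_in_image[OF \<tau>(1), of i] by auto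
  let ?y = "permute_tuple k \<sigma> y" and ?c = "op_act k c \<sigma>"
  have yT: "y i \<in> topspace (Tot X push)" if "i < k" for i
    using y that by auto
  have y': "?y i = y (\<tau> i)" if "i < k" for i
    using that by (simp add: permute_tuple_def \<tau>_def)
  have yT': "?y i \<in> topspace (Tot X push)" if "i < k" for i
    using yT ink that by (simp add: y')
  have c': "?c \<in> op_set k" "\<And>i. i < k \<Longrightarrow> ?c (Suc i) = c (Suc (\<sigma> i))"
    using op_act_in[OF c \<sigma>] by (auto simp: op_act_def)
  have yE: "y \<in> extensional {..<k}" "?y \<in> extensional {..<k}"
    using y by (simp_all add: PiE_iff permute_tuple_def)
  show ?thesis
  proof (rule Tot_eqI[OF action_in[OF c'(1) yT yE(1)] action_in[OF c yT' yE(2)]])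
    fix r p assume r: "r \<in> fin_ord" and p: "p \<in> topspace (simplex_space r)"
    obtain S f \<phi> a b where sub: "subdivision k (\<lambda>i. c (Suc i)) r p S f \<phi> a b"
      using op_subdivision_exists_range[OF c r p inj_on_id] by (elim exE conjE)
    note D = subdivisionD[OF sub]
    \<comment> \<open>Coordinate \<open>i\<close> of the permuted path is coordinate
      \<open>\<sigma> i\<close> of \<open>c\<close>, so the same intervals serve after relabelling
      by the inverse of \<open>\<sigma>\<close>.\<close>
    let ?f = "\<lambda>s\<in>Field S. \<tau> (f s)"
    have fib: "?f s = i \<longleftrightarrow> f s = \<sigma> i" if "s \<in> Field S" for s i
      using that \<tau>(2,3) by auto
    have fibs: "{s \<in> Field S. ?f s = i} = {s \<in> Field S. f s = \<sigma> i}" for i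
      using fib by blast
    have sub': "subdivision k (\<lambda>i. ?c (Suc i)) r p S ?f \<phi> a b"
      unfolding subdivision_def
    proof (intro conjI allI impI D(1,3))
      fix i assume i: "i < k"
      show "(\<Sum>s\<in>{s \<in> Field S. ?f s = i}. ?c (Suc i) (b s) - ?c (Suc i) (a s)) = 1"
        unfolding fibs c'(2)[OF i] using D(7)[OF ink(1)[OF i]] .
    qed (use D(2) ink(2) sub in \<open>auto simp: subdivision_def\<close>)
    let ?x = "\<lambda>i. ?y i (preimage_ord S f {i}) (weight (\<lambda>i. c (Suc i)) S f a b i)"
    have xin: "?x i \<in> topspace (X (preimage_ord S f {i}))" if "i < k" for i
      using TotD(4)[OF yT'[OF that] preimage_ord_fin_ord[OF D(1)]
          weight_in_simplex[OF sub that]] op_setD(2)[OF c that] by blast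
    have "brs S {..<k} f ?x = brs S (\<sigma> ` {..<k}) f ?x"
      using permutes_image[OF \<sigma>] by simp
    also have "\<dots> = brs S {..<k} ?f (\<lambda>i. ?x (\<sigma> i))"
      using ink fib xin permutes_inj[OF \<sigma>]
      by (intro brs_reindex[OF D(1)]) (auto intro: inj_on_subset)
    also have "\<dots> = brs S {..<k} ?f (\<lambda>i. y i (preimage_ord S ?f {i}) (weight (\<lambda>i. ?c (Suc i)) S ?f a b i))"
    proof (rule brs_cong[OF D(1)])
      fix i assume "i \<in> {..<k}"
      then have i: "i < k" by simp
      have P: "preimage_ord S ?f {i} = preimage_ord S f {\<sigma> i}"
        using fibs[of i] by (simp only: Restr_preimage(2)[symmetric])
      have W: "weight (\<lambda>i. ?c (Suc i)) S ?f a b i = weight (\<lambda>i. c (Suc i)) S f a b (\<sigma> i)"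
      proof
        fix s
        show "weight (\<lambda>i. ?c (Suc i)) S ?f a b i s = weight (\<lambda>i. c (Suc i)) S f a b (\<sigma> i) s"
          unfolding weight_def c'(2)[OF i] using fib[of s i] by (cases "s \<in> Field S") (simp_all del: restrict_apply)
      qed
      show "?x (\<sigma> i) \<in> topspace (X (preimage_ord S ?f {i}))"
        unfolding P by (rule xin[OF ink(1)[OF i]])
      show "?x (\<sigma> i) = y i (preimage_ord S ?f {i}) (weight (\<lambda>i. ?c (Suc i)) S ?f a b i)"
        unfolding P W using y'[OF ink(1)[OF i]] \<tau>(2) by simp
    qed auto
    finally have "val k y S r ?f \<phi> (weight (\<lambda>i. ?c (Suc i)) S ?f a b)
        = val k ?y S r f \<phi> (weight (\<lambda>i. c (Suc i)) S f a b)"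
      unfolding val_def by simp
    moreover have "action_val k ?c y r p = val k y S r ?f \<phi> (weight (\<lambda>i. ?c (Suc i)) S ?f a b)"
      by (rule action_val_eq[OF c'(1) r p yT sub'])
    moreover have "action_val k c ?y r p = val k ?y S r f \<phi> (weight (\<lambda>i. c (Suc i)) S f a b)"
      by (rule action_val_eq[OF c r p yT' sub])
    ultimately show "action k (?c, y) r p = action k (c, ?y) r p"
      unfolding action_apply[OF r p] by simp
  qed
qed

end

section \<open>Compatibility of the action with operadic composition\<close>

text \<open>Any section of a monotone surjection is monotone. It need not be continuous: it jumps
  over intervals on which \<open>g\<close> rests.\<close>

lemma unit_path_right_inverse:
  assumes "unit_path g"
  obtains h where "\<And>z. 0 \<le> z \<Longrightarrow> z \<le> 1 \<Longrightarrow> g (h z) = z"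
    "\<And>z z'. 0 \<le> z \<Longrightarrow> z \<le> z' \<Longrightarrow> z' \<le> 1 \<Longrightarrow> h z \<le> h z'"
proof -
  have ex: "\<exists>x. g x = z" if "0 \<le> z" "z \<le> 1" for z
    using IVT'[of g 0 z 1] that unit_pathD(3,4)[OF assms] assms
    by (auto simp: unit_path_def intro: continuous_on_subset)
  define h where "h z = (SOME x. g x = z)" for z
  have h: "g (h z) = z" if "0 \<le> z" "z \<le> 1" for z
    unfolding h_def using someI_ex[OF ex[OF that]] .
  moreover have "h z \<le> h z'" if z: "0 \<le> z" "z \<le> z'" "z' \<le> 1" for z z'
  proof (rule ccontr)
    assume "\<not> h z \<le> h z'"
    then have "g (h z') \<le> g (h z)"
      by (intro unit_pathD(1)[OF assms]) simp
    then have "z = z'"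
      using h[of z] h[of z'] z by auto
    with \<open>\<not> h z \<le> h z'\<close> show False by simp
  qed
  ultimately show thesis by (rule that)
qed

text \<open>If \<open>x\<close> lies outside \<open>[l, u]\<close>, monotonicity and the assumed
  bounds force \<open>g\<close> to be constant from \<open>x\<close> to the nearer end.\<close>

lemma unit_path_clamped:
  assumes g: "unit_path g" and "l \<le> u" "g l \<le> g x" "g x \<le> g u"
  shows "g (max l (min u x)) = g x"
  using unit_pathD(1)[OF g, of x l] unit_pathD(1)[OF g, of u x] assms
  by (auto simp: max_def min_def)

context cosimplicial_brackets
begin

text \<open>Subdivisions for \<open>c\<close> and for the \<open>d s\<close> combine to one for the composite: the intervals
  of the latter are pulled back along \<open>c s\<close> and ordered lexicographically.\<close>

lemma action_comp_val:
  assumes c: "c \<in> op_set (length js)" and d: "\<And>s. s < length js \<Longrightarrow> d s \<in> op_set (js ! s)"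
    and y: "\<And>n. n < sum_list js \<Longrightarrow> y n \<in> topspace (Tot X push)"
    and r: "r \<in> fin_ord" and p: "p \<in> topspace (simplex_space r)"
  shows "action_val (sum_list js) (op_comp js (c, d)) y r p
    = action_val (length js) c (\<lambda>s\<in>{..<length js}. action (js ! s) (d s, block js y s)) r p"
proof -
  let ?k = "length js" and ?c = "\<lambda>i. c (Suc i)" and ?C = "\<lambda>n. op_comp js (c, d) (Suc n)"
  let ?H = "\<lambda>s\<in>{..<length js}. action (js ! s) (d s, block js y s)"
  obtain S f \<phi> a b where sub: "subdivision ?k ?c r p S f \<phi> a b"
    using op_subdivision_exists_range[OF c r p inj_on_id] by (elim exE conjE)
  note D = subdivisionD[OF sub]
  let ?P = "\<lambda>s. preimage_ord S f {s}" and ?q = "weight ?c S f a b"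
  have up: "unit_path (c (Suc s))" if "s < ?k" for s
    using op_setD(2)[OF c that] .
  have P: "?P s \<in> fin_ord" for s
    using D(1) by auto
  have q: "?q s \<in> topspace (simplex_space (?P s))" if "s < ?k" for s
    using weight_in_simplex[OF sub that] up[OF that] by simp
  have yb: "block js y s j \<in> topspace (Tot X push)" if "s < ?k" "j < js ! s" for s j
    using that y by (simp add: block_def)
  have H: "?H s \<in> topspace (Tot X push)" if "s < ?k" for s
    using that action_in[OF d[OF that], of "block js y s"] yb[OF that] by (simp add: block_def)
  \<comment> \<open>A subdivision for each \<open>d s\<close>, at the point \<open>?q s\<close> of
    the simplex on the fibre over \<open>s\<close>. Its elements are codes of pairs with first entry
    \<open>s\<close>, so the orders \<open>T s\<close> have disjoint fields and \<open>s\<close> can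
    be read off as \<open>lab\<close>.\<close>
  have "\<forall>s. \<exists>T g \<psi> u v. s < ?k \<longrightarrow> subdivision (js ! s) (\<lambda>i. d s (Suc i)) (?P s) (?q s) T g \<psi> u v \<and>
      Field T \<subseteq> range (\<lambda>m. prod_encode (s, m))"
  proof
    fix s
    have "inj (\<lambda>m. prod_encode (s, m))"
      by (auto simp: inj_def)
    then show "\<exists>T g \<psi> u v. s < ?k \<longrightarrow> subdivision (js ! s) (\<lambda>i. d s (Suc i)) (?P s) (?q s) T g \<psi> u v \<and>
      Field T \<subseteq> range (\<lambda>m. prod_encode (s, m))"
      using op_subdivision_exists_range[OF d P q] by blast
  qed
  then obtain T where "\<forall>s. \<exists>g \<psi> u v. s < ?k \<longrightarrow> subdivision (js ! s) (\<lambda>i. d s (Suc i)) (?P s) (?q s) (T s) g \<psi> u v \<and>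
      Field (T s) \<subseteq> range (\<lambda>m. prod_encode (s, m))"
    by (rule choice[THEN exE])
  then obtain g where "\<forall>s. \<exists>\<psi> u v. s < ?k \<longrightarrow> subdivision (js ! s) (\<lambda>i. d s (Suc i)) (?P s) (?q s) (T s) (g s) \<psi> u v \<and>
      Field (T s) \<subseteq> range (\<lambda>m. prod_encode (s, m))"
    by (rule choice[THEN exE])
  then obtain \<psi> where "\<forall>s. \<exists>u v. s < ?k \<longrightarrow> subdivision (js ! s) (\<lambda>i. d s (Suc i)) (?P s) (?q s) (T s) (g s) (\<psi> s) u v \<and>
      Field (T s) \<subseteq> range (\<lambda>m. prod_encode (s, m))"
    by (rule choice[THEN exE])
  then obtain u where "\<forall>s. \<exists>v. s < ?k \<longrightarrow> subdivision (js ! s) (\<lambda>i. d s (Suc i)) (?P s) (?q s) (T s) (g s) (\<psi> s) (u s) v \<and>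
      Field (T s) \<subseteq> range (\<lambda>m. prod_encode (s, m))"
    by (rule choice[THEN exE])
  then obtain v where v: "\<forall>s. s < ?k \<longrightarrow> subdivision (js ! s) (\<lambda>i. d s (Suc i)) (?P s) (?q s) (T s) (g s) (\<psi> s) (u s) (v s) \<and>
      Field (T s) \<subseteq> range (\<lambda>m. prod_encode (s, m))"
    by (rule choice[THEN exE])
  have subT: "subdivision (js ! s) (\<lambda>i. d s (Suc i)) (?P s) (?q s) (T s) (g s) (\<psi> s) (u s) (v s)"
    and labT: "\<And>w. w \<in> Field (T s) \<Longrightarrow> fst (prod_decode w) = s" if "s < ?k" for s
    using v that by fastforce+
  note DT = subdivisionD[OF subT]
  have "\<forall>s. \<exists>h. s < ?k \<longrightarrow> (\<forall>z. 0 \<le> z \<longrightarrow> z \<le> 1 \<longrightarrow> c (Suc s) (h z) = z) \<and>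
      (\<forall>z z'. 0 \<le> z \<longrightarrow> z \<le> z' \<longrightarrow> z' \<le> 1 \<longrightarrow> h z \<le> h z')"
    using unit_path_right_inverse[OF up] by metis
  then obtain h where "\<forall>s. s < ?k \<longrightarrow> (\<forall>z. 0 \<le> z \<longrightarrow> z \<le> 1 \<longrightarrow> c (Suc s) (h s z) = z) \<and>
      (\<forall>z z'. 0 \<le> z \<longrightarrow> z \<le> z' \<longrightarrow> z' \<le> 1 \<longrightarrow> h s z \<le> h s z')"
    by (rule choice[THEN exE])
  then have h: "\<And>s z. s < ?k \<Longrightarrow> 0 \<le> z \<Longrightarrow> z \<le> 1 \<Longrightarrow> c (Suc s) (h s z) = z"
    "\<And>s z z'. s < ?k \<Longrightarrow> 0 \<le> z \<Longrightarrow> z \<le> z' \<Longrightarrow> z' \<le> 1 \<Longrightarrow> h s z \<le> h s z'"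
    by blast+

  define lab where "lab w = fst (prod_decode w)" for w
  define U where "U = (\<Union>s<?k. Field (T s))"
  define \<pi> where "\<pi> = (\<lambda>w\<in>U. \<psi> (lab w) w)"
  \<comment> \<open>Elements over the same interval of \<open>S\<close> share the label of that
    interval and hence belong to one \<open>T s\<close>, whose order breaks the tie.\<close>
  define R where "R = {(w, w'). w \<in> U \<and> w' \<in> U \<and> (\<pi> w, \<pi> w') \<in> S \<and> (\<pi> w = \<pi> w' \<longrightarrow> (w, w') \<in> T (lab w))}"
  define G where "G = (\<lambda>w\<in>U. offset js (lab w) + g (lab w) w)"
  \<comment> \<open>Pulls a time \<open>z\<close> of the clock back to a time of \<open>c\<close>.
    The section \<open>h\<close> may choose a time outside the interval \<open>\<pi> w\<close> if
    the clock rests at its ends; clamping corrects this without changing the clock, as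
    \<open>cA\<close> shows.\<close>
  define A where "A w z = max (a (\<pi> w)) (min (b (\<pi> w)) (h (lab w) z))" for w z
  define a' where "a' w = A w (u (lab w) w)" for w
  define b' where "b' w = A w (v (lab w) w)" for w

  have UT: "w \<in> U \<longleftrightarrow> lab w < ?k \<and> w \<in> Field (T (lab w))" for w
    using labT by (auto simp: U_def lab_def)
  have UTs: "w \<in> U" "lab w = s" if "s < ?k" "w \<in> Field (T s)" for w s
    using that labT by (auto simp: U_def lab_def)
  have \<pi>T: "\<pi> w = \<psi> s w" if "s < ?k" "w \<in> Field (T s)" for w s
    using UTs[OF that] by (simp add: \<pi>_def)
  have \<pi>S: "\<pi> w \<in> Field S" "f (\<pi> w) = lab w" if "w \<in> U" for w
  proof -
    have "lab w < ?k" "w \<in> Field (T (lab w))"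
      using that UT by auto
    then have "\<pi> w \<in> Field (?P (lab w))"
      using \<pi>T ord_homD(2)[OF DT(3)] by metis
    then show "\<pi> w \<in> Field S" "f (\<pi> w) = lab w"
      using D(1) by auto
  qed
  have gw: "g (lab w) w < js ! lab w" "G w = offset js (lab w) + g (lab w) w" if "w \<in> U" for w
    using that DT(2)[of "lab w"] UT[of w] by (auto simp: G_def)
  have RT: "(w, w') \<in> R \<longleftrightarrow> (w, w') \<in> T s" if s: "s < ?k" and w: "w \<in> Field (T s)" "w' \<in> Field (T s)" for s w w'
  proof
    assume "(w, w') \<in> T s"
    moreover have "(\<psi> s w, \<psi> s w') \<in> ?P s"
      using ord_homD(3)[OF DT(3)[OF s] calculation] .
    ultimately show "(w, w') \<in> R"
      using UTs[OF s] \<pi>T[OF s] w by (simp add: R_def preimage_ord_def)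
  next
    assume R: "(w, w') \<in> R"
    show "(w, w') \<in> T s"
    proof (cases "\<pi> w = \<pi> w'")
      case True
      then show ?thesis using R UTs[OF s w(1)] by (auto simp: R_def)
    next
      case False
      have "(w', w) \<notin> T s"
      proof
        assume "(w', w) \<in> T s"
        from ord_homD(3)[OF DT(3)[OF s] this] have "(\<pi> w', \<pi> w) \<in> S"
          using \<pi>T[OF s] w by (simp add: preimage_ord_def)
        with R False show False
          using fin_ordD(4)[OF D(1)] by (auto simp: R_def)
      qed
      then show ?thesis
        using fin_ordD(6)[OF DT(1)[OF s] w] by blast
    qed
  qed
  have reflR: "(w, w) \<in> R" if "w \<in> U" for w
    using that \<pi>S[OF that] fin_ordD(3)[OF D(1)] fin_ordD(3)[OF DT(1)] UT[of w] by (auto simp: R_def)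
  have FR: "Field R = U"
    using reflR by (auto simp: R_def Field_def)
  have R: "R \<in> fin_ord"
    unfolding fin_ord_def linear_order_on_def partial_order_on_def preorder_on_def
  proof (intro CollectI conjI)
    show "finite (Field R)"
      unfolding FR U_def using fin_ordD(1)[OF DT(1)] by auto
    show "R \<subseteq> Field R \<times> Field R" by (auto simp: Field_def)
    show "refl_on (Field R) R" using reflR by (simp add: FR refl_on_def)
    show "antisym R"
    proof (rule antisymI)
      fix w w' assume ww: "(w, w') \<in> R" "(w', w) \<in> R"
      then have "\<pi> w = \<pi> w'"
        using fin_ordD(4)[OF D(1)] by (auto simp: R_def)
      moreover have "lab w = lab w'"
        using ww \<pi>S(2)[of w] \<pi>S(2)[of w'] calculation by (auto simp: R_def)
      ultimately show "w = w'"
        using ww UT[of w] fin_ordD(4)[OF DT(1)[of "lab w"], of w w'] by (auto simp: R_def)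
    qed
    show "trans R"
    proof (rule transI)
      fix w w' w'' assume ww: "(w, w') \<in> R" "(w', w'') \<in> R"
      have \<pi>\<pi>: "(\<pi> w, \<pi> w'') \<in> S"
        using ww fin_ordD(5)[OF D(1), of "\<pi> w" "\<pi> w'" "\<pi> w''"] by (auto simp: R_def)
      moreover have "(w, w'') \<in> T (lab w)" if eq: "\<pi> w = \<pi> w''"
      proof -
        have e: "\<pi> w = \<pi> w'"
          using ww eq fin_ordD(4)[OF D(1)] by (auto simp: R_def)
        then have "lab w = lab w'"
          using ww \<pi>S(2)[of w] \<pi>S(2)[of w'] by (auto simp: R_def)
        then show ?thesis
          using ww e eq UT[of w] fin_ordD(5)[OF DT(1)[of "lab w"], of w w' w''] by (auto simp: R_def)
      qed
      ultimately show "(w, w'') \<in> R"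
        using ww by (auto simp: R_def)
    qed
    show "total_on (Field R) R"
      unfolding total_on_def FR
    proof (intro ballI impI)
      fix w w' assume w: "w \<in> U" "w' \<in> U"
      show "(w, w') \<in> R \<or> (w', w) \<in> R"
      proof (cases "\<pi> w = \<pi> w'")
        case True
        then have "lab w = lab w'"
          using \<pi>S(2)[OF w(1)] \<pi>S(2)[OF w(2)] by simp
        then show ?thesis
          using RT[of "lab w" w w'] RT[of "lab w" w' w] UT[of w] UT[of w'] w
            fin_ordD(6)[OF DT(1)[of "lab w"], of w w'] by auto
      next
        case False
        then show ?thesis
          using fin_ordD(6)[OF D(1) \<pi>S(1)[OF w(1)] \<pi>S(1)[OF w(2)]] w by (auto simp: R_def)
      qed
    qed
  qed
  have pre: "preimage_ord R lab {s} = T s" if s: "s < ?k" for s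
  proof -
    have "{w \<in> U. lab w \<in> {s}} = Field (T s)"
      using UT UTs[OF s] s by auto
    then have "preimage_ord R lab {s} = Restr R (Field (T s))"
      by (simp add: preimage_ord_def FR)
    also have "\<dots> = T s"
    proof (intro equalityI subsetI)
      fix x assume "x \<in> Restr R (Field (T s))"
      then show "x \<in> T s" using RT[OF s] by auto
    next
      fix x assume x: "x \<in> T s"
      then have "fst x \<in> Field (T s)" "snd x \<in> Field (T s)"
        by (cases x; auto intro: FieldI1 FieldI2)+
      then show "x \<in> Restr R (Field (T s))"
        using RT[OF s, of "fst x" "snd x"] x by (auto simp: mem_Times_iff)
    qed
    finally show ?thesis .
  qed
  have \<pi>hom: "\<pi> \<in> ord_hom R S"
  proof (rule ord_homI[OF _ _ R])
    show "\<pi> \<in> extensional (Field R)" unfolding FR by (simp add: \<pi>_def)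
  qed (simp add: R_def)

  have Ab: "a (\<pi> w) \<le> A w z" "A w z \<le> b (\<pi> w)" if "w \<in> U" for w z
    using D(4)[OF \<pi>S(1)[OF that]] by (auto simp: A_def)
  \<comment> \<open>By \<open>subdivision_lower_upper\<close> the cell of \<open>\<pi> w\<close> has
    the clock readings at the ends of the interval \<open>\<pi> w\<close> as its ends, so the first
    two inequalities are the cell condition of the inner subdivision.\<close>
  have uv: "c (Suc (lab w)) (a (\<pi> w)) \<le> u (lab w) w" "v (lab w) w \<le> c (Suc (lab w)) (b (\<pi> w))"
    "0 \<le> u (lab w) w" "u (lab w) w \<le> v (lab w) w" "v (lab w) w \<le> 1" if w: "w \<in> U" for w
  proof -
    have s: "lab w < ?k" "w \<in> Field (T (lab w))"
      using w UT by auto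
    have "\<psi> (lab w) w = \<pi> w"
      using \<pi>T[OF s] by simp
    then show "c (Suc (lab w)) (a (\<pi> w)) \<le> u (lab w) w" "v (lab w) w \<le> c (Suc (lab w)) (b (\<pi> w))"
      using DT(6)[OF s] subdivision_lower_upper[OF sub s(1) up[OF s(1)] \<pi>S[OF w]] by auto
    show "0 \<le> u (lab w) w" "u (lab w) w \<le> v (lab w) w" "v (lab w) w \<le> 1"
      using DT(4)[OF s] by auto
  qed
  have cA: "c (Suc (lab w)) (A w z) = z"
    if w: "w \<in> U" and z: "u (lab w) w \<le> z" "z \<le> v (lab w) w" for w z
  proof -
    have s: "lab w < ?k" using w UT by auto
    have z01: "0 \<le> z" "z \<le> 1" using uv[OF w] z by auto
    have "c (Suc (lab w)) (A w z) = c (Suc (lab w)) (h (lab w) z)"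
      unfolding A_def using D(4)[OF \<pi>S(1)[OF w]] uv[OF w] z h(1)[OF s z01]
      by (intro unit_path_clamped[OF up[OF s]]) auto
    then show ?thesis using h(1)[OF s z01] by simp
  qed
  have Amono: "A w z \<le> A w' z'" if "w \<in> U" "lab w = lab w'" "\<pi> w = \<pi> w'" "0 \<le> z" "z \<le> z'" "z' \<le> 1" for w w' z z'
    using h(2)[of "lab w" z z'] that UT[of w] unfolding A_def by (auto intro!: max.mono min.mono)
  have ca': "c (Suc (lab w)) (a' w) = u (lab w) w" "c (Suc (lab w)) (b' w) = v (lab w) w" if "w \<in> U" for w
    using cA[OF that] uv[OF that] by (auto simp: a'_def b'_def)
  have fibG: "w \<in> U \<and> G w = offset js s + j \<longleftrightarrow> w \<in> Field (T s) \<and> g s w = j" if s: "s < ?k" "j < js ! s" for s j w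
  proof
    assume w: "w \<in> U \<and> G w = offset js s + j"
    then have "unindex js (offset js (lab w) + g (lab w) w) = unindex js (offset js s + j)"
      using gw[of w] by simp
    then have "lab w = s" "g (lab w) w = j"
      using w gw[of w] UT[of w] s by auto
    then show "w \<in> Field (T s) \<and> g s w = j"
      using w UT[of w] by auto
  next
    assume "w \<in> Field (T s) \<and> g s w = j"
    then show "w \<in> U \<and> G w = offset js s + j"
      using UTs[OF s(1)] gw[of w] by auto
  qed
  have C: "op_comp js (c, d) \<in> op_set (sum_list js)"
    by (rule op_comp_in[OF c d])
  have subR: "subdivision (sum_list js) ?C r p R G (compose U \<phi> \<pi>) a' b'"
    unfolding subdivision_def FR
  proof (intro conjI R)
    show "G \<in> U \<rightarrow>\<^sub>E {..<sum_list js}"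
      using gw UT by (auto simp: G_def)
    show "compose U \<phi> \<pi> \<in> ord_hom R r"
      using ord_hom_compose[OF R \<pi>hom D(3)] by (simp add: FR)
    show "\<forall>w\<in>U. 0 \<le> a' w \<and> a' w \<le> b' w \<and> b' w \<le> 1"
    proof
      fix w assume w: "w \<in> U"
      have "0 \<le> a' w" "b' w \<le> 1"
        using Ab[OF w] D(4)[OF \<pi>S(1)[OF w]] unfolding a'_def b'_def by (meson order.trans)+
      moreover have "a' w \<le> b' w"
        unfolding a'_def b'_def using uv[OF w] w by (intro Amono) auto
      ultimately show "0 \<le> a' w \<and> a' w \<le> b' w \<and> b' w \<le> 1" by simp
    qed
    show "\<forall>(w, w')\<in>R. w \<noteq> w' \<longrightarrow> b' w \<le> a' w'"
    proof clarify
      fix w w' assume ww: "(w, w') \<in> R" "w \<noteq> w'"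
      then have w: "w \<in> U" "w' \<in> U" "(\<pi> w, \<pi> w') \<in> S"
        by (auto simp: R_def)
      show "b' w \<le> a' w'"
      proof (cases "\<pi> w = \<pi> w'")
        case True
        then have l: "lab w = lab w'"
          using \<pi>S(2)[OF w(1)] \<pi>S(2)[OF w(2)] by simp
        have "v (lab w) w \<le> u (lab w) w'"
          using ww True DT(5)[of "lab w" w w'] UT[of w] w by (auto simp: R_def)
        then show ?thesis
          unfolding a'_def b'_def using uv[OF w(1)] uv[OF w(2)] l True w by (intro Amono) auto
      next
        case False
        then have "b (\<pi> w) \<le> a (\<pi> w')"
          using D(5)[OF w(3)] by simp
        then show ?thesis
          using Ab(2)[OF w(1)] Ab(1)[OF w(2)] unfolding a'_def b'_def by (meson order.trans)
      qed
    qed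
    show "\<forall>w\<in>U. lower r p (compose U \<phi> \<pi> w) \<le> a' w \<and> b' w \<le> upper r p (compose U \<phi> \<pi> w)"
    proof
      fix w assume w: "w \<in> U"
      then show "lower r p (compose U \<phi> \<pi> w) \<le> a' w \<and> b' w \<le> upper r p (compose U \<phi> \<pi> w)"
        using Ab[OF w] D(6)[OF \<pi>S(1)[OF w]] unfolding a'_def b'_def compose_def
        by (simp, meson order.trans)
    qed
    show "\<forall>n<sum_list js. (\<Sum>w\<in>{w \<in> U. G w = n}. ?C n (b' w) - ?C n (a' w)) = 1"
    proof (intro allI impI)
      fix n assume "n < sum_list js"
      then obtain s j where s: "s < ?k" "j < js ! s" "n = offset js s + j"
        using block_cases by blast
      have "(\<Sum>w\<in>{w \<in> U. G w = n}. ?C n (b' w) - ?C n (a' w))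
        = (\<Sum>w\<in>{w \<in> Field (T s). g s w = j}. d s (Suc j) (v s w) - d s (Suc j) (u s w))"
      proof (rule sum.cong)
        show "{w \<in> U. G w = n} = {w \<in> Field (T s). g s w = j}"
          using fibG[OF s(1,2)] s(3) by blast
        fix w assume "w \<in> {w \<in> Field (T s). g s w = j}"
        then have "w \<in> U" "lab w = s" using UTs[OF s(1)] by auto
        then show "?C n (b' w) - ?C n (a' w) = d s (Suc j) (v s w) - d s (Suc j) (u s w)"
          using ca'[of w] s by simp
      qed
      then show "(\<Sum>w\<in>{w \<in> U. G w = n}. ?C n (b' w) - ?C n (a' w)) = 1"
        using DT(7)[OF s(1,2)] by simp
    qed
  qed

  let ?Q = "weight ?C R G a' b'"
  let ?x = "\<lambda>n. y n (preimage_ord R G {n}) (?Q n)"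
  let ?J = "\<lambda>s. (\<lambda>j. offset js s + j) ` {..<js ! s}"
  let ?z = "\<lambda>s j. block js y s j (preimage_ord (T s) (g s) {j}) (weight (\<lambda>i. d s (Suc i)) (T s) (g s) (u s) (v s) j)"
  have xin: "?x n \<in> topspace (X (preimage_ord R G {n}))" if n: "n < sum_list js" for n
    using TotD(4)[OF y[OF n] preimage_ord_fin_ord[OF R] weight_in_simplex[OF subR n]] op_setD(2)[OF C n]
    by blast
  have preG: "preimage_ord R G {offset js s + j} = preimage_ord (T s) (g s) {j}" if s: "s < ?k" "j < js ! s" for s j
  proof -
    have "{w \<in> U. G w = offset js s + j} = {w \<in> Field (T s). g s w = j}"
      using fibG[OF s] by blast
    moreover have "Restr (T s) {w \<in> Field (T s). g s w = j} = Restr R {w \<in> Field (T s). g s w = j}"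
      using RT[OF s(1)] by auto
    ultimately show ?thesis
      by (simp only: Restr_preimage(2)[symmetric] FR)
  qed
  have xz: "?x (offset js s + j) = ?z s j" if s: "s < ?k" "j < js ! s" for s j
  proof -
    have "?Q (offset js s + j) = weight (\<lambda>i. d s (Suc i)) (T s) (g s) (u s) (v s) j"
    proof
      fix w
      show "?Q (offset js s + j) w = weight (\<lambda>i. d s (Suc i)) (T s) (g s) (u s) (v s) j w"
      proof (cases "w \<in> Field (T s) \<and> g s w = j")
        case True
        then have "w \<in> U" "lab w = s" "G w = offset js s + j"
          using fibG[OF s, of w] UTs[OF s(1)] by auto
        with True show ?thesis
          using ca'[of w] s by (simp add: weight_def FR)
      next
        case False
        then have "\<not> (w \<in> U \<and> G w = offset js s + j)"
          using fibG[OF s, of w] by blast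
        with False show ?thesis
          unfolding weight_def FR by auto
      qed
    qed
    then show ?thesis
      using preG[OF s] s by (simp add: block_def)
  qed
  have zin: "?z s j \<in> topspace (X (preimage_ord (T s) (g s) {j}))" if s: "s < ?k" "j < js ! s" for s j
    using xin[OF offset_less[OF s]] xz[OF s] preG[OF s] by simp
  have inner: "brs R (?J s) G ?x = brs (T s) {..<js ! s} (g s) (?z s)" if s: "s < ?k" for s
  proof -
    have TR: "Restr R (Field (T s)) = T s" and sub: "Field (T s) \<subseteq> Field R"
    proof -
      have "{w \<in> U. lab w \<in> {s}} = Field (T s)"
        using UT UTs[OF s] s by auto
      then show "Restr R (Field (T s)) = T s" "Field (T s) \<subseteq> Field R"
        using pre[OF s] by (auto simp: preimage_ord_def FR)
    qed
    \<comment> \<open>Labels of block \<open>s\<close> occur only on \<open>Field (T s)\<close>, so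
      the bracket may be formed there.\<close>
    have "brs R (?J s) G ?x = brs (T s) (?J s) G ?x"
    proof (rule brs_Restr[OF R sub, unfolded TR, symmetric])
      fix w assume "w \<in> Field R" "G w \<in> ?J s"
      then obtain j where "j < js ! s" "w \<in> U" "G w = offset js s + j" by (auto simp: FR)
      then show "w \<in> Field (T s)" using fibG[OF s, of j w] by blast
    next
      fix n assume "n \<in> ?J s"
      then show "?x n \<in> topspace (X (preimage_ord R G {n}))"
        using s by (intro xin) auto
    qed simp
    also have "\<dots> = brs (T s) {..<js ! s} (g s) (\<lambda>j. ?x (offset js s + j))"
    proof (rule brs_reindex[OF DT(1)[OF s]])
      fix j assume "j \<in> {..<js ! s}"
      then have j: "j < js ! s" by simp
      have "preimage_ord (T s) G {offset js s + j} = preimage_ord (T s) (g s) {j}"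
      proof -
        have "{w \<in> Field (T s). G w = offset js s + j} = {w \<in> Field (T s). g s w = j}"
          using fibG[OF s j] UTs(1)[OF s] by blast
        then show ?thesis by (simp only: Restr_preimage(2)[symmetric])
      qed
      then show "?x (offset js s + j) \<in> topspace (X (preimage_ord (T s) G {offset js s + j}))"
        using zin[OF s j] xz[OF s j] by simp
      fix w assume "w \<in> Field (T s)"
      then show "G w = offset js s + j \<longleftrightarrow> g s w = j"
        using fibG[OF s j, of w] UTs(1)[OF s] by blast
    qed (auto simp: inj_on_def)
    also have "\<dots> = brs (T s) {..<js ! s} (g s) (?z s)"
      using xz[OF s] zin[OF s] by (intro brs_cong[OF DT(1)[OF s]]) auto
    finally show ?thesis .
  qed
  have bin: "brs (T s) {..<js ! s} (g s) (?z s) \<in> topspace (X (T s))" if s: "s < ?k" for s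
    using zin[OF s] DT(2)[OF s] by (intro brs_in[OF DT(1)[OF s]]) auto
  have split: "{..<sum_list js} = (\<Union>s\<in>{..<?k}. ?J s)"
  proof (intro equalityI subsetI)
    fix n assume "n \<in> {..<sum_list js}"
    then have "n < sum_list js" by simp
    then obtain s j where "s < ?k" "j < js ! s" "n = offset js s + j"
      using block_cases by blast
    then show "n \<in> (\<Union>s\<in>{..<?k}. ?J s)" by blast
  next
    fix n assume "n \<in> (\<Union>s\<in>{..<?k}. ?J s)"
    then show "n \<in> {..<sum_list js}" by auto
  qed
  \<comment> \<open>Associativity: the composite labels are grouped by blocks, and the induced
    labelling is \<open>lab\<close>.\<close>
  have "brs R {..<sum_list js} G ?x = brs R {..<?k} lab (\<lambda>s. brs R (?J s) G ?x)"
    unfolding split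
  proof (rule brs_UN[OF R])
    show "disjoint_family_on ?J {..<?k}"
      unfolding disjoint_family_on_def
    proof (intro ballI impI)
      fix s s' assume s: "s \<in> {..<?k}" "s' \<in> {..<?k}" "s \<noteq> s'"
      have False if "j < js ! s" "j' < js ! s'" "offset js s + j = offset js s' + j'" for j j'
        using unindex_offset[of s js j] unindex_offset[of s' js j'] that s by simp
      then show "?J s \<inter> ?J s' = {}" by blast
    qed
    fix s j assume "s \<in> {..<?k}" "j \<in> ?J s"
    then show "?x j \<in> topspace (X (preimage_ord R G {j}))"
      by (intro xin) auto
  next
    fix w s assume w: "w \<in> Field R" and s: "s \<in> {..<?k}"
    show "lab w = s \<longleftrightarrow> G w \<in> ?J s"
    proof
      assume "lab w = s"
      then show "G w \<in> ?J s" using w gw[of w] by (auto simp: FR)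
    next
      assume "G w \<in> ?J s"
      then obtain j where "j < js ! s" "G w = offset js s + j" by auto
      then have "w \<in> Field (T s)" using fibG[of s j w] w s by (auto simp: FR)
      then show "lab w = s" using UTs s by auto
    qed
  qed auto
  also have "\<dots> = brs R {..<?k} lab (\<lambda>s. brs (T s) {..<js ! s} (g s) (?z s))"
    using inner bin by (intro brs_cong[OF R]) (auto simp: pre)
  finally have brsR: "brs R {..<sum_list js} G ?x = brs R {..<?k} lab (\<lambda>s. brs (T s) {..<js ! s} (g s) (?z s))" .

  have labk: "lab \<in> Field R \<rightarrow> {..<?k}"
    using UT by (auto simp: FR)
  have fk: "f \<in> Field S \<rightarrow> {..<?k}"
    using D(2) by auto
  have rT: "restrict \<pi> (Field (T s)) = \<psi> s" if s: "s < ?k" for s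
    using \<pi>T[OF s] ord_homD(1)[OF DT(3)[OF s]] by (auto simp: fun_eq_iff extensional_def)
  have act: "push (T s) (?P s) (\<psi> s) (brs (T s) {..<js ! s} (g s) (?z s)) = ?H s (?P s) (?q s)" if s: "s < ?k" for s
  proof -
    have "?H s (?P s) (?q s) = action_val (js ! s) (d s) (block js y s) (?P s) (?q s)"
      using s action_apply[OF P q[OF s]] by simp
    also have "\<dots> = val (js ! s) (block js y s) (T s) (?P s) (g s) (\<psi> s)
        (weight (\<lambda>i. d s (Suc i)) (T s) (g s) (u s) (v s))"
      by (rule action_val_eq[OF d[OF s] P q[OF s] yb[OF s] subT[OF s]])
    finally show ?thesis by (simp add: val_def)
  qed
  have Lin: "brs R {..<sum_list js} G ?x \<in> topspace (X R)"
    by (rule val_in(1)[OF r _ y subR]) (rule op_setD(2)[OF C])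
  have "push R S \<pi> (brs R {..<sum_list js} G ?x)
      = push R S \<pi> (brs R {..<?k} lab (\<lambda>s. brs (T s) {..<js ! s} (g s) (?z s)))"
    by (simp only: brsR)
  \<comment> \<open>Naturality along \<open>\<pi>\<close> carries each inner bracket to the fibre
    \<open>?P s\<close> of \<open>S\<close>; by \<open>act\<close> it becomes there the value of the
    inner action at \<open>?q s\<close>.\<close>
  also have "\<dots> = brs S {..<?k} f (\<lambda>s. push (preimage_ord R lab {s}) (?P s)
      (restrict \<pi> (Field (preimage_ord R lab {s}))) (brs (T s) {..<js ! s} (g s) (?z s)))"
  proof -
    have "restrict \<pi> (Field R) = \<pi>"
      using ord_homD(1)[OF \<pi>hom] by (rule extensional_restrict)
    then show ?thesis
      using brs_push[OF R D(1) \<pi>hom, of f lab "{..<?k}" "\<lambda>s. brs (T s) {..<js ! s} (g s) (?z s)"]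
        \<pi>S(2) bin by (simp add: preimage_ord_all[OF labk] preimage_ord_all[OF fk] FR pre)
  qed
  also have "\<dots> = brs S {..<?k} f (\<lambda>s. ?H s (?P s) (?q s))"
  proof (rule brs_cong[OF D(1)])
    fix s assume "s \<in> {..<?k}"
    then have s: "s < ?k" by simp
    show eq: "push (preimage_ord R lab {s}) (?P s) (restrict \<pi> (Field (preimage_ord R lab {s})))
        (brs (T s) {..<js ! s} (g s) (?z s)) = ?H s (?P s) (?q s)"
      unfolding pre[OF s] rT[OF s] by (rule act[OF s])
    show "push (preimage_ord R lab {s}) (?P s) (restrict \<pi> (Field (preimage_ord R lab {s})))
        (brs (T s) {..<js ! s} (g s) (?z s)) \<in> topspace (X (?P s))"
      unfolding eq by (rule TotD(4)[OF H[OF s] P q[OF s]])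
  qed auto
  finally have key: "push R S \<pi> (brs R {..<sum_list js} G ?x) = brs S {..<?k} f (\<lambda>s. ?H s (?P s) (?q s))" .
  have "action_val (sum_list js) (op_comp js (c, d)) y r p = val (sum_list js) y R r G (compose U \<phi> \<pi>) ?Q"
    by (rule action_val_eq[OF C r p y subR])
  also have "\<dots> = push S r \<phi> (push R S \<pi> (brs R {..<sum_list js} G ?x))"
    unfolding val_def using push_compose[OF R D(1) r \<pi>hom D(3) Lin] by (simp only: FR)
  also have "\<dots> = val ?k ?H S r f \<phi> ?q"
    unfolding key val_def ..
  also have "\<dots> = action_val ?k c ?H r p"
    by (rule action_val_eq[OF c r p H sub, symmetric])
  finally show ?thesis .
qed

lemma Tot_operad_action: "operad_action op_space op_act op_one op_comp (Tot X push) action"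
proof -
  interpret operad op_space op_act op_one op_comp
    by (rule lattice_path_operad)
  show ?thesis
  proof
    fix k
    show "continuous_map (prod_topology (op_space k) (product_topology (\<lambda>_. Tot X push) {..<k})) (Tot X push) (action k)"
      by (rule action_continuous)
  next
    fix h assume "h \<in> topspace (Tot X push)"
    then show "action 1 (op_one, \<lambda>i\<in>{..<1}. h) = h" by (rule action_one)
  next
    fix c js d y
    assume c: "c \<in> topspace (op_space (length js))"
      and d: "d \<in> (\<Pi>\<^sub>E s\<in>{..<length js}. topspace (op_space (js ! s)))"
      and y: "y \<in> {..<sum_list js} \<rightarrow>\<^sub>E topspace (Tot X push)"
    have c': "c \<in> op_set (length js)" using c by simp
    have d': "d s \<in> op_set (js ! s)" if "s < length js" for s
      using PiE_mem[OF d, of s] that by simp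
    have y': "y n \<in> topspace (Tot X push)" if "n < sum_list js" for n
      using PiE_mem[OF y, of n] that by simp
    have yE: "y \<in> extensional {..<sum_list js}"
      using y by (simp add: PiE_iff)
    let ?H = "\<lambda>s\<in>{..<length js}. action (js ! s) (d s, block js y s)"
    have H: "?H s \<in> topspace (Tot X push)" if s: "s < length js" for s
    proof -
      have "action (js ! s) (d s, block js y s) \<in> topspace (Tot X push)"
        using s by (intro action_in[OF d'[OF s]]) (simp_all add: block_def y')
      then show ?thesis using s by simp
    qed
    show "action (sum_list js) (op_comp js (c, d), y) = action (length js) (c, ?H)"
    proof (rule Tot_eqI[OF action_in[OF op_comp_in[OF c' d'] y' yE] action_in[OF c' H restrict_extensional]])
      fix r p assume r: "r \<in> fin_ord" and p: "p \<in> topspace (simplex_space r)"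
      show "action (sum_list js) (op_comp js (c, d), y) r p = action (length js) (c, ?H) r p"
        unfolding action_apply[OF r p] by (rule action_comp_val[OF c' d' y' r p])
    qed
  next
    fix c k y \<sigma>
    assume "c \<in> topspace (op_space k)" "y \<in> {..<k} \<rightarrow>\<^sub>E topspace (Tot X push)" "\<sigma> permutes {..<k}"
    then show "action k (op_act k c \<sigma>, y) = action k (c, permute_tuple k \<sigma> y)"
      by (intro action_equivariant) simp_all
  qed
qed

end

theorem theorem8p3:
  fixes X :: "nat rel \<Rightarrow> 'a topology"
    and push :: "nat rel \<Rightarrow> nat rel \<Rightarrow> (nat \<Rightarrow> nat) \<Rightarrow> 'a \<Rightarrow> 'a"
    and br :: "nat rel \<Rightarrow> (nat \<Rightarrow> nat) \<Rightarrow> 'a \<times> 'a \<Rightarrow> 'a"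
  assumes cosimplicial: "augmented_cosimplicial_space X push"
    and continuous:
      "\<And>T f. \<lbrakk>T \<in> fin_ord; f \<in> Field T \<rightarrow>\<^sub>E {1, 2}\<rbrakk> \<Longrightarrow>
         continuous_map
           (prod_topology (X (preimage_ord T f {1})) (X (preimage_ord T f {2}))) (X T) (br T f)"
    and compatible:
      "\<And>T T' \<phi> f g x y.
         \<lbrakk>T \<in> fin_ord; T' \<in> fin_ord; \<phi> \<in> ord_hom T T';
          f \<in> Field T \<rightarrow>\<^sub>E {1, 2}; g \<in> Field T' \<rightarrow>\<^sub>E {1, 2}; compose (Field T) g \<phi> = f;
          x \<in> topspace (X (preimage_ord T f {1})); y \<in> topspace (X (preimage_ord T f {2}))\<rbrakk> \<Longrightarrow>
         push T T' \<phi> (br T f (x, y)) =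
         br T' g
           (push (preimage_ord T f {1}) (preimage_ord T' g {1})
              (restrict \<phi> (Field (preimage_ord T f {1}))) x,
            push (preimage_ord T f {2}) (preimage_ord T' g {2})
              (restrict \<phi> (Field (preimage_ord T f {2}))) y)"
    and commutative:
      "\<And>T f x y.
         \<lbrakk>T \<in> fin_ord; f \<in> Field T \<rightarrow>\<^sub>E {1, 2};
          x \<in> topspace (X (preimage_ord T f {1})); y \<in> topspace (X (preimage_ord T f {2}))\<rbrakk> \<Longrightarrow>
         br T f (x, y) = br T (\<lambda>i\<in>Field T. if f i = 1 then 2 else 1) (y, x)"
    and associative:
      "\<And>T g x y z.
         \<lbrakk>T \<in> fin_ord; g \<in> Field T \<rightarrow>\<^sub>E {1, 2, 3};
          x \<in> topspace (X (preimage_ord T g {1})); y \<in> topspace (X (preimage_ord T g {2}));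
          z \<in> topspace (X (preimage_ord T g {3}))\<rbrakk> \<Longrightarrow>
         br T (\<lambda>i\<in>Field T. if g i = 3 then 2 else 1)
           (br (preimage_ord T g {1, 2}) (\<lambda>i\<in>Field (preimage_ord T g {1, 2}). g i) (x, y), z) =
         br T (\<lambda>i\<in>Field T. if g i = 1 then 1 else 2)
           (x, br (preimage_ord T g {2, 3}) (\<lambda>i\<in>Field (preimage_ord T g {2, 3}). g i - 1) (y, z))"
    and unit:
      "\<exists>\<epsilon> \<in> topspace (X {}). \<forall>T \<in> fin_ord. \<forall>x \<in> topspace (X T).
         br T (\<lambda>i\<in>Field T. 1) (x, \<epsilon>) = x \<and> br T (\<lambda>i\<in>Field T. 2) (\<epsilon>, x) = x"
  shows "E_infinity_space (Tot X push)"
proof -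
  obtain \<epsilon> where \<epsilon>: "\<epsilon> \<in> topspace (X {})"
    "\<And>T x. T \<in> fin_ord \<Longrightarrow> x \<in> topspace (X T) \<Longrightarrow> br T (\<lambda>i\<in>Field T. 1) (x, \<epsilon>) = x"
    using unit by blast
  interpret cosimplicial_brackets X push br \<epsilon>
    by (intro cosimplicial_brackets.intro cosimplicial cosimplicial_brackets_axioms.intro)
       (fact continuous compatible commutative associative \<epsilon>)+
  show ?thesis
    unfolding E_infinity_space_def
    using lattice_path_E_infinity Tot_operad_action by blast
qed

end
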